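(* Let $(\widetilde{\mathbf{x}},\rho,\widetilde{B})$ be a generalized seed of geometric type with $\mathbf{ex}=[1,n]$. If $(\widetilde{\mathbf{x}},\rho,\widetilde{B})$ is acyclic and coprime, then the standard monomials in $\{x_1,x'_1,\ldots,x_n,x'_n\}$ form a $\mathbb{ZP}$-basis of the generalized cluster algebra $\mathcal{A}(\widetilde{\mathbf{x}},\rho,\widetilde{B})$.
   Context: Notation: $[i,j]=\{i,i+1,\ldots,j\}$; $[a]_+=a$ if $a\ge 0$ and $[a]_+=0$ otherwise. Let $m\ge n\ge 1$ be integers and let $\mathbf{ex}=[1,n]$. Generalized seed (of geometric type): a triple $(\widetilde{\mathbf{x}},\rho,\widetilde{B})$ with the following data. (1) The extended cluster $\widetilde{\mathbf{x}}=\{x_1,\ldots,x_m\}$ is a set of $m$ algebraically independent elements freely generating the field $\mathbb{Q}(x_1,\ldots,x_m)$; $\mathbf{x}=\{x_1,\ldots,x_n\}$ is the cluster, its elements are the cluster variables, and $x_{n+1},\ldots,x_m$ are the frozen variables. $\mathbb{P}$ is the multiplicative free abelian group generated by the frozen variables, and $\mathbb{ZP}$ is its integer group ring (the Laurent polynomial ring over $\mathbb{Z}$ in the frozen variables). (2) $\widetilde{B}=(b_{ij})$ is an $m\times n$ integer matrix whose principal part $B$ (rows $1,\ldots,n$) is skew-symmetrizable, i.e. $DB$ is skew-symmetric for some diagonal matrix $D$ with positive integer diagonal entries. For each $s\in[1,n]$ there is a given positive integer $d_s$ dividing $b_{is}$ for all $i\in[1,m]$, and $\beta_{is}:=b_{is}/d_s$.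 (3) $\rho=\{\rho_i\mid i\in[1,n]\}$, where the $i$th string $\rho_i=\{\rho_{i,0},\ldots,\rho_{i,d_i}\}$ satisfies $\rho_{i,0}=\rho_{i,d_i}=1$ and, for $1\le j\le d_i-1$, $\rho_{i,j}$ is a monomial in $\mathbb{Z}[x_{n+1},\ldots,x_m]$ (an integer coefficient is allowed). For $i\in[1,n]$ put $P_i:=\sum_{r=0}^{d_i}\rho_{i,r}\prod_{j=1}^m x_j^{r[\beta_{ji}]_+ +(d_i-r)[-\beta_{ji}]_+}$ and $x'_i:=x_i^{-1}P_i$. Mutation: for $i\in[1,n]$, $\mu_i(\widetilde{\mathbf{x}},\rho,\widetilde{B})=(\widetilde{\mathbf{x}}',\rho',\widetilde{B}')$ is the generalized seed with $\widetilde{\mathbf{x}}'=(\widetilde{\mathbf{x}}-\{x_i\})\cup\{x'_i\}$; $\rho'=\{\rho'_i\}\cup\{\rho_j\mid j\ne i\}$ where $\rho'_{i,r}=\rho_{i,d_i-r}$ for $0\le r\le d_i$; and $\widetilde{B}'=(b'_{kl})$ with $b'_{kl}=-b_{kl}$ if $k=i$ or $l=i$, and $b'_{kl}=b_{kl}+[b_{il}]_+b_{ki}+b_{il}[-b_{ki}]_+$ otherwise. The integers $d_s$ and the frozen variables are unchanged. Two generalized seeds are mutation-equivalent if one is obtained from the other by a finite sequence of mutations. Generalized cluster algebra: $\mathcal{A}(\widetilde{\mathbf{x}},\rho,\widetilde{B})$ is the $\mathbb{ZP}$-subalgebra of $\mathbb{Q}(x_1,\ldots,x_m)$ generated by all cluster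 variables from all generalized seeds mutation-equivalent to $(\widetilde{\mathbf{x}},\rho,\widetilde{B})$. Acyclic: the directed graph with vertex set $[1,n]$ and a directed edge $(i,j)$ if and only if $b_{ij}>0$ contains no oriented cycle. Coprime: $P_i$ and $P_j$ are coprime (have no common non-unit factor in $\mathbb{ZP}[x_1,\ldots,x_n]$) for any two different $i,j\in[1,n]$. Standard monomial in $\{x_1,x'_1,\ldots,x_n,x'_n\}$: a monomial in these elements (with nonnegative exponents) having no factor of the form $x_ix'_i$ for any $i\in[1,n]$.
   Formalization: The formal theorem also assumes every P_i is nonzero; otherwise (e.g. n=m=1, B=(0), d_1=2, ρ_1=(1,-2,1)) P_1=0, so x'_1=0 is a standard monomial and the claim fails. *)

theory Defs
  imports Complex_Main
begin

section \<open>Subrings and linear algebra inside a field\<close>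

definition is_subring :: "'k::comm_ring_1 set \<Rightarrow> bool" where
  "is_subring R \<longleftrightarrow> 1 \<in> R \<and> (\<forall>a\<in>R. \<forall>b\<in>R. a - b \<in> R \<and> a * b \<in> R)"

definition is_subfield :: "'k::field set \<Rightarrow> bool" where
  "is_subfield K \<longleftrightarrow> is_subring K \<and> (\<forall>a\<in>K. inverse a \<in> K)"

text \<open>Families \<open>v\<close> indexed by a set \<open>E\<close>, with scalars in a subring \<open>R\<close> of the ambient ring.\<close>

definition lin_indep :: "'k::comm_ring_1 set \<Rightarrow> 'e set \<Rightarrow> ('e \<Rightarrow> 'k) \<Rightarrow> bool" where
  "lin_indep R E v \<longleftrightarrow>
     (\<forall>T c. finite T \<and> T \<subseteq> E \<and> c ` T \<subseteq> R \<and> (\<Sum>e\<in>T. c e * v e) = 0 \<longrightarrow> (\<forall>e\<in>T. c e = 0))"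

definition lin_span :: "'k::comm_ring_1 set \<Rightarrow> 'e set \<Rightarrow> ('e \<Rightarrow> 'k) \<Rightarrow> 'k set" where
  "lin_span R E v = {\<Sum>e\<in>T. c e * v e | T c. finite T \<and> T \<subseteq> E \<and> c ` T \<subseteq> R}"

definition is_basis :: "'k::comm_ring_1 set \<Rightarrow> 'e set \<Rightarrow> ('e \<Rightarrow> 'k) \<Rightarrow> 'k set \<Rightarrow> bool" where
  "is_basis R E v M \<longleftrightarrow> lin_indep R E v \<and> lin_span R E v = M"

text \<open>No nontrivial polynomial relation with rational coefficients among \<open>x 1, \<dots>, x m\<close>; the
  exponent functions supported in \<open>{1..m}\<close> index the monomials.\<close>

definition alg_indep :: "nat \<Rightarrow> (nat \<Rightarrow> 'k::field_char_0) \<Rightarrow> bool" where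
  "alg_indep m x \<longleftrightarrow>
     lin_indep \<rat> {e :: nat \<Rightarrow> nat. \<forall>j. j \<notin> {1..m} \<longrightarrow> e j = 0} (\<lambda>e. \<Prod>j=1..m. x j ^ e j)"

section \<open>Generalized seeds of geometric type\<close>

text \<open>All indices start at 1: \<open>clus S j\<close> is \<open>x\<^sub>j\<close> for \<open>j \<in> {1..m}\<close> (frozen for \<open>j > n\<close>),
  \<open>rho S i r\<close> is \<open>\<rho>\<^bsub>i,r\<^esub>\<close> for \<open>i \<in> {1..n}\<close>, \<open>r \<le> d i\<close>, and \<open>bmat S j i\<close> is \<open>b\<^bsub>ji\<^esub>\<close> for
  \<open>j \<in> {1..m}\<close>, \<open>i \<in> {1..n}\<close>.  Values at other indices are never used.  The numbers \<open>m\<close>, \<open>n\<close>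
  and \<open>d\<close> do not change under mutation and are passed as parameters.\<close>

record 'k gseed =
  clus :: "nat \<Rightarrow> 'k"
  rho :: "nat \<Rightarrow> nat \<Rightarrow> 'k"
  bmat :: "nat \<Rightarrow> nat \<Rightarrow> int"

definition skew_symmetrizable :: "nat \<Rightarrow> (nat \<Rightarrow> nat \<Rightarrow> int) \<Rightarrow> bool" where
  "skew_symmetrizable n b \<longleftrightarrow>
     (\<exists>D :: nat \<Rightarrow> int. (\<forall>i\<in>{1..n}. D i > 0) \<and>
        (\<forall>i\<in>{1..n}. \<forall>j\<in>{1..n}. D i * b i j = - (D j * b j i)))"

definition frozen_monomial :: "nat \<Rightarrow> nat \<Rightarrow> (nat \<Rightarrow> 'k::field_char_0) \<Rightarrow> 'k \<Rightarrow> bool" where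
  "frozen_monomial m n x p \<longleftrightarrow>
     (\<exists>(c::int) (e :: nat \<Rightarrow> nat). p = of_int c * (\<Prod>j=n+1..m. x j ^ e j))"

text \<open>The type \<open>'k\<close> plays the role of the ambient field \<open>\<rat>(x\<^sub>1,\<dots>,x\<^sub>m)\<close>: the extended cluster is
  algebraically independent and generates all of it.\<close>

definition generalized_seed :: "nat \<Rightarrow> nat \<Rightarrow> (nat \<Rightarrow> nat) \<Rightarrow> 'k::field_char_0 gseed \<Rightarrow> bool" where
  "generalized_seed m n d S \<longleftrightarrow>
     alg_indep m (clus S) \<and> is_subfield hull (clus S ` {1..m}) = UNIV \<and>
     skew_symmetrizable n (bmat S) \<and>
     (\<forall>s\<in>{1..n}. d s > 0 \<and> (\<forall>i\<in>{1..m}. int (d s) dvd bmat S i s)) \<and>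
     (\<forall>i\<in>{1..n}. rho S i 0 = 1 \<and> rho S i (d i) = 1 \<and>
        (\<forall>r\<in>{1..<d i}. frozen_monomial m n (clus S) (rho S i r)))"

section \<open>Mutation and the generalized cluster algebra\<close>

text \<open>The coercion \<open>nat\<close> sends negative integers to 0, so it computes \<open>[a]\<^sub>+\<close>.\<close>

definition exch_poly :: "nat \<Rightarrow> (nat \<Rightarrow> nat) \<Rightarrow> 'k::field_char_0 gseed \<Rightarrow> nat \<Rightarrow> 'k" where
  "exch_poly m d S i =
     (\<Sum>r=0..d i. rho S i r *
        (\<Prod>j=1..m. let \<beta> = bmat S j i div int (d i)
                  in clus S j ^ (r * nat \<beta> + (d i - r) * nat (- \<beta>))))"

definition new_var :: "nat \<Rightarrow> (nat \<Rightarrow> nat) \<Rightarrow> 'k::field_char_0 gseed \<Rightarrow> nat \<Rightarrow> 'k" where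
  "new_var m d S i = inverse (clus S i) * exch_poly m d S i"

definition mutate :: "nat \<Rightarrow> (nat \<Rightarrow> nat) \<Rightarrow> nat \<Rightarrow> 'k::field_char_0 gseed \<Rightarrow> 'k gseed" where
  "mutate m d i S =
     \<lparr> clus = (clus S)(i := new_var m d S i),
       rho = (rho S)(i := (\<lambda>r. rho S i (d i - r))),
       bmat = (\<lambda>k l. if k = i \<or> l = i then - bmat S k l
                else bmat S k l + max (bmat S i l) 0 * bmat S k i
                       + bmat S i l * max (- bmat S k i) 0) \<rparr>"

definition mutation_equivalent ::
    "nat \<Rightarrow> nat \<Rightarrow> (nat \<Rightarrow> nat) \<Rightarrow> 'k::field_char_0 gseed \<Rightarrow> 'k gseed \<Rightarrow> bool" where
  "mutation_equivalent m n d = (\<lambda>S S'. \<exists>i\<in>{1..n}. S' = mutate m d i S)\<^sup>*\<^sup>*"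

text \<open>The Laurent polynomial ring in the frozen variables, as a subring of the ambient field.\<close>

definition ZP :: "nat \<Rightarrow> nat \<Rightarrow> 'k::field_char_0 gseed \<Rightarrow> 'k set" where
  "ZP m n S = is_subring hull (clus S ` {n+1..m} \<union> inverse ` clus S ` {n+1..m})"

definition generalized_cluster_algebra ::
    "nat \<Rightarrow> nat \<Rightarrow> (nat \<Rightarrow> nat) \<Rightarrow> 'k::field_char_0 gseed \<Rightarrow> 'k set" where
  "generalized_cluster_algebra m n d S =
     is_subring hull (ZP m n S \<union> {clus S' i | S' i. mutation_equivalent m n d S S' \<and> i \<in> {1..n}})"

section \<open>Acyclicity, coprimality, standard monomials\<close>

definition acyclic_seed :: "nat \<Rightarrow> 'k gseed \<Rightarrow> bool" where
  "acyclic_seed n S \<longleftrightarrow> acyclic {(i, j). i \<in> {1..n} \<and> j \<in> {1..n} \<and> bmat S i j > 0}"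

definition coprime_in :: "'k::comm_ring_1 set \<Rightarrow> 'k \<Rightarrow> 'k \<Rightarrow> bool" where
  "coprime_in R p q \<longleftrightarrow>
     (\<forall>f\<in>R. (\<exists>g\<in>R. p = f * g) \<and> (\<exists>h\<in>R. q = f * h) \<longrightarrow> (\<exists>u\<in>R. f * u = 1))"

definition coprime_seed :: "nat \<Rightarrow> nat \<Rightarrow> (nat \<Rightarrow> nat) \<Rightarrow> 'k::field_char_0 gseed \<Rightarrow> bool" where
  "coprime_seed m n d S \<longleftrightarrow>
     (\<forall>i\<in>{1..n}. \<forall>j\<in>{1..n}. i \<noteq> j \<longrightarrow>
        coprime_in (is_subring hull (ZP m n S \<union> clus S ` {1..n}))
          (exch_poly m d S i) (exch_poly m d S j))"

text \<open>A pair \<open>(a, a')\<close> encodes the exponents of the \<open>x\<^sub>i\<close> and of the \<open>x'\<^sub>i\<close>.\<close>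

definition standard_exps :: "nat \<Rightarrow> ((nat \<Rightarrow> nat) \<times> (nat \<Rightarrow> nat)) set" where
  "standard_exps n =
     {(a, a'). (\<forall>i. i \<notin> {1..n} \<longrightarrow> a i = 0 \<and> a' i = 0) \<and> (\<forall>i\<in>{1..n}. a i = 0 \<or> a' i = 0)}"

definition monomial_at ::
    "nat \<Rightarrow> nat \<Rightarrow> (nat \<Rightarrow> nat) \<Rightarrow> 'k::field_char_0 gseed \<Rightarrow> (nat \<Rightarrow> nat) \<times> (nat \<Rightarrow> nat) \<Rightarrow> 'k" where
  "monomial_at m n d S = (\<lambda>(a, a'). \<Prod>i=1..n. clus S i ^ a i * new_var m d S i ^ a' i)"

text \<open>If column \<open>i\<close> of the matrix vanishes then \<open>P\<^sub>i\<close> is the sum of the \<open>\<rho>\<^bsub>i,r\<^esub>\<close>, which can be 0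
  (e.g. \<open>d\<^sub>i = 2\<close>, \<open>\<rho>\<^bsub>i,1\<^esub> = -2\<close>); then \<open>x'\<^sub>i = 0\<close> and the mutation in direction \<open>i\<close> is not a
  generalized seed.  The following condition excludes exactly this.\<close>

definition mutable_seed :: "nat \<Rightarrow> nat \<Rightarrow> (nat \<Rightarrow> nat) \<Rightarrow> 'k::field_char_0 gseed \<Rightarrow> bool" where
  "mutable_seed m n d S \<longleftrightarrow> (\<forall>i\<in>{1..n}. exch_poly m d S i \<noteq> 0)"

end

(* Adjoin one new frozen variable per direction, so that the extended exchange matrix gets full rank.
   Then in every seed of the deformed pattern the exchange polynomials are coprime in the strong sense
   that P_i | P_j g implies P_i | g: some linear weight makes P_i homogeneous, while the lowest part of
   P_j is a unit monomial.

   For an acyclic set J of directions of such a seed, the Laurent polynomials which stay Laurent after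
   every single mutation in J are the polynomials in the x_j, x'_j with j in J over the Laurent ring of
   the other variables. This goes by induction on J, splitting off a source.

   Any two directions are acyclic, so this applies with J = {i, j} to every seed; it shows that passing
   back along a mutation does not enlarge the set of elements that are Laurent in a seed and all its
   neighbours. Hence all deformed cluster variables are Laurent in the initial seed and its neighbours,
   and J = {1..n} makes them polynomials in the x_i, x'_i. Setting the new variables to 1 gives the
   generators of the original algebra. Replacing x_i x'_i by P_i straightens products into standard
   monomials, which are independent because their lowest parts with respect to a source are. *)

theory Submission
  imports Defs "HOL-Library.Poly_Mapping" "HOL-Computational_Algebra.Polynomial_Factorial"
begin

section \<open>Subrings and spans of standard monomials\<close>

text \<open>Coprimality of the \<open>P_i\<close> in one seed can be lost by a mutation, whereas
  full rank of the extended matrix cannot; this is why the pattern is deformed before upper bounds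
  are compared. The final specialisation is a homomorphism on Laurent polynomials but is not defined
  on their whole fraction field, so the Laurent property of the deformed cluster variables has to be
  known before anything is specialised. All ring arguments are therefore made for formal Laurent
  polynomials (\<open>lau\<close>) and an arbitrary family \<open>p\<close> with a few properties of
  its exponents; seeds enter through evaluation. Such properties, unlike being an exchange
  polynomial, survive setting the variable of a source to 0, which the independence proof needs.
  Membership in the ring of one direction is tested by divisibility: the part of degree
  \<open>- r\<close> in \<open>x_k\<close> must be divisible by \<open>P_k ^ r\<close>. With the
  strong form of coprimality such powers cancel without appeal to unique factorisation.\<close>

lemma is_subring_hull: "is_subring (is_subring hull G)"
  by (rule hull_in) (auto simp: is_subring_def)

lemma subring_one: "is_subring R \<Longrightarrow> 1 \<in> R"
  by (simp add: is_subring_def)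

lemma subring_diff: "is_subring R \<Longrightarrow> a \<in> R \<Longrightarrow> b \<in> R \<Longrightarrow> a - b \<in> R"
  by (simp add: is_subring_def)

lemma subring_mult: "is_subring R \<Longrightarrow> a \<in> R \<Longrightarrow> b \<in> R \<Longrightarrow> a * b \<in> R"
  by (simp add: is_subring_def)

lemma subring_zero: "is_subring R \<Longrightarrow> 0 \<in> R"
  using subring_diff[of R 1 1] subring_one[of R] by simp

lemma subring_uminus: "is_subring R \<Longrightarrow> a \<in> R \<Longrightarrow> - a \<in> R"
  using subring_diff[of R 0 a] subring_zero[of R] by simp

lemma subring_add: "is_subring R \<Longrightarrow> a \<in> R \<Longrightarrow> b \<in> R \<Longrightarrow> a + b \<in> R"
  using subring_diff[of R a "- b"] subring_uminus[of R b] by simp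

lemma subring_power: "is_subring R \<Longrightarrow> a \<in> R \<Longrightarrow> a ^ k \<in> R"
  by (induction k) (auto intro: subring_one subring_mult)

lemma subring_sum: "is_subring R \<Longrightarrow> (\<And>i. i \<in> A \<Longrightarrow> f i \<in> R) \<Longrightarrow> sum f A \<in> R"
  by (induction A rule: infinite_finite_induct) (auto intro: subring_zero subring_add)

lemma subring_prod: "is_subring R \<Longrightarrow> (\<And>i. i \<in> A \<Longrightarrow> f i \<in> R) \<Longrightarrow> prod f A \<in> R"
  by (induction A rule: infinite_finite_induct) (auto intro: subring_one subring_mult)

lemma subring_of_nat: "is_subring R \<Longrightarrow> of_nat k \<in> R"
  by (induction k) (auto intro: subring_zero subring_one subring_add)

lemma subring_of_int: "is_subring R \<Longrightarrow> of_int k \<in> R"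
  by (cases k) (auto intro!: subring_diff subring_uminus subring_one subring_of_nat)

lemmas subring_intros = subring_one subring_zero subring_diff subring_mult subring_add
  subring_uminus subring_power subring_sum subring_prod subring_of_nat subring_of_int

text \<open>Additive subgroup generated by \<open>G\<close>. Its induction rule describes the
  elements of a subring hull once products of generators stay in the span
  (\<open>hull_subset_aspan\<close>).\<close>

inductive_set aspan :: "'a::ab_group_add set \<Rightarrow> 'a set" for G where
  base: "g \<in> G \<Longrightarrow> g \<in> aspan G"
| zero: "0 \<in> aspan G"
| diff: "a \<in> aspan G \<Longrightarrow> b \<in> aspan G \<Longrightarrow> a - b \<in> aspan G"

lemma aspan_minimal:
  assumes "G \<subseteq> T" "0 \<in> T" "\<And>a b. a \<in> T \<Longrightarrow> b \<in> T \<Longrightarrow> a - b \<in> T"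
  shows "aspan G \<subseteq> T"
proof
  fix a assume "a \<in> aspan G"
  then show "a \<in> T" by induction (use assms in auto)
qed

lemma aspan_mult_left:
  fixes c :: "'a::ring"
  assumes "a \<in> aspan G" "\<And>g. g \<in> G \<Longrightarrow> c * g \<in> aspan H"
  shows "c * a \<in> aspan H"
  using assms(1)
  by induction (auto simp: assms(2) right_diff_distrib intro: aspan.intros)

lemma aspan_mult:
  fixes G :: "'a::comm_ring set"
  assumes "a \<in> aspan G" "b \<in> aspan H" "\<And>g h. g \<in> G \<Longrightarrow> h \<in> H \<Longrightarrow> g * h \<in> aspan K"
  shows "a * b \<in> aspan K"
proof (rule aspan_mult_left[OF assms(2)])
  fix h assume h: "h \<in> H"
  have "h * a \<in> aspan K"
    by (rule aspan_mult_left[OF assms(1)]) (use h assms(3) in \<open>simp add: mult.commute\<close>)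
  then show "a * h \<in> aspan K" by (simp add: mult.commute)
qed

lemma is_subring_aspan:
  fixes G :: "'a::comm_ring_1 set"
  assumes "1 \<in> aspan G" "\<And>g h. g \<in> G \<Longrightarrow> h \<in> G \<Longrightarrow> g * h \<in> aspan G"
  shows "is_subring (aspan G)"
  unfolding is_subring_def using assms aspan_mult by (blast intro: aspan.diff)

lemma hull_subset_aspan:
  fixes G :: "'a::comm_ring_1 set"
  assumes "B \<subseteq> aspan G" "1 \<in> aspan G" "\<And>g h. g \<in> G \<Longrightarrow> h \<in> G \<Longrightarrow> g * h \<in> aspan G"
  shows "is_subring hull B \<subseteq> aspan G"
proof (rule hull_minimal[OF assms(1)])
  show "is_subring (aspan G)" by (rule is_subring_aspan) (use assms in auto)
qed

section \<open>Linear combinations and straightening into standard monomials\<close>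

lemma lin_indepD:
  assumes "lin_indep R E v" "finite T" "T \<subseteq> E" "\<And>e. e \<in> T \<Longrightarrow> c e \<in> R"
    "(\<Sum>e\<in>T. c e * v e) = 0" "e \<in> T"
  shows "c e = 0"
  using assms(1)[unfolded lin_indep_def, THEN spec, of T, THEN spec, of c] assms(2-) by auto

lemma lin_spanI:
  "finite T \<Longrightarrow> T \<subseteq> E \<Longrightarrow> c ` T \<subseteq> R \<Longrightarrow> (\<Sum>e\<in>T. c e * v e) \<in> lin_span R E v"
  unfolding lin_span_def by (intro CollectI exI[of _ T] exI[of _ c]) simp

lemma lin_span_diff:
  assumes R: "is_subring R" and a: "a \<in> lin_span R E v" and b: "b \<in> lin_span R E v"
  shows "a - b \<in> lin_span R E v"
proof -
  obtain T c where T: "a = (\<Sum>e\<in>T. c e * v e)" "finite T" "T \<subseteq> E" "c ` T \<subseteq> R"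
    using a by (auto simp: lin_span_def)
  obtain T' c' where T': "b = (\<Sum>e\<in>T'. c' e * v e)" "finite T'" "T' \<subseteq> E" "c' ` T' \<subseteq> R"
    using b by (auto simp: lin_span_def)
  define C where "C = (\<lambda>e. (if e \<in> T then c e else 0) - (if e \<in> T' then c' e else 0))"
  have "a = (\<Sum>e\<in>T \<union> T'. (if e \<in> T then c e else 0) * v e)"
    unfolding T(1) by (rule sum.mono_neutral_cong_left) (use T T' in auto)
  moreover have "b = (\<Sum>e\<in>T \<union> T'. (if e \<in> T' then c' e else 0) * v e)"
    unfolding T'(1) by (rule sum.mono_neutral_cong_left) (use T T' in auto)
  ultimately have "a - b = (\<Sum>e\<in>T \<union> T'. C e * v e)"
    by (simp add: C_def left_diff_distrib sum_subtractf)
  moreover have "C ` (T \<union> T') \<subseteq> R"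
  proof clarify
    fix e
    have "(if e \<in> T then c e else 0) \<in> R" "(if e \<in> T' then c' e else 0) \<in> R"
      using T(4) T'(4) subring_zero[OF R] by auto
    then show "C e \<in> R" unfolding C_def by (rule subring_diff[OF R])
  qed
  ultimately show ?thesis
    unfolding lin_span_def using T(2,3) T'(2,3) by (auto intro!: exI[of _ "T \<union> T'"] exI[of _ C])
qed

lemma aspan_subset_lin_span:
  assumes R: "is_subring R"
  shows "aspan {c * v e | c e. c \<in> R \<and> e \<in> E} \<subseteq> lin_span R E v"
proof (rule aspan_minimal)
  show "0 \<in> lin_span R E v"
    unfolding lin_span_def by (auto intro!: exI[of _ "{}"])
  show "{c * v e | c e. c \<in> R \<and> e \<in> E} \<subseteq> lin_span R E v"
  proof clarify
    fix c e assume "c \<in> R" "e \<in> E"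
    then show "c * v e \<in> lin_span R E v"
      unfolding lin_span_def by (auto intro!: exI[of _ "{e}"] exI[of _ "\<lambda>_. c"])
  qed
qed (rule lin_span_diff[OF R])

text \<open>One integer per index encodes both exponents: a positive value is a power of
  \<open>x j\<close>, a negative one a power of \<open>y j\<close>. The exclusion of factors
  \<open>x j * y j\<close> is thus built into the encoding.\<close>

definition std_mon :: "(nat \<Rightarrow> 'a) \<Rightarrow> (nat \<Rightarrow> 'a) \<Rightarrow> nat set \<Rightarrow> (nat \<Rightarrow> int) \<Rightarrow> 'a::comm_ring_1" where
  "std_mon x y J z = (\<Prod>j\<in>J. x j ^ nat (z j) * y j ^ nat (- z j))"

definition int_exps :: "nat set \<Rightarrow> (nat \<Rightarrow> int) set" where
  "int_exps J = {z. \<forall>j. j \<notin> J \<longrightarrow> z j = 0}"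

text \<open>Straightening: each factor \<open>x i * y i\<close> is replaced by a polynomial in the
  \<open>x j\<close> over \<open>R\<close>. The replacement introduces no \<open>y j\<close>, so the
  total exponent of the \<open>y j\<close> drops and the process ends in standard monomials.\<close>

lemma hull_subset_std_span:
  fixes R :: "'a::comm_ring_1 set"
  assumes R: "is_subring R" and J: "finite J"
    and xy: "\<And>j. j \<in> J \<Longrightarrow> x j * y j \<in> is_subring hull (R \<union> x ` J)"
  shows "is_subring hull (R \<union> x ` J \<union> y ` J) \<subseteq> lin_span R (int_exps J) (std_mon x y J)"
proof -
  define G where "G = {c * std_mon x y J z | c z. c \<in> R \<and> z \<in> int_exps J}"
  define mon where "mon = (\<lambda>a b. (\<Prod>j\<in>J. x j ^ a j) * (\<Prod>j\<in>J. y j ^ b j))"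
  define H where "H = {c * (\<Prod>j\<in>J. x j ^ a j) | c a. c \<in> R}"
  have mon_mult: "mon a b * mon a' b' = mon (\<lambda>j. a j + a' j) (\<lambda>j. b j + b' j)" for a b a' b'
    by (simp add: mon_def power_add prod.distrib mult_ac)
  have mon_x: "mon (\<lambda>j. if j = i then 1 else 0) (\<lambda>_. 0) = x i" if "i \<in> J" for i
    using J that by (simp add: mon_def if_distrib[of "\<lambda>k. _ ^ k"] prod.delta cong: if_cong)
  have mon_y: "mon (\<lambda>_. 0) (\<lambda>j. if j = i then 1 else 0) = y i" if "i \<in> J" for i
    using J that by (simp add: mon_def if_distrib[of "\<lambda>k. _ ^ k"] prod.delta cong: if_cong)
  have polH: "is_subring hull (R \<union> x ` J) \<subseteq> aspan H"
  proof (rule hull_subset_aspan)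
    show "R \<union> x ` J \<subseteq> aspan H"
    proof
      fix r assume "r \<in> R \<union> x ` J"
      then show "r \<in> aspan H"
      proof
        assume "r \<in> R"
        then have "r \<in> H" unfolding H_def by (auto intro!: exI[of _ r] exI[of _ "\<lambda>_. 0"])
        then show ?thesis by (rule aspan.base)
      next
        assume "r \<in> x ` J"
        then obtain i where "i \<in> J" "r = x i" by auto
        then have "r \<in> H" unfolding H_def using mon_x[of i] subring_one[OF R]
          by (auto simp: mon_def intro!: exI[of _ 1] exI[of _ "\<lambda>j. if j = i then 1 else 0"])
        then show ?thesis by (rule aspan.base)
      qed
    qed
    show "1 \<in> aspan H"
      by (rule aspan.base) (auto simp: H_def subring_one[OF R] intro!: exI[of _ 1] exI[of _ "\<lambda>_. 0"])
    fix g h assume "g \<in> H" "h \<in> H"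
    then obtain c a c' a' where "c \<in> R" "c' \<in> R" "g = c * (\<Prod>j\<in>J. x j ^ a j)"
      "h = c' * (\<Prod>j\<in>J. x j ^ a' j)" by (auto simp: H_def)
    then have "g * h = (c * c') * (\<Prod>j\<in>J. x j ^ (a j + a' j))" "c * c' \<in> R"
      using subring_mult[OF R] by (auto simp: power_add prod.distrib mult_ac)
    then show "g * h \<in> aspan H" unfolding H_def
      by (intro aspan.base CollectI exI[of _ "c * c'"] exI[of _ "\<lambda>j. a j + a' j"] conjI)
  qed
  have scal: "c * g \<in> aspan G" if "c \<in> R" "g \<in> aspan G" for c g
  proof (rule aspan_mult_left[OF that(2)])
    fix g assume "g \<in> G"
    then obtain c' z where "c' \<in> R" "z \<in> int_exps J" "g = c' * std_mon x y J z" by (auto simp: G_def)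
    then have "c * g = (c * c') * std_mon x y J z" "c * c' \<in> R" "z \<in> int_exps J"
      using that(1) subring_mult[OF R] by (auto simp: mult_ac)
    then show "c * g \<in> aspan G" unfolding G_def by (blast intro: aspan.base)
  qed
  have mon_G: "mon a b \<in> aspan G" for a b
  proof (induction "\<Sum>j\<in>J. b j" arbitrary: a b rule: less_induct)
    case less
    show ?case
    proof (cases "\<exists>j\<in>J. a j > 0 \<and> b j > 0")
      case True
      then obtain i where i: "i \<in> J" "a i > 0" "b i > 0" by blast
      define a' where "a' = a(i := a i - 1)"
      define b' where "b' = b(i := b i - 1)"
      have "mon a b = mon (\<lambda>j. if j = i then 1 else 0) (\<lambda>_. 0) * mon (\<lambda>_. 0) (\<lambda>j. if j = i then 1 else 0) * mon a' b'"
        unfolding mon_mult using i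
        by (intro arg_cong2[where f = mon]) (auto simp: a'_def b'_def fun_eq_iff)
      then have eq: "mon a b = mon a' b' * (x i * y i)"
        using i(1) by (simp add: mon_x mon_y mult_ac)
      have lt: "(\<Sum>j\<in>J. b' j) < (\<Sum>j\<in>J. b j)"
        by (rule sum_strict_mono_ex1[OF J]) (use i in \<open>auto simp: b'_def\<close>)
      show ?thesis unfolding eq
      proof (rule aspan_mult_left[of _ H])
        show "x i * y i \<in> aspan H" using polH xy[OF i(1)] by blast
        fix h assume "h \<in> H"
        then obtain c e where h: "c \<in> R" "h = c * (\<Prod>j\<in>J. x j ^ e j)" by (auto simp: H_def)
        have "mon a' b' * h = c * mon (\<lambda>j. a' j + e j) b'"
          by (simp add: h mon_def power_add prod.distrib mult_ac)
        then show "mon a' b' * h \<in> aspan G" using scal[OF h(1)] less[OF lt] by simp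
      qed
    next
      case False
      define z where "z = (\<lambda>j. if j \<in> J then int (a j) - int (b j) else 0)"
      have "mon a b = std_mon x y J z"
        unfolding mon_def std_mon_def prod.distrib[symmetric]
      proof (rule prod.cong)
        fix j assume "j \<in> J"
        then have "nat (z j) = a j" "nat (- z j) = b j" using False by (auto simp: z_def)
        then show "x j ^ a j * y j ^ b j = x j ^ nat (z j) * y j ^ nat (- z j)" by simp
      qed simp
      moreover have "z \<in> int_exps J" by (auto simp: z_def int_exps_def)
      ultimately have "mon a b \<in> G" unfolding G_def using subring_one[OF R]
        by (auto intro!: exI[of _ 1])
      then show ?thesis by (rule aspan.base)
    qed
  qed
  have "is_subring hull (R \<union> x ` J \<union> y ` J) \<subseteq> aspan G"
  proof (rule hull_subset_aspan)
    show one: "1 \<in> aspan G"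
      using mon_G[of "\<lambda>_. 0" "\<lambda>_. 0"] by (simp add: mon_def)
    have "r \<in> aspan G" if "r \<in> R" for r using scal[OF that one] by simp
    moreover have "x i \<in> aspan G" "y i \<in> aspan G" if "i \<in> J" for i
      using mon_G mon_x[OF that, symmetric] mon_y[OF that, symmetric] by simp_all
    ultimately show "R \<union> x ` J \<union> y ` J \<subseteq> aspan G" by blast
    fix g h assume "g \<in> G" "h \<in> G"
    then obtain c z c' z' where gh: "c \<in> R" "c' \<in> R" "g = c * std_mon x y J z"
      "h = c' * std_mon x y J z'" by (auto simp: G_def)
    have sm: "std_mon x y J u = mon (\<lambda>j. nat (u j)) (\<lambda>j. nat (- u j))" for u
      by (simp add: std_mon_def mon_def prod.distrib)
    have "g * h = (c * c') * (std_mon x y J z * std_mon x y J z')" using gh by (simp add: mult_ac)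
    then show "g * h \<in> aspan G"
      unfolding sm mon_mult using scal[OF subring_mult[OF R gh(1,2)] mon_G] by simp
  qed
  also have "\<dots> \<subseteq> lin_span R (int_exps J) (std_mon x y J)"
    unfolding G_def by (rule aspan_subset_lin_span[OF R])
  finally show ?thesis .
qed


section \<open>Laurent polynomials with integer coefficients\<close>

text \<open>Integer exponents make all variables units. Indices are not bounded, so one type serves
  the original seed and its deformation with \<open>n\<close> more variables; bounds enter through
  \<open>vars\<close>.\<close>

type_synonym lau = "(nat \<Rightarrow>\<^sub>0 int) \<Rightarrow>\<^sub>0 int"

abbreviation "keys \<equiv> Poly_Mapping.keys"

abbreviation "lookup \<equiv> Poly_Mapping.lookup"

abbreviation "single \<equiv> Poly_Mapping.single"

abbreviation expo :: "(nat \<Rightarrow>\<^sub>0 int) \<Rightarrow> nat \<Rightarrow> int" where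
  "expo \<equiv> Poly_Mapping.lookup"

definition lmon :: "(nat \<Rightarrow>\<^sub>0 int) \<Rightarrow> lau" where
  "lmon e = single e 1"

abbreviation xpow :: "nat \<Rightarrow> int \<Rightarrow> lau" where
  "xpow j k \<equiv> lmon (single j k)"

definition X :: "nat \<Rightarrow> lau" where
  "X j = xpow j 1"

lemma lmon_0 [simp]: "lmon 0 = 1"
  by (simp add: lmon_def)

lemma lmon_add: "lmon (e + f) = lmon e * lmon f"
  by (simp add: lmon_def mult_single)

lemma keys_lmon [simp]: "keys (lmon e) = {e}"
  by (simp add: lmon_def)

lemma lmon_nonzero [simp]: "lmon e \<noteq> 0"
  using keys_lmon[of e] by (metis insert_not_empty keys_zero)

lemma lmon_inverse [simp]: "lmon e * lmon (- e) = 1" "lmon (- e) * lmon e = 1"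
  by (simp_all flip: lmon_add)

lemma lmon_sum: "lmon (\<Sum>i\<in>A. f i) = (\<Prod>i\<in>A. lmon (f i))"
  by (induction A rule: infinite_finite_induct) (auto simp: lmon_add)

lemma X_power: "X j ^ k = xpow j (int k)"
  by (induction k) (auto simp: X_def algebra_simps simp flip: lmon_add single_add)

lemma X_nonzero [simp]: "X j \<noteq> 0"
  by (simp add: X_def)

lemma X_inverse [simp]: "X j * xpow j (- 1) = 1"
  by (simp add: X_def single_uminus)

lemma of_int_lmon: "of_int c * lmon e = single e c"
  by (metis lmon_def mult_single single_of_int add_0 mult.right_neutral of_int_eq_id id_apply)

lemma lau_expand: "F = (\<Sum>e\<in>keys F. of_int (lookup F e) * lmon e)" for F :: lau
  unfolding of_int_lmon by (rule poly_mapping_eqI)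
    (auto simp: lookup_sum lookup_single when_def sum.delta in_keys_iff)

section \<open>Homogeneous components for an additive weight\<close>

definition hpart :: "((nat \<Rightarrow>\<^sub>0 int) \<Rightarrow> int) \<Rightarrow> int \<Rightarrow> lau \<Rightarrow> lau" where
  "hpart \<delta> r F = Poly_Mapping.mapp (\<lambda>e c. c when \<delta> e = r) F"

lemma lookup_hpart: "lookup (hpart \<delta> r F) e = (lookup F e when \<delta> e = r)"
  by (auto simp: hpart_def lookup_mapp when_def in_keys_iff)

lemma keys_hpart: "keys (hpart \<delta> r F) = {e \<in> keys F. \<delta> e = r}"
  by (auto simp: in_keys_iff lookup_hpart)

lemma hpart_zero [simp]: "hpart \<delta> r 0 = 0"
  by (rule poly_mapping_eqI) (simp add: lookup_hpart)

lemma hpart_add: "hpart \<delta> r (F + G) = hpart \<delta> r F + hpart \<delta> r G"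
  by (rule poly_mapping_eqI) (simp add: lookup_hpart lookup_add when_def)

lemma hpart_diff: "hpart \<delta> r (F - G) = hpart \<delta> r F - hpart \<delta> r G"
  by (rule poly_mapping_eqI) (simp add: lookup_hpart lookup_minus when_def)

lemma hpart_sum: "hpart \<delta> r (\<Sum>i\<in>A. f i) = (\<Sum>i\<in>A. hpart \<delta> r (f i))"
  by (induction A rule: infinite_finite_induct) (auto simp: hpart_add)

lemma hpart_id: "(\<And>e. e \<in> keys F \<Longrightarrow> \<delta> e = r) \<Longrightarrow> hpart \<delta> r F = F"
  by (rule poly_mapping_eqI) (auto simp: lookup_hpart when_def in_keys_iff)

lemma hpart_eq_0: "(\<And>e. e \<in> keys F \<Longrightarrow> \<delta> e \<noteq> r) \<Longrightarrow> hpart \<delta> r F = 0"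
  by (rule poly_mapping_eqI) (auto simp: lookup_hpart when_def in_keys_iff)

lemma hpart_decomp:
  assumes "finite A" "\<delta> ` keys F \<subseteq> A"
  shows "F = (\<Sum>r\<in>A. hpart \<delta> r F)"
proof (rule poly_mapping_eqI)
  fix e
  show "lookup F e = lookup (\<Sum>r\<in>A. hpart \<delta> r F) e"
    using assms by (cases "e \<in> keys F") (auto simp: lookup_sum lookup_hpart when_def in_keys_iff)
qed

lemma keys_mult_cases:
  assumes "e \<in> keys (F * G :: lau)"
  obtains f g where "f \<in> keys F" "g \<in> keys G" "e = f + g"
  using keys_mult[of F G] assms by blast

definition additive_deg :: "((nat \<Rightarrow>\<^sub>0 int) \<Rightarrow> int) \<Rightarrow> bool" where
  "additive_deg \<delta> \<longleftrightarrow> (\<forall>e f. \<delta> (e + f) = \<delta> e + \<delta> f)"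

lemma hpart_mult_hom:
  assumes \<delta>: "additive_deg \<delta>" and F: "\<And>e. e \<in> keys F \<Longrightarrow> \<delta> e = a"
  shows "hpart \<delta> r (F * G) = F * hpart \<delta> (r - a) G"
proof -
  let ?A = "hpart \<delta> (r - a) G"
  have add: "\<delta> (e + f) = \<delta> e + \<delta> f" for e f using \<delta> by (simp add: additive_deg_def)
  have "hpart \<delta> r (F * ?A) = F * ?A"
    by (rule hpart_id) (auto simp: add keys_hpart F elim!: keys_mult_cases)
  moreover have "hpart \<delta> r (F * (G - ?A)) = 0"
  proof (rule hpart_eq_0)
    fix e assume "e \<in> keys (F * (G - ?A))"
    then obtain f g where fg: "f \<in> keys F" "g \<in> keys (G - ?A)" "e = f + g"
      by (rule keys_mult_cases)
    then have "\<delta> g \<noteq> r - a" by (auto simp: in_keys_iff lookup_minus lookup_hpart)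
    then show "\<delta> e \<noteq> r" using fg by (simp add: add F)
  qed
  ultimately show ?thesis
    using hpart_add[of \<delta> r "F * ?A" "F * (G - ?A)"] by (simp add: algebra_simps)
qed

text \<open>For \<open>\<delta> = deg k\<close> this makes setting \<open>x_k\<close> to 0
  multiplicative on elements without negative powers of \<open>x_k\<close>.\<close>

lemma hpart_zero_mult:
  assumes \<delta>: "additive_deg \<delta>" and F: "\<And>e. e \<in> keys F \<Longrightarrow> \<delta> e \<ge> 0"
    and G: "\<And>e. e \<in> keys G \<Longrightarrow> \<delta> e \<ge> 0"
  shows "hpart \<delta> 0 (F * G) = hpart \<delta> 0 F * hpart \<delta> 0 G"
proof -
  let ?A = "hpart \<delta> 0 F"
  have add: "\<delta> (e + f) = \<delta> e + \<delta> f" for e f using \<delta> by (simp add: additive_deg_def)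
  have "hpart \<delta> 0 (?A * G) = ?A * hpart \<delta> 0 G"
    using hpart_mult_hom[OF \<delta>, of ?A 0 0 G] by (simp add: keys_hpart)
  moreover have "hpart \<delta> 0 ((F - ?A) * G) = 0"
  proof (rule hpart_eq_0)
    fix e assume "e \<in> keys ((F - ?A) * G)"
    then obtain f g where fg: "f \<in> keys (F - ?A)" "g \<in> keys G" "e = f + g"
      by (rule keys_mult_cases)
    then have "\<delta> f \<noteq> 0" "f \<in> keys F" by (auto simp: in_keys_iff lookup_minus lookup_hpart)
    then have "\<delta> f > 0" using F by force
    then show "\<delta> e \<noteq> 0" using fg G by (force simp: add)
  qed
  ultimately show ?thesis
    using hpart_add[of \<delta> 0 "?A * G" "(F - ?A) * G"] by (simp add: algebra_simps)
qed

text \<open>For a submonoid \<open>Q\<close> of exponents this is a subring; \<open>rest\<close>,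
  \<open>vars\<close> and the ring \<open>W0\<close> of the main induction are of this kind.\<close>

definition supp :: "(nat \<Rightarrow>\<^sub>0 int) set \<Rightarrow> lau set" where
  "supp Q = {F. keys F \<subseteq> Q}"

lemma supp_iff: "F \<in> supp Q \<longleftrightarrow> (\<forall>e\<in>keys F. e \<in> Q)"
  by (auto simp: supp_def)

lemma is_subring_supp:
  assumes "0 \<in> Q" "\<And>e f. e \<in> Q \<Longrightarrow> f \<in> Q \<Longrightarrow> e + f \<in> Q"
  shows "is_subring (supp Q)"
  unfolding is_subring_def
proof (intro conjI ballI)
  fix F G assume FG: "F \<in> supp Q" "G \<in> supp Q"
  have "keys (F - G) \<subseteq> keys F \<union> keys G" by (auto simp: in_keys_iff lookup_minus)
  then show "F - G \<in> supp Q" using FG by (auto simp: supp_def)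
  show "F * G \<in> supp Q"
    unfolding supp_iff
  proof
    fix e assume "e \<in> keys (F * G)"
    then obtain f g where "f \<in> keys F" "g \<in> keys G" "e = f + g" by (elim keys_mult_cases)
    then show "e \<in> Q" using FG assms(2) by (auto simp: supp_iff)
  qed
qed (use assms(1) in \<open>auto simp: supp_iff\<close>)

lemma supp_subset_subring:
  assumes "is_subring R" "\<And>e. e \<in> Q \<Longrightarrow> lmon e \<in> R"
  shows "supp Q \<subseteq> R"
proof
  fix F assume "F \<in> supp Q"
  then have "(\<Sum>e\<in>keys F. of_int (lookup F e) * lmon e) \<in> R"
    using assms by (auto simp: supp_def intro!: subring_intros)
  then show "F \<in> R" using lau_expand by simp
qed

section \<open>Rings attached to a set of directions\<close>

definition deg :: "nat \<Rightarrow> (nat \<Rightarrow>\<^sub>0 int) \<Rightarrow> int" where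
  "deg k e = expo e k"

lemma additive_deg [simp]: "additive_deg (deg k)"
  by (simp add: additive_deg_def deg_def lookup_add)

definition rest :: "nat set \<Rightarrow> lau set" where
  "rest J = supp {e. \<forall>j\<in>J. expo e j = 0}"

lemma rest_iff: "F \<in> rest J \<longleftrightarrow> (\<forall>e\<in>keys F. \<forall>j\<in>J. expo e j = 0)"
  by (simp add: rest_def supp_iff)

lemma is_subring_rest: "is_subring (rest J)"
  unfolding rest_def by (rule is_subring_supp) (auto simp: lookup_add)

text \<open>For \<open>p j\<close> the exchange polynomial this is the new variable
  \<open>x'_j\<close>; \<open>p\<close> stays arbitrary because inductions also use specialised
  families.\<close>

definition Y :: "(nat \<Rightarrow> lau) \<Rightarrow> nat \<Rightarrow> lau" where
  "Y p j = p j * xpow j (- 1)"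

lemma X_Y: "X j * Y p j = p j"
  by (simp add: Y_def mult.left_commute[of "X j"])

text \<open>Variables outside \<open>J\<close> are inverted. Hence \<open>lower p {j}\<close> sees a
  single mutation only, while \<open>J = {1..n}\<close> inverts none of the cluster
  variables.\<close>

definition lower :: "(nat \<Rightarrow> lau) \<Rightarrow> nat set \<Rightarrow> lau set" where
  "lower p J = is_subring hull (rest J \<union> X ` J \<union> Y p ` J)"

lemma is_subring_lower: "is_subring (lower p J)"
  by (simp add: lower_def is_subring_hull)

lemma rest_subset_lower: "rest J \<subseteq> lower p J"
  unfolding lower_def by (meson hull_subset le_sup_iff)

lemma X_in_lower: "j \<in> J \<Longrightarrow> X j \<in> lower p J"
  unfolding lower_def by (rule hull_inc) auto

lemma Y_in_lower: "j \<in> J \<Longrightarrow> Y p j \<in> lower p J"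
  unfolding lower_def by (rule hull_inc) auto

lemma Y_power: "Y p j ^ k = p j ^ k * xpow j (- int k)"
proof -
  have "xpow j (- 1) ^ k = xpow j (- int k)"
    by (induction k) (auto simp flip: lmon_add single_add)
  then show ?thesis by (simp add: Y_def power_mult_distrib)
qed

lemma hpart_deg_times_X:
  "hpart (deg k) r F = xpow k r * (xpow k (- r) * hpart (deg k) r F)"
  by (simp add: single_uminus mult.assoc[symmetric])

lemma keys_lmon_mult: "keys (lmon f * F) = (+) f ` keys F" for F :: lau
proof -
  have sub: "keys (lmon f * F) \<subseteq> (+) f ` keys F" for f and F :: lau
    by (auto elim!: keys_mult_cases)
  have "(+) f ` keys F \<subseteq> keys (lmon f * F)"
  proof clarify
    fix e assume "e \<in> keys F"
    then have "e \<in> keys (lmon (- f) * (lmon f * F))" by (simp add: mult.assoc[symmetric])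
    then obtain g where "g \<in> keys (lmon f * F)" "e = - f + g" using sub by blast
    then show "f + e \<in> keys (lmon f * F)" by simp
  qed
  with sub show ?thesis by blast
qed

lemma shifted_cmp_in_rest: "xpow k (- r) * hpart (deg k) r F \<in> rest {k}"
  by (auto simp: rest_iff keys_lmon_mult keys_hpart deg_def lookup_add)

text \<open>A denominator \<open>x_k ^ r\<close> is absorbed by the divisor \<open>p k ^ r\<close>,
  because together they form \<open>Y p k ^ r\<close>; nonnegative powers of \<open>x_k\<close> are
  harmless.\<close>

lemma lower_singleI:
  assumes "\<And>r::nat. p k ^ r dvd hpart (deg k) (- int r) F" and p: "p k \<in> rest {k}"
  shows "F \<in> lower p {k}"
proof -
  let ?m = "\<lambda>r. xpow k r"
  have "hpart (deg k) r F \<in> lower p {k}" for r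
  proof (cases "r \<ge> 0")
    case True
    have eq: "X k ^ nat r * (?m (- r) * hpart (deg k) r F) = hpart (deg k) r F"
      using True hpart_deg_times_X[of k r F, symmetric] by (simp add: X_power)
    have "X k ^ nat r * (?m (- r) * hpart (deg k) r F) \<in> lower p {k}"
      using subsetD[OF rest_subset_lower shifted_cmp_in_rest]
      by (intro subring_mult[OF is_subring_lower, of "_ ^ _"] subring_power[OF is_subring_lower] X_in_lower) simp_all
    then show ?thesis by (simp only: eq)
  next
    case False
    define n where "n = nat (- r)"
    have r: "r = - int n" using False by (simp add: n_def)
    obtain h where h: "hpart (deg k) r F = p k ^ n * h" using assms(1)[of n] r by (auto simp: dvd_def)
    have pn: "p k ^ n \<in> rest {k}" using p by (intro subring_power is_subring_rest)
    \<comment> \<open>Since \<open>p k\<close> has degree 0 in \<open>x_k\<close>, the cofactor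
      \<open>h\<close> can be replaced by its component of degree \<open>r\<close>.\<close>
    have "hpart (deg k) r F = hpart (deg k) r (hpart (deg k) r F)" by (rule hpart_id[symmetric]) (simp add: keys_hpart)
    also have "\<dots> = p k ^ n * hpart (deg k) r h"
      unfolding h using hpart_mult_hom[of "deg k" "p k ^ n" 0 r h] pn by (auto simp: rest_iff deg_def)
    also have "\<dots> = p k ^ n * (?m r * (?m (- r) * hpart (deg k) r h))" using hpart_deg_times_X by simp
    also have "\<dots> = Y p k ^ n * (?m (- r) * hpart (deg k) r h)" by (simp add: Y_power r mult_ac)
    finally have eq: "hpart (deg k) r F = Y p k ^ n * (?m (- r) * hpart (deg k) r h)" .
    show ?thesis unfolding eq
      using subsetD[OF rest_subset_lower shifted_cmp_in_rest]
      by (intro subring_mult[OF is_subring_lower, of "_ ^ _"] subring_power[OF is_subring_lower] Y_in_lower) simp_all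
  qed
  then have "(\<Sum>r\<in>deg k ` keys F. hpart (deg k) r F) \<in> lower p {k}"
    by (intro subring_sum is_subring_lower)
  then show ?thesis using hpart_decomp[of "deg k ` keys F" "deg k" F] by simp
qed

text \<open>Mixed products of \<open>X k\<close> and \<open>Y p k\<close> collapse through
  \<open>X k * Y p k = p k\<close>. So each element is a sum of terms \<open>c * X k ^ s\<close> and
  \<open>c * Y p k ^ s\<close>, for which divisibility is visible. Together with
  \<open>lower_singleI\<close> this turns membership into a divisibility test.\<close>

lemma lower_singleD:
  assumes F: "F \<in> lower p {k}" and p: "p k \<in> rest {k}"
  shows "p k ^ r dvd hpart (deg k) (- int r) F"
proof -
  define G where "G = {c * X k ^ s | c s. c \<in> rest {k}} \<union> {c * Y p k ^ s | c s. c \<in> rest {k}}"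
  note sr = is_subring_rest[of "{k}"]
  have GX: "c * X k ^ s \<in> G" and GY: "c * Y p k ^ s \<in> G" if "c \<in> rest {k}" for c s
    using that by (auto simp: G_def)
  have XY: "c * (X k ^ s * Y p k ^ t) \<in> G" if c: "c \<in> rest {k}" for c s t
  proof (cases "s \<le> t")
    case True
    then have "X k ^ s * Y p k ^ t = (X k * Y p k) ^ s * Y p k ^ (t - s)"
      by (simp add: power_mult_distrib mult.assoc flip: power_add)
    then have eq: "c * (X k ^ s * Y p k ^ t) = (c * p k ^ s) * Y p k ^ (t - s)"
      by (simp only: X_Y mult.assoc)
    show ?thesis unfolding eq by (rule GY[OF subring_mult[OF sr c subring_power[OF sr p]]])
  next
    case False
    then have "X k ^ s * Y p k ^ t = (X k * Y p k) ^ t * X k ^ (s - t)"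
      by (simp add: power_mult_distrib mult_ac flip: power_add)
    then have eq: "c * (X k ^ s * Y p k ^ t) = (c * p k ^ t) * X k ^ (s - t)"
      by (simp only: X_Y mult.assoc)
    show ?thesis unfolding eq by (rule GX[OF subring_mult[OF sr c subring_power[OF sr p]]])
  qed
  have "lower p {k} \<subseteq> aspan G"
    unfolding lower_def
  proof (rule hull_subset_aspan)
    have "c \<in> G" if "c \<in> rest {k}" for c using GX[OF that, of 0] by simp
    moreover have "X k \<in> G" "Y p k \<in> G"
      using GX[OF subring_one[OF sr], of 1] GY[OF subring_one[OF sr], of 1] by auto
    ultimately show "rest {k} \<union> X ` {k} \<union> Y p ` {k} \<subseteq> aspan G" by (auto intro: aspan.base)
    show "1 \<in> aspan G" using GX[OF subring_one[OF sr], of 0] by (simp add: aspan.base)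
    fix g h assume "g \<in> G" "h \<in> G"
    then obtain c s c' s' where cs: "c \<in> rest {k}" "c' \<in> rest {k}"
      "g = c * X k ^ s \<or> g = c * Y p k ^ s" "h = c' * X k ^ s' \<or> h = c' * Y p k ^ s'"
      unfolding G_def by blast
    have cc: "c * c' \<in> rest {k}" using cs(1,2) by (rule subring_mult[OF sr])
    have "g * h = c * c' * X k ^ (s + s') \<or> g * h = c * c' * Y p k ^ (s + s') \<or>
      g * h = c * c' * (X k ^ s * Y p k ^ s') \<or> g * h = c * c' * (X k ^ s' * Y p k ^ s)"
      using cs(3,4) by (auto simp: power_add mult_ac)
    then have "g * h \<in> G" using GX[OF cc] GY[OF cc] XY[OF cc] by metis
    then show "g * h \<in> aspan G" by (rule aspan.base)
  qed
  with F have "F \<in> aspan G" by blast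
  then show ?thesis
  proof induction
    case (base g)
    then consider c s where "c \<in> rest {k}" "g = c * X k ^ s" | c s where "c \<in> rest {k}" "g = c * Y p k ^ s"
      unfolding G_def by blast
    then show ?case
    proof cases
      case 1
      have "hpart (deg k) (- int r) g = 0" if "r > 0"
        by (rule hpart_eq_0)
          (use 1 that in \<open>auto simp: X_power rest_iff deg_def lookup_add elim!: keys_mult_cases\<close>)
      then show ?thesis by (cases "r = 0") auto
    next
      case 2
      have pk: "p k ^ s \<in> rest {k}" using p sr by (rule subring_power[rotated])
      have *: "deg k e = - int s" if "e \<in> keys g" for e
        using that 2 pk by (auto simp: Y_power rest_iff deg_def lookup_add elim!: keys_mult_cases)
      show ?thesis
      proof (cases "r = s")
        case True
        then have "hpart (deg k) (- int r) g = g" using * by (intro hpart_id) auto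
        then show ?thesis using True 2 by (simp add: Y_power)
      next
        case False
        then have "hpart (deg k) (- int r) g = 0" using * by (intro hpart_eq_0) auto
        then show ?thesis by simp
      qed
    qed
  qed (auto simp: hpart_diff)
qed

section \<open>Independence of standard monomials in the acyclic case\<close>

text \<open>For finite \<open>J\<close> this is acyclicity of \<open>E\<close> on \<open>J\<close>,
  stated by its use: an induction can always split off a source.\<close>

definition sourced :: "(nat \<times> nat) set \<Rightarrow> nat set \<Rightarrow> bool" where
  "sourced E J \<longleftrightarrow> (\<forall>J'\<subseteq>J. J' \<noteq> {} \<longrightarrow> (\<exists>k\<in>J'. \<forall>i\<in>J'. (i, k) \<notin> E))"

lemma sourcedE:
  assumes "sourced E J" "J' \<subseteq> J" "J' \<noteq> {}"
  obtains k where "k \<in> J'" "\<And>i. i \<in> J' \<Longrightarrow> (i, k) \<notin> E"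
  using assms(1)[unfolded sourced_def, rule_format, OF assms(2,3)] by auto

lemma sourced_mono: "sourced E J \<Longrightarrow> J' \<subseteq> J \<Longrightarrow> sourced E J'"
  unfolding sourced_def by (meson subset_trans)

text \<open>What the independence proof needs to know about exchange polynomials. The first clause
  lets a term survive when the variables of the in-neighbours of \<open>j\<close> are set to 0; the
  others keep \<open>p j\<close> polynomial in the variables of \<open>J\<close> and restrict these
  to neighbours of \<open>j\<close>. Setting \<open>x_k\<close> to 0 for a source \<open>k\<close>
  preserves all this.\<close>

definition triangular :: "(nat \<times> nat) set \<Rightarrow> nat set \<Rightarrow> (nat \<Rightarrow> lau) \<Rightarrow> bool" where
  "triangular E J p \<longleftrightarrow> (\<forall>j\<in>J.
     (\<exists>e\<in>keys (p j). \<forall>i\<in>J. (i, j) \<in> E \<longrightarrow> expo e i = 0) \<and>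
     (\<forall>e\<in>keys (p j). expo e j = 0 \<and>
        (\<forall>i\<in>J. expo e i \<ge> 0 \<and> ((i, j) \<notin> E \<and> (j, i) \<notin> E \<longrightarrow> expo e i = 0))))"

lemma hpart_zero_power:
  assumes "additive_deg \<delta>" "\<And>e. e \<in> keys F \<Longrightarrow> \<delta> e \<ge> 0" "\<delta> 0 = 0"
  shows "(\<forall>e\<in>keys (F ^ n). \<delta> e \<ge> 0) \<and> hpart \<delta> 0 (F ^ n) = hpart \<delta> 0 F ^ n"
proof (induction n)
  case 0
  show ?case using assms(3) hpart_id[of 1 \<delta> 0] by simp
next
  case (Suc n)
  have "\<forall>e\<in>keys (F * F ^ n). \<delta> e \<ge> 0"
    using Suc assms by (auto simp: additive_deg_def elim!: keys_mult_cases)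
  then show ?case using Suc hpart_zero_mult[OF assms(1), of F "F ^ n"] assms(2) by simp
qed

lemma hpart_zero_prod:
  assumes "additive_deg \<delta>" "\<And>i e. i \<in> A \<Longrightarrow> e \<in> keys (f i) \<Longrightarrow> \<delta> e \<ge> 0" "\<delta> 0 = 0"
  shows "(\<forall>e\<in>keys (\<Prod>i\<in>A. f i). \<delta> e \<ge> 0) \<and> hpart \<delta> 0 (\<Prod>i\<in>A. f i) = (\<Prod>i\<in>A. hpart \<delta> 0 (f i))"
  using assms(2)
proof (induction A rule: infinite_finite_induct)
  case (insert x A)
  have "\<forall>e\<in>keys (f x * prod f A). \<delta> e \<ge> 0"
  proof
    fix e assume "e \<in> keys (f x * prod f A)"
    then obtain g h where "g \<in> keys (f x)" "h \<in> keys (prod f A)" "e = g + h" by (rule keys_mult_cases)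
    moreover from this have "\<delta> g \<ge> 0" "\<delta> h \<ge> 0" using insert by auto
    ultimately show "\<delta> e \<ge> 0" using assms(1) by (simp add: additive_deg_def)
  qed
  moreover have "hpart \<delta> 0 (f x * prod f A) = hpart \<delta> 0 (f x) * hpart \<delta> 0 (prod f A)"
    by (rule hpart_zero_mult[OF assms(1)]) (use insert in auto)
  moreover have "hpart \<delta> 0 (prod f A) = (\<Prod>i\<in>A. hpart \<delta> 0 (f i))" using insert by blast
  ultimately show ?case using insert(1,2) by simp
qed (use assms(3) hpart_id[of 1 \<delta> 0] in simp_all)

text \<open>The part of lowest degree in \<open>x\<^sub>k\<close>, for a source \<open>k\<close>, of a linear relation is a relation for the
  polynomials \<open>p\<^sub>j\<close> specialised at \<open>x\<^sub>k = 0\<close>.\<close>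

lemma triangular_independent:
  assumes "finite J" "sourced E J" "triangular E J p"
  shows "lin_indep (rest J) (int_exps J) (std_mon X (Y p) J)"
  using assms
proof (induction "card J" arbitrary: J p)
  case 0
  then have "J = {}" by simp
  then have "int_exps J = {\<lambda>_. 0}" "std_mon X (Y p) J = (\<lambda>_. 1)"
    by (auto simp: int_exps_def std_mon_def)
  then show ?case unfolding lin_indep_def
  proof (clarsimp)
    fix T :: "(nat \<Rightarrow> int) set" and c :: "_ \<Rightarrow> lau" and z
    assume "T \<subseteq> {\<lambda>_. 0}" "sum c T = 0" "z \<in> T"
    moreover from this have "T = {z}" by blast
    ultimately show "c z = 0" by simp
  qed
next
  case (Suc n)
  then have "J \<noteq> {}" by auto
  then obtain k where k: "k \<in> J" "\<And>i. i \<in> J \<Longrightarrow> (i, k) \<notin> E"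
    using sourcedE[OF Suc.prems(2) subset_refl] by metis
  define J' where "J' = J - {k}"
  define p' where "p' = (\<lambda>j. hpart (deg k) 0 (p j))"
  have tri: "\<exists>e\<in>keys (p j). \<forall>i\<in>J. (i, j) \<in> E \<longrightarrow> expo e i = 0"
    "\<And>e. e \<in> keys (p j) \<Longrightarrow> expo e j = 0"
    "\<And>e i. e \<in> keys (p j) \<Longrightarrow> i \<in> J \<Longrightarrow> expo e i \<ge> 0"
    "\<And>e i. e \<in> keys (p j) \<Longrightarrow> i \<in> J \<Longrightarrow> (i, j) \<notin> E \<Longrightarrow> (j, i) \<notin> E \<Longrightarrow> expo e i = 0"
    if "j \<in> J" for j
    using Suc.prems(3) that unfolding triangular_def by blast+
  have J': "finite J'" "card J' = n" "sourced E J'" "k \<notin> J'"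
    using Suc.prems(1) Suc.hyps(2) k(1) sourced_mono[OF Suc.prems(2), of J'] by (auto simp: J'_def)
  have "triangular E J' p'"
    unfolding triangular_def
  proof (intro ballI conjI)
    fix j assume j: "j \<in> J'"
    then have jJ: "j \<in> J" by (simp add: J'_def)
    obtain e where e: "e \<in> keys (p j)" "\<forall>i\<in>J. (i, j) \<in> E \<longrightarrow> expo e i = 0" using tri(1)[OF jJ] by blast
    \<comment> \<open>Either \<open>(k, j)\<close> is an edge, and the chosen term avoids
      \<open>x_k\<close>, or \<open>k\<close> is no neighbour of \<open>j\<close> at all, as no edge
      enters \<open>k\<close>. So this term survives in \<open>p' j\<close>.\<close>
    have "expo e k = 0"
      using e k(1) k(2)[OF jJ] tri(4)[OF jJ e(1) k(1)] by blast
    then have "e \<in> keys (p' j)" using e by (simp add: p'_def keys_hpart deg_def)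
    then show "\<exists>e\<in>keys (p' j). \<forall>i\<in>J'. (i, j) \<in> E \<longrightarrow> expo e i = 0" using e by (auto simp: J'_def)
  qed (use tri in \<open>auto simp: J'_def p'_def keys_hpart deg_def\<close>)
  then have IH: "lin_indep (rest J') (int_exps J') (std_mon X (Y p') J')"
    using Suc.hyps(1) J' by blast
  \<comment> \<open>The factor at \<open>k\<close> of a standard monomial is homogeneous of degree
    \<open>s\<close> in \<open>x_k\<close>, since \<open>p k\<close> is free of \<open>x_k\<close>.
    The remaining factor \<open>N\<close> has no negative powers of \<open>x_k\<close>, so degrees
    in \<open>x_k\<close> separate the terms of a relation from below.\<close>
  define q where "q = (\<lambda>s. X k ^ nat s * Y p k ^ nat (- s))"
  define N where "N = std_mon X (Y p) J'"
  have pk: "p k \<in> rest {k}" using tri(2)[OF k(1)] by (auto simp: rest_iff)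
  have pk0: "p k \<noteq> 0" using tri(1)[OF k(1)] by auto
  have q0: "q s \<noteq> 0" for s using pk0 by (auto simp: q_def Y_power)
  have qdeg: "deg k e = s" if "e \<in> keys (q s)" for e s
  proof (cases "s \<ge> 0")
    case True
    then show ?thesis using that by (auto simp: q_def X_power deg_def)
  next
    case False
    have "p k ^ nat (- s) \<in> rest {k}" using pk by (intro subring_power is_subring_rest)
    then show ?thesis using that False
      by (auto simp: q_def Y_power deg_def rest_iff lookup_add elim!: keys_mult_cases)
  qed
  have M: "std_mon X (Y p) J z = q (z k) * N z" for z
    using Suc.prems(1) k(1) by (simp add: std_mon_def q_def N_def J'_def prod.remove)
  have X_nn: "\<And>e. e \<in> keys (X j) \<Longrightarrow> deg k e \<ge> 0" for j
    by (auto simp: X_def deg_def lookup_single when_def)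
  have X_hpart: "hpart (deg k) 0 (X j) = X j" if "j \<in> J'" for j
    using that J'(4) by (intro hpart_id) (auto simp: X_def deg_def lookup_single when_def)
  have Y_nn: "\<And>e. e \<in> keys (Y p j) \<Longrightarrow> deg k e \<ge> 0" if "j \<in> J'" for j
    using that J'(4) k(1) tri(3)[of j _ k]
    by (auto simp: Y_def J'_def deg_def lookup_single lookup_add when_def elim!: keys_mult_cases)
  have Y_hpart: "hpart (deg k) 0 (Y p j) = Y p' j" if "j \<in> J'" for j
  proof -
    have "hpart (deg k) 0 (xpow j (-1) * p j) =
      xpow j (-1) * hpart (deg k) (0 - 0) (p j)"
      by (rule hpart_mult_hom) (use that J'(4) in \<open>auto simp: deg_def lookup_single when_def\<close>)
    then show ?thesis by (simp add: Y_def p'_def mult.commute)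
  qed
  have d0: "deg k 0 = 0" by (simp add: deg_def)
  have N: "(\<forall>e\<in>keys (N z). deg k e \<ge> 0) \<and> hpart (deg k) 0 (N z) = std_mon X (Y p') J' z" for z
  proof -
    have *: "(\<forall>e\<in>keys (X j ^ nat (z j) * Y p j ^ nat (- z j)). deg k e \<ge> 0) \<and>
      hpart (deg k) 0 (X j ^ nat (z j) * Y p j ^ nat (- z j)) = X j ^ nat (z j) * Y p' j ^ nat (- z j)"
      if "j \<in> J'" for j
    proof -
      note 1 = hpart_zero_power[of "deg k", OF additive_deg X_nn[of _ j] d0, where n = "nat (z j)"]
      note 2 = hpart_zero_power[of "deg k", OF additive_deg Y_nn[OF that] d0, where n = "nat (- z j)"]
      have "\<forall>e\<in>keys (X j ^ nat (z j) * Y p j ^ nat (- z j)). deg k e \<ge> 0"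
        using 1 2 by (auto simp: deg_def lookup_add elim!: keys_mult_cases)
      then show ?thesis
        using 1 2 hpart_zero_mult[of "deg k" "X j ^ nat (z j)" "Y p j ^ nat (- z j)"]
        by (simp add: X_hpart[OF that] Y_hpart[OF that])
    qed
    show ?thesis
      using hpart_zero_prod[of "deg k" J' "\<lambda>j. X j ^ nat (z j) * Y p j ^ nat (- z j)"] * d0
      by (simp add: N_def std_mon_def)
  qed
  show ?case
    unfolding lin_indep_def
  proof (intro allI impI)
    fix T c assume T: "finite T \<and> T \<subseteq> int_exps J \<and> c ` T \<subseteq> rest J \<and> (\<Sum>e\<in>T. c e * std_mon X (Y p) J e) = 0"
    show "\<forall>e\<in>T. c e = 0"
    proof (rule ccontr)
      assume ne: "\<not> (\<forall>e\<in>T. c e = 0)"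
      define T' where "T' = {z \<in> T. c z \<noteq> 0}"
      \<comment> \<open>The lowest degree in \<open>x_k\<close>. In this degree only the terms with
        \<open>z k = s\<close> remain, each with its factor \<open>N\<close> taken at
        \<open>x_k = 0\<close>, and the common factor \<open>q s\<close> cancels.\<close>
      define s where "s = Min ((\<lambda>z. z k) ` T')"
      have T': "finite T'" "T' \<noteq> {}" using T ne by (auto simp: T'_def)
      have s_le: "s \<le> z k" if "z \<in> T'" for z using T' that by (auto simp: s_def)
      obtain z0 where z0: "z0 \<in> T'" "z0 k = s"
      proof -
        have "s \<in> (\<lambda>z. z k) ` T'" unfolding s_def using T' by (intro Min_in) auto
        then show ?thesis using that by auto
      qed
      define T0 where "T0 = {z \<in> T'. z k = s}"
      have crest: "c z \<in> rest J" if "z \<in> T" for z using T that by auto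
      have "0 = (\<Sum>z\<in>T'. c z * std_mon X (Y p) J z)"
      proof -
        have "(\<Sum>z\<in>T. c z * std_mon X (Y p) J z) = (\<Sum>z\<in>T'. c z * std_mon X (Y p) J z)"
          by (rule sum.mono_neutral_right) (use T in \<open>auto simp: T'_def\<close>)
        then show ?thesis using T by simp
      qed
      then have "0 = (\<Sum>z\<in>T'. hpart (deg k) s (c z * std_mon X (Y p) J z))"
        by (metis hpart_sum hpart_zero)
      also have "\<dots> = (\<Sum>z\<in>T'. (c z * q (z k)) * hpart (deg k) (s - z k) (N z))"
      proof (rule sum.cong[OF refl])
        fix z assume "z \<in> T'"
        then have c: "c z \<in> rest J" using crest by (auto simp: T'_def)
        have "deg k e = z k" if "e \<in> keys (c z * q (z k))" for e
          using that c k(1) qdeg by (fastforce simp: rest_iff deg_def lookup_add elim!: keys_mult_cases)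
        then show "hpart (deg k) s (c z * std_mon X (Y p) J z) = (c z * q (z k)) * hpart (deg k) (s - z k) (N z)"
          unfolding M mult.assoc[symmetric] by (intro hpart_mult_hom) auto
      qed
      also have "\<dots> = (\<Sum>z\<in>T0. (c z * q (z k)) * hpart (deg k) (s - z k) (N z))"
      proof (rule sum.mono_neutral_right)
        show "\<forall>z\<in>T' - T0. c z * q (z k) * hpart (deg k) (s - z k) (N z) = 0"
        proof
          fix z assume "z \<in> T' - T0"
          then have "z k > s" using s_le by (force simp: T0_def)
          then have "hpart (deg k) (s - z k) (N z) = 0" using N[of z] by (intro hpart_eq_0) auto
          then show "c z * q (z k) * hpart (deg k) (s - z k) (N z) = 0" by simp
        qed
      qed (use T' in \<open>auto simp: T0_def\<close>)
      also have "\<dots> = (\<Sum>z\<in>T0. q s * (c z * std_mon X (Y p') J' z))"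
        by (rule sum.cong) (use N in \<open>auto simp: T0_def mult_ac\<close>)
      also have "\<dots> = q s * (\<Sum>z\<in>T0. c z * std_mon X (Y p') J' z)" by (simp add: sum_distrib_left)
      finally have sum0: "(\<Sum>z\<in>T0. c z * std_mon X (Y p') J' z) = 0" using q0[of s] by simp
      \<comment> \<open>On the surviving indices the value at \<open>k\<close> is constantly
        \<open>s\<close>; dropping it gives indices for \<open>J'\<close>, and \<open>\<psi>\<close>
        restores it.\<close>
      define \<phi> where "\<phi> = (\<lambda>z::nat \<Rightarrow> int. z(k := 0))"
      define \<psi> where "\<psi> = (\<lambda>z::nat \<Rightarrow> int. z(k := s))"
      have \<psi>\<phi>: "\<psi> (\<phi> z) = z" if "z \<in> T0" for z using that by (auto simp: \<phi>_def \<psi>_def T0_def)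
      have inj: "inj_on \<phi> T0" by (rule inj_on_inverseI[of _ \<psi>]) (rule \<psi>\<phi>)
      have "(\<Sum>w\<in>\<phi> ` T0. c (\<psi> w) * std_mon X (Y p') J' w) = 0"
        unfolding sum.reindex[OF inj] sum0[symmetric]
        by (rule sum.cong) (use J'(4) \<psi>\<phi> in \<open>auto simp: std_mon_def \<phi>_def intro!: prod.cong\<close>)
      moreover have "finite (\<phi> ` T0)" "\<phi> ` T0 \<subseteq> int_exps J'"
        using T T' by (auto simp: \<phi>_def T0_def T'_def int_exps_def J'_def)
      moreover have "(\<lambda>w. c (\<psi> w)) ` \<phi> ` T0 \<subseteq> rest J'"
        using \<psi>\<phi> crest by (force simp: T0_def T'_def rest_iff J'_def)
      ultimately have "\<forall>w\<in>\<phi> ` T0. c (\<psi> w) = 0" using IH unfolding lin_indep_def by blast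
      moreover have "z0 \<in> T0" using z0 by (simp add: T0_def)
      ultimately have "c z0 = 0" using \<psi>\<phi> by force
      then show False using z0 by (simp add: T'_def)
    qed
  qed
qed


section \<open>Upper bound and lower bound in the acyclic case\<close>

lemma lmon_split:
  assumes "finite J"
  shows "lmon e = lmon (e - (\<Sum>j\<in>J. single j (expo e j))) *
    (\<Prod>j\<in>J. xpow j (expo e j))"
  by (simp flip: lmon_sum lmon_add)

lemma lookup_sum_single:
  assumes "finite J"
  shows "expo (\<Sum>j\<in>J. single j (f j)) i = (if i \<in> J then f i else 0)"
  using assms by (simp add: lookup_sum lookup_single when_def)

text \<open>Splits each monomial into powers of the \<open>X j\<close> with \<open>j\<close> in
  \<open>J\<close> and a monomial free of these variables; only the latter kind is left to
  check.\<close>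

lemma supp_subset_pol:
  assumes J: "finite J" and R: "is_subring R" and X: "X ` J \<subseteq> R"
    and Q: "\<And>e. e \<in> Q \<Longrightarrow> \<forall>j\<in>J. expo e j \<ge> 0"
    and c: "\<And>e f. e \<in> Q \<Longrightarrow> (\<And>i. expo f i = (if i \<in> J then 0 else expo e i)) \<Longrightarrow> lmon f \<in> R"
  shows "supp Q \<subseteq> R"
proof (rule supp_subset_subring[OF R])
  fix e assume e: "e \<in> Q"
  show "lmon e \<in> R"
    unfolding lmon_split[OF J, of e]
  proof (intro subring_mult[OF R] subring_prod[OF R])
    show "lmon (e - (\<Sum>j\<in>J. single j (expo e j))) \<in> R"
      by (rule c[OF e]) (simp add: lookup_minus lookup_sum_single[OF J])
    fix j assume j: "j \<in> J"
    then have "xpow j (expo e j) = X j ^ nat (expo e j)"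
      using Q[OF e] by (simp add: X_power)
    then show "xpow j (expo e j) \<in> R"
      using X j subring_power[OF R] by auto
  qed
qed

lemma pol_in_hull:
  assumes J: "finite J" and F: "\<And>e j. e \<in> keys F \<Longrightarrow> j \<in> J \<Longrightarrow> expo e j \<ge> 0"
  shows "F \<in> is_subring hull (rest J \<union> X ` J)"
proof -
  have "supp {e. \<forall>j\<in>J. expo e j \<ge> 0} \<subseteq> is_subring hull (rest J \<union> X ` J)"
  proof (rule supp_subset_pol[OF J is_subring_hull])
    show "X ` J \<subseteq> is_subring hull (rest J \<union> X ` J)" by (auto intro: hull_inc)
    fix f e assume "\<And>i. expo f i = (if i \<in> J then 0 else expo e i)"
    then have "lmon f \<in> rest J" by (simp add: rest_iff)
    then show "lmon f \<in> is_subring hull (rest J \<union> X ` J)" by (auto intro: hull_inc)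
  qed auto
  then show ?thesis using F by (auto simp: supp_iff subset_iff)
qed

lemma pol_in_lower:
  assumes "finite J" "\<And>e j. e \<in> keys F \<Longrightarrow> j \<in> J \<Longrightarrow> expo e j \<ge> 0"
  shows "F \<in> lower p J"
proof -
  have "is_subring hull (rest J \<union> X ` J) \<subseteq> lower p J"
    unfolding lower_def by (rule hull_mono) auto
  then show ?thesis using pol_in_hull[OF assms] by auto
qed

lemma keys_Y: "keys (Y p j) = (\<lambda>e. single j (- 1) + e) ` keys (p j)"
  by (simp add: Y_def mult.commute[of "p j"] keys_lmon_mult)

lemma keys_X [simp]: "keys (X j) = {single j 1}"
  by (simp add: X_def)

text \<open>Shrinking the set of directions inverts more variables. For a dropped \<open>j\<close>
  even \<open>Y p j\<close> becomes a Laurent polynomial without negative powers of the remaining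
  \<open>x_i\<close>, because \<open>p j\<close> has none.\<close>

lemma lower_mono:
  assumes J: "finite J'" "J' \<subseteq> J"
    and p: "\<And>j e i. j \<in> J - J' \<Longrightarrow> e \<in> keys (p j) \<Longrightarrow> i \<in> J' \<Longrightarrow> expo e i \<ge> 0"
  shows "lower p J \<subseteq> lower p J'"
  unfolding lower_def[of p J]
proof (rule hull_minimal[where S = is_subring, OF _ is_subring_lower])
  have "X j \<in> lower p J'" for j
    by (rule pol_in_lower[OF J(1)]) (simp add: lookup_single when_def)
  moreover have "Y p j \<in> lower p J'" if "j \<in> J" for j
  proof (cases "j \<in> J'")
    case False
    then show ?thesis using that p[of j]
      by (intro pol_in_lower[OF J(1)]) (auto simp: keys_Y lookup_add lookup_single when_def)
  qed (rule Y_in_lower)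
  moreover have "rest J \<subseteq> lower p J'"
    using J(2) rest_subset_lower[of J' p] by (auto simp: rest_iff subset_iff)
  ultimately show "rest J \<union> X ` J \<union> Y p ` J \<subseteq> lower p J'" by blast
qed

lemma triangular_mono:
  assumes "triangular E J p" "J' \<subseteq> J"
  shows "triangular E J' p"
  unfolding triangular_def
proof
  fix j assume "j \<in> J'"
  then have "j \<in> J" using assms(2) by blast
  note * = bspec[OF assms(1)[unfolded triangular_def] this]
  show "(\<exists>e\<in>keys (p j). \<forall>i\<in>J'. (i, j) \<in> E \<longrightarrow> expo e i = 0) \<and>
     (\<forall>e\<in>keys (p j). expo e j = 0 \<and>
        (\<forall>i\<in>J'. expo e i \<ge> 0 \<and> ((i, j) \<notin> E \<and> (j, i) \<notin> E \<longrightarrow> expo e i = 0)))"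
  proof (rule conjI)
    from * obtain e where "e \<in> keys (p j)" "\<forall>i\<in>J. (i, j) \<in> E \<longrightarrow> expo e i = 0" by (elim conjE bexE)
    then show "\<exists>e\<in>keys (p j). \<forall>i\<in>J'. (i, j) \<in> E \<longrightarrow> expo e i = 0"
      using assms(2) by (intro bexI[of _ e]) auto
  qed (use * assms(2) in auto)
qed

text \<open>For a source \<open>k\<close> of \<open>J'\<close>, \<open>p\<^sub>k\<close> is a unit plus a multiple of the product of the \<open>x\<^sub>a\<close> over the
  out-neighbours \<open>a\<close> of \<open>k\<close>; dividing by \<open>x\<^sub>k\<close>, this trades \<open>1 / x\<^sub>k\<close> for \<open>x'\<^sub>k\<close> modulo that product.\<close>

definition peelable :: "(nat \<times> nat) set \<Rightarrow> nat set \<Rightarrow> (nat \<Rightarrow> lau) \<Rightarrow> bool" where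
  "peelable E J p \<longleftrightarrow> (\<forall>J'\<subseteq>J. \<forall>k\<in>J'. (\<forall>i\<in>J'. (i, k) \<notin> E) \<longrightarrow>
     (\<exists>e0. (\<forall>i\<in>J'. expo e0 i = 0) \<and>
       (\<forall>e\<in>keys (p k - lmon e0). \<forall>a\<in>J'. (k, a) \<in> E \<longrightarrow> expo e a \<ge> 1)))"

lemma peelable_mono:
  assumes "peelable E J p" "J' \<subseteq> J"
  shows "peelable E J' p"
  unfolding peelable_def
proof (intro allI impI)
  fix B assume "B \<subseteq> J'"
  then have B: "B \<subseteq> J" using assms(2) by (rule subset_trans)
  show "\<forall>k\<in>B. (\<forall>i\<in>B. (i, k) \<notin> E) \<longrightarrow> (\<exists>e0. (\<forall>i\<in>B. expo e0 i = 0) \<and>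
       (\<forall>e\<in>keys (p k - lmon e0). \<forall>a\<in>B. (k, a) \<in> E \<longrightarrow> expo e a \<ge> 1))"
    by (rule mp[OF spec[OF assms(1)[unfolded peelable_def]] B])
qed

text \<open>That is, \<open>p j\<close> is a nonzerodivisor modulo \<open>p i\<close>. In this form
  powers of \<open>p i\<close> cancel by a plain induction
  (\<open>power_dvd_cancel\<close>).\<close>

definition pairwise_coprime :: "nat set \<Rightarrow> (nat \<Rightarrow> lau) \<Rightarrow> bool" where
  "pairwise_coprime J p \<longleftrightarrow>
     (\<forall>i\<in>J. \<forall>j\<in>J. i \<noteq> j \<longrightarrow> (\<forall>g. p i dvd p j * g \<longrightarrow> p i dvd g))"

lemma power_dvd_cancel:
  fixes a b :: "'a::idom"
  assumes "a \<noteq> 0" "\<And>g. a dvd b * g \<Longrightarrow> a dvd g" "a ^ r dvd b * g"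
  shows "a ^ r dvd g"
  using assms(3)
proof (induction r arbitrary: g)
  case (Suc r)
  then have "a dvd g" using assms(2)[of g] dvd_mult_left[of a "a ^ r" "b * g"] by simp
  then obtain h where h: "g = a * h" by auto
  have "a * a ^ r dvd a * (b * h)" using Suc.prems by (simp add: h mult_ac)
  then have "a ^ r dvd b * h" using assms(1) by simp
  then show ?case using Suc.IH[of h] by (simp add: h mult_dvd_mono)
qed simp

lemma keys_diff_subset: "keys (F - G) \<subseteq> keys F \<union> keys G" for F G :: lau
  by (auto simp: in_keys_iff lookup_minus)

text \<open>Modulo \<open>x_a\<close> the factor \<open>P\<close> is the monomial
  \<open>lmon e0\<close>, a unit free of \<open>x_a\<close>, so the lowest power of
  \<open>x_a\<close> in \<open>c\<close> survives in \<open>P * c\<close>. The proof raises a lower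
  bound \<open>- (n + 1)\<close> for the exponents to \<open>- n\<close>: a term of
  \<open>(P - lmon e0) * c\<close> gains at least one power of \<open>x_a\<close>.\<close>

lemma nonneg_of_mult:
  assumes e0: "expo e0 a = 0" and P: "\<And>e. e \<in> keys (P - lmon e0) \<Longrightarrow> expo e a \<ge> 1"
    and h: "\<And>e. e \<in> keys (P * c) \<Longrightarrow> expo e a \<ge> 0" and e: "e \<in> keys c"
  shows "expo e a \<ge> 0"
proof -
  have bound: "\<forall>e\<in>keys c. expo e a \<ge> - int n \<Longrightarrow> \<forall>e\<in>keys c. expo e a \<ge> 0" for n
  proof (induction n)
    case (Suc n)
    show ?case
    proof (rule Suc.IH, rule ballI)
      fix e assume "e \<in> keys c"
      then have "e0 + e \<in> keys (lmon e0 * c)" by (simp add: keys_lmon_mult)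
      also have "lmon e0 * c = P * c - (P - lmon e0) * c" by (simp add: algebra_simps)
      finally have "e0 + e \<in> keys (P * c) \<or> e0 + e \<in> keys ((P - lmon e0) * c)"
        using keys_diff_subset by blast
      then show "expo e a \<ge> - int n"
      proof
        assume "e0 + e \<in> keys (P * c)"
        from h[OF this] show ?thesis using e0 by (simp add: lookup_add)
      next
        assume "e0 + e \<in> keys ((P - lmon e0) * c)"
        then obtain f g where fg: "f \<in> keys (P - lmon e0)" "g \<in> keys c" "e0 + e = f + g"
          by (rule keys_mult_cases)
        have "expo e a = expo f a + expo g a"
          using arg_cong[OF fg(3), of "\<lambda>e. expo e a"] e0 by (simp add: lookup_add)
        then show ?thesis using P[OF fg(1)] Suc.prems fg(2) by force
      qed
    qed
  qed simp
  define n where "n = nat (- Min ((\<lambda>e. expo e a) ` keys c))"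
  have "\<forall>e\<in>keys c. expo e a \<ge> - int n"
  proof
    fix e assume "e \<in> keys c"
    then have "Min ((\<lambda>e. expo e a) ` keys c) \<le> expo e a" by (intro Min_le) auto
    then show "expo e a \<ge> - int n" unfolding n_def by linarith
  qed
  with bound e show ?thesis by blast
qed

text \<open>Let \<open>k\<close> be a source and \<open>A\<close> its out-neighbours. By induction
  an element lies in the ring for \<open>J1\<close>, where \<open>x_k\<close> is still inverted.
  Modulo \<open>lower p J\<close> it becomes a Laurent polynomial \<open>w\<close> in
  \<open>x_k\<close> over a ring \<open>W\<close> free of \<open>x_k\<close> and built without the
  \<open>x'_a\<close> for \<open>a\<close> in \<open>A\<close>. Membership in
  \<open>lower p {k}\<close> makes the part of degree \<open>- r\<close> divisible by
  \<open>p k ^ r\<close>. As the quotient is again over \<open>W\<close>, this part is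
  \<open>Y p k ^ r\<close> times an element of \<open>W\<close>.\<close>

lemma upper_subset_lower:
  assumes "finite J" "sourced E J" "triangular E J p" "peelable E J p" "pairwise_coprime J p"
  shows "(\<Inter>j\<in>J. lower p {j}) \<subseteq> lower p J"
  using assms
proof (induction "card J" arbitrary: J rule: less_induct)
  case less
  have fin: "finite J" by (rule less.prems)
  show ?case
  proof (cases "J = {}")
    case True
    then have "rest J = UNIV" by (auto simp: rest_iff)
    then show ?thesis using rest_subset_lower[of J p] by blast
  next
    case False
    obtain k where k: "k \<in> J" "\<And>i. i \<in> J \<Longrightarrow> (i, k) \<notin> E"
      using sourcedE[OF less.prems(2) subset_refl False] by metis
    define A where "A = {a \<in> J. (k, a) \<in> E}"
    define J1 where "J1 = J - {k}"
    define J2 where "J2 = J1 - A"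
    have kA: "k \<notin> A" using k by (auto simp: A_def)
    have finA: "finite A" "finite J1" "finite J2" using fin by (auto simp: A_def J1_def J2_def)
    have IH: "(\<Inter>j\<in>J'. lower p {j}) \<subseteq> lower p J'" if "J' \<subseteq> J1" for J'
    proof (rule less.hyps)
      have J': "J' \<subseteq> J" "k \<notin> J'" using that by (auto simp: J1_def)
      show "card J' < card J" using J' k(1) fin by (intro psubset_card_mono) auto
      show "finite J'" using J'(1) fin by (rule finite_subset)
      show "sourced E J'" "triangular E J' p" "peelable E J' p"
        using J' less.prems(2-4) sourced_mono triangular_mono peelable_mono by metis+
      show "pairwise_coprime J' p"
        using J' less.prems(5) unfolding pairwise_coprime_def by blast
    qed
    have tri: "\<exists>e. e \<in> keys (p j)" "\<And>e. e \<in> keys (p j) \<Longrightarrow> expo e j = 0"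
      "\<And>e i. e \<in> keys (p j) \<Longrightarrow> i \<in> J \<Longrightarrow> expo e i \<ge> 0"
      "\<And>e i. e \<in> keys (p j) \<Longrightarrow> i \<in> J \<Longrightarrow> (i, j) \<notin> E \<Longrightarrow> (j, i) \<notin> E \<Longrightarrow> expo e i = 0"
      if "j \<in> J" for j
      using less.prems(3) that unfolding triangular_def by blast+
    have p0: "p j \<noteq> 0" if "j \<in> J" for j using tri(1)[OF that] by auto
    have p_rest: "p j \<in> rest {j}" if "j \<in> J" for j using tri(2)[OF that] by (auto simp: rest_iff)
    obtain e0 where e0: "\<And>i. i \<in> J \<Longrightarrow> expo e0 i = 0"
      "\<And>e a. e \<in> keys (p k - lmon e0) \<Longrightarrow> a \<in> A \<Longrightarrow> expo e a \<ge> 1"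
      using less.prems(4)[unfolded peelable_def, rule_format, OF subset_refl k(1)] k(2)
      unfolding A_def by blast
    have pk_J2: "expo e j = 0" if "e \<in> keys (p k)" "j \<in> J2" for e j
      using that tri(4)[OF k(1) that(1), of j] k(2)[of j] by (auto simp: J2_def J1_def A_def)
    have J2_pk: "expo e k = 0" if "j \<in> J2" "e \<in> keys (p j)" for e j
      using that tri(4)[of j e k] k by (auto simp: J2_def J1_def A_def)
    \<comment> \<open>The coefficients of \<open>W\<close>: variables of \<open>A\<close> occur
      polynomially, those of \<open>k\<close> and \<open>J2\<close> not at all. Since no
      \<open>Y p a\<close> with \<open>a\<close> in \<open>A\<close> is adjoined, exponents of
      \<open>x_a\<close> stay nonnegative, which is what \<open>nonneg_of_mult\<close> can
      control.\<close>
    define QW where "QW = {e. expo e k = 0 \<and> (\<forall>j\<in>J2. expo e j = 0) \<and> (\<forall>a\<in>A. expo e a \<ge> 0)}"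
    define W0 where "W0 = supp QW"
    have W0_iff: "F \<in> W0 \<longleftrightarrow> (\<forall>e\<in>keys F. expo e k = 0 \<and> (\<forall>j\<in>J2. expo e j = 0) \<and> (\<forall>a\<in>A. expo e a \<ge> 0))" for F
      by (simp add: W0_def QW_def supp_iff)
    have srW0: "is_subring W0"
      unfolding W0_def by (rule is_subring_supp) (auto simp: QW_def lookup_add)
    define W where "W = is_subring hull (W0 \<union> X ` J2 \<union> Y p ` J2)"
    have srW: "is_subring W" unfolding W_def by (rule is_subring_hull)
    have W0_W: "W0 \<subseteq> W" and XW: "\<And>j. j \<in> J2 \<Longrightarrow> X j \<in> W" and YW: "\<And>j. j \<in> J2 \<Longrightarrow> Y p j \<in> W"
      unfolding W_def by (auto intro: hull_inc)
    have W_min: "W \<subseteq> S" if "is_subring S" "W0 \<subseteq> S" "\<And>j. j \<in> J2 \<Longrightarrow> X j \<in> S" "\<And>j. j \<in> J2 \<Longrightarrow> Y p j \<in> S" for S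
      unfolding W_def by (rule hull_minimal) (use that in auto)
    have J_split: "J = insert k (J2 \<union> A)" "k \<notin> J2" "J2 \<inter> A = {}"
      using k(1) kA by (auto simp: J2_def J1_def A_def)
    define y where "y = xpow k (- 1)"
    have y_pow: "y ^ b = xpow k (- int b)" for b
      by (induction b) (auto simp: y_def simp flip: lmon_add single_add)
    define Wx where "Wx = is_subring hull (W \<union> {X k, y})"
    have srWx: "is_subring Wx" unfolding Wx_def by (rule is_subring_hull)
    have W_Wx: "W \<subseteq> Wx" and XkWx: "X k \<in> Wx" and yWx: "y \<in> Wx"
      unfolding Wx_def by (auto intro: hull_inc)
    have W_lower: "W \<subseteq> lower p J"
    proof (rule W_min[OF is_subring_lower])
      show "W0 \<subseteq> lower p J"
      proof
        fix F assume F: "F \<in> W0"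
        show "F \<in> lower p J"
        proof (rule pol_in_lower[OF fin])
          fix e j assume "e \<in> keys F" "j \<in> J"
          then show "expo e j \<ge> 0" using F unfolding W0_iff J_split(1) by fastforce
        qed
      qed
      show "X j \<in> lower p J" "Y p j \<in> lower p J" if "j \<in> J2" for j
        using that by (auto intro!: X_in_lower Y_in_lower simp: J2_def J1_def)
    qed
    have W_rest: "W \<subseteq> rest {k}"
    proof (rule W_min[OF is_subring_rest])
      show "Y p j \<in> rest {k}" if "j \<in> J2" for j
        using that J2_pk[OF that] J_split(2)
        by (auto simp: rest_iff keys_Y lookup_add lookup_single when_def)
    qed (use J_split(2) in \<open>auto simp: rest_iff W0_iff lookup_single when_def\<close>)
    \<comment> \<open>The sum of \<open>lower p J\<close> and \<open>Wx\<close> is only an additive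
      group; elements common to both rings act on it, so \<open>S0\<close> serves as ring of
      scalars.\<close>
    define S0 where "S0 = lower p J \<inter> Wx"
    have srS0: "is_subring S0"
      using is_subring_lower[of p J] srWx unfolding S0_def is_subring_def by blast
    have W_S0: "W \<subseteq> S0" using W_lower W_Wx by (auto simp: S0_def)
    have Xk_S0: "X k \<in> S0" using X_in_lower[OF k(1)] XkWx by (auto simp: S0_def)
    have pk_W0: "p k \<in> W0"
      unfolding W0_iff using tri(2,3)[OF k(1)] pk_J2 by (auto simp: A_def)
    have Yk_S0: "Y p k \<in> S0"
    proof -
      have "Y p k = p k * y" by (simp add: Y_def y_def)
      then have "Y p k \<in> Wx" using pk_W0 W0_W W_Wx yWx subring_mult[OF srWx] by auto
      then show ?thesis using Y_in_lower[OF k(1)] by (simp add: S0_def)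
    qed
    have pol_S0: "F \<in> S0" if F: "\<And>e j. e \<in> keys F \<Longrightarrow> j \<in> J \<Longrightarrow> expo e j \<ge> 0" for F
    proof -
      have "supp {e. \<forall>j\<in>J. expo e j \<ge> 0} \<subseteq> Wx"
      proof (rule supp_subset_pol[OF fin srWx])
        show "X ` J \<subseteq> Wx"
        proof -
          have "X a \<in> W0" if "a \<in> A" for a
            using that kA J_split(3) by (auto simp: W0_iff lookup_single when_def)
          then show ?thesis using XW W_Wx XkWx W0_W by (auto simp: J_split(1))
        qed
        fix e f assume "\<And>i. expo f i = (if i \<in> J then 0 else expo e i)"
        then have "lmon f \<in> W0" by (simp add: W0_iff J_split)
        then show "lmon f \<in> Wx" using W0_W W_Wx by auto
      qed auto
      then have "F \<in> Wx" using F by (auto simp: supp_iff subset_iff)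
      then show ?thesis using pol_in_lower[OF fin F] by (simp add: S0_def)
    qed
    \<comment> \<open>Modulo the lower bound for \<open>J\<close>, every element of the lower bound for \<open>J1\<close> is a Laurent
      polynomial in \<open>x\<^sub>k\<close> over \<open>W\<close>: a product \<open>x\<^sub>a x'\<^sub>a\<close> with \<open>a \<in> A\<close> created by rewriting
      \<open>1 / x\<^sub>k\<close> equals \<open>p\<^sub>a\<close>, which removes all \<open>x'\<^sub>a\<close>.\<close>
    define T where "T = {l + w | l w. l \<in> lower p J \<and> w \<in> Wx}"
    have T_I: "l + w \<in> T" if "l \<in> lower p J" "w \<in> Wx" for l w using that by (auto simp: T_def)
    have lower_T: "l \<in> T" if "l \<in> lower p J" for l using T_I[OF that subring_zero[OF srWx]] by simp
    have Wx_T: "w \<in> T" if "w \<in> Wx" for w using T_I[OF subring_zero[OF is_subring_lower] that] by simp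
    have T_diff: "a - b \<in> T" if ab: "a \<in> T" "b \<in> T" for a b
    proof -
      obtain l w l' w' where *: "l \<in> lower p J" "w \<in> Wx" "l' \<in> lower p J" "w' \<in> Wx" "a = l + w" "b = l' + w'"
        using ab by (auto simp: T_def)
      have "(l - l') + (w - w') \<in> T"
        by (rule T_I) (use * srWx is_subring_lower in \<open>auto intro: subring_diff\<close>)
      then show ?thesis by (simp add: * algebra_simps)
    qed
    have T_mult: "c * a \<in> T" if ca: "c \<in> S0" "a \<in> T" for c a
    proof -
      obtain l w where *: "l \<in> lower p J" "w \<in> Wx" "a = l + w" using ca by (auto simp: T_def)
      have "c * l + c * w \<in> T"
        by (rule T_I) (use * ca srWx is_subring_lower in \<open>auto simp: S0_def intro: subring_mult\<close>)
      then show ?thesis by (simp add: * algebra_simps)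
    qed
    have yT: "y ^ b * prod_list (map (Y p) as) \<in> T" if "set as \<subseteq> A" for as b
      using that
    proof (induction as arbitrary: b)
      case Nil
      then show ?case using Wx_T subring_power[OF srWx yWx] by simp
    next
      case (Cons a as)
      define m where "m = prod_list (map (Y p) as)"
      have aA: "a \<in> A" and aJ: "a \<in> J" using Cons.prems by (auto simp: A_def)
      show ?case
      proof (induction b)
        case 0
        have "prod_list (map (Y p) bs) \<in> lower p J" if "set bs \<subseteq> J" for bs
          using that
          by (induction bs) (auto intro: subring_mult subring_one is_subring_lower Y_in_lower)
        moreover have "set (a # as) \<subseteq> J" using Cons.prems by (auto simp: A_def)
        ultimately have "prod_list (map (Y p) (a # as)) \<in> lower p J" by blast
        then show ?case using lower_T by simp
      next
        case (Suc b)
        \<comment> \<open>With \<open>g\<close> the quotient of \<open>p k - lmon e0\<close> by the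
          product of all \<open>X a\<close>, the relation \<open>Y p k = p k * y\<close> is solved
          for one factor \<open>y\<close>. The first resulting term has one \<open>y\<close> less;
          in the second the list of the \<open>Y p a\<close> gets shorter.\<close>
        define u' where "u' = lmon (- e0)"
        define eA where "eA = (\<Sum>a\<in>A. single a (1::int))"
        have eA: "expo eA i = (if i \<in> A then 1 else 0)" for i
          unfolding eA_def using lookup_sum_single[OF finA(1), of "\<lambda>_. 1" i] by simp
        define g where "g = (p k - lmon e0) * lmon (- eA)"
        define XA where "XA = (\<Prod>a\<in>A - {a}. X a)"
        have XaXA: "X a * XA = lmon eA"
          unfolding XA_def eA_def lmon_sum X_def[symmetric] by (rule prod.remove[symmetric]) (use aA finA in auto)
        have pk_eq: "p k = lmon e0 + X a * XA * g"
          by (simp add: XaXA g_def mult.left_commute[of "lmon eA"])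
        have u': "u' * lmon e0 = 1" by (simp add: u'_def)
        have y_eq: "y = u' * (Y p k - X a * XA * g * y)"
        proof -
          have "Y p k = p k * y" by (simp add: Y_def y_def)
          also have "\<dots> = lmon e0 * y + X a * XA * g * y" by (simp only: pk_eq algebra_simps)
          finally have "u' * (Y p k - X a * XA * g * y) = (u' * lmon e0) * y" by (simp add: algebra_simps)
          then show ?thesis by (simp add: u')
        qed
        have "y ^ Suc b * (Y p a * m) = y * (y ^ b * (Y p a * m))" by (simp add: mult_ac)
        also have "\<dots> = u' * (Y p k - X a * XA * g * y) * (y ^ b * (Y p a * m))" using y_eq by simp
        also have "\<dots> = (u' * Y p k) * (y ^ b * (Y p a * m)) - (u' * (XA * g * (X a * Y p a))) * (y ^ Suc b * m)"
          by (simp add: algebra_simps)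
        also have "\<dots> = (u' * Y p k) * (y ^ b * (Y p a * m)) - (u' * (XA * g * p a)) * (y ^ Suc b * m)"
          by (simp add: X_Y)
        finally have eq: "y ^ Suc b * (Y p a * m) = (u' * Y p k) * (y ^ b * (Y p a * m)) - (u' * (XA * g * p a)) * (y ^ Suc b * m)" .
        have u'S: "u' \<in> S0" unfolding u'_def using e0(1) by (intro pol_S0) simp
        have gS: "g \<in> S0"
        proof (rule pol_S0)
          fix e j assume e: "e \<in> keys g" and j: "j \<in> J"
          then obtain f where f: "f \<in> keys (p k - lmon e0)" "e = - eA + f"
            by (auto simp: g_def mult.commute[of _ "lmon _"] keys_lmon_mult)
          have "f \<in> keys (p k) \<or> f = e0" using f(1) keys_diff_subset by fastforce
          then have "expo f j \<ge> 0" using tri(3)[OF k(1) _ j] e0(1)[OF j] by auto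
          moreover have "j \<in> A \<Longrightarrow> expo f j \<ge> 1" using e0(2)[OF f(1)] by blast
          ultimately show "expo e j \<ge> 0" by (auto simp: f(2) lookup_add lookup_minus eA)
        qed
        have XAS: "XA \<in> S0"
          unfolding XA_def by (intro subring_prod[OF srS0] pol_S0) (simp add: lookup_single when_def)
        have paS: "p a \<in> S0" by (rule pol_S0) (rule tri(3)[OF aJ])
        have 1: "(u' * Y p k) * (y ^ b * (Y p a * m)) \<in> T"
          by (rule T_mult) (use Suc u'S Yk_S0 srS0 in \<open>auto simp: m_def intro: subring_mult\<close>)
        have 2: "(u' * (XA * g * p a)) * (y ^ Suc b * m) \<in> T"
        proof (rule T_mult)
          show "u' * (XA * g * p a) \<in> S0" by (intro subring_mult[OF srS0] u'S gS XAS paS)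
          show "y ^ Suc b * m \<in> T" unfolding m_def using Cons.prems by (intro Cons.IH) auto
        qed
        show ?case using T_diff[OF 1 2] unfolding eq[symmetric] by (simp add: m_def)
      qed
    qed
    have LL1_T: "lower p J1 \<subseteq> T"
    proof -
      \<comment> \<open>The ring for \<open>J1\<close> is spanned over \<open>S0\<close> by powers
        of \<open>y\<close> times products of some \<open>Y p a\<close>; the \<open>Y p j\<close>
        with \<open>j\<close> in \<open>J2\<close> already are scalars.\<close>
      define G where "G = {c * (y ^ b * prod_list (map (Y p) as)) | c b as. c \<in> S0 \<and> set as \<subseteq> A}"
      have G_I: "c * (y ^ b * prod_list (map (Y p) as)) \<in> G" if "c \<in> S0" "set as \<subseteq> A" for c b as
        using that unfolding G_def by blast
      have S0_G: "c \<in> aspan G" if "c \<in> S0" for c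
        using G_I[OF that, of "[]" 0] by (simp add: aspan.base)
      have G_mult: "g * h \<in> aspan G" if gh: "g \<in> G" "h \<in> G" for g h
      proof -
        obtain c b as c' b' as' where *: "c \<in> S0" "set as \<subseteq> A" "c' \<in> S0" "set as' \<subseteq> A"
          "g = c * (y ^ b * prod_list (map (Y p) as))" "h = c' * (y ^ b' * prod_list (map (Y p) as'))"
          using gh unfolding G_def by blast
        have "g * h = (c * c') * (y ^ (b + b') * prod_list (map (Y p) (as @ as')))"
          by (simp add: * power_add mult_ac)
        moreover have "\<dots> \<in> G" by (rule G_I) (use * srS0 in \<open>auto intro: subring_mult\<close>)
        ultimately show ?thesis by (simp add: aspan.base)
      qed
      have one: "1 \<in> aspan G" by (rule S0_G[OF subring_one[OF srS0]])
      have srG: "is_subring (aspan G)" by (rule is_subring_aspan[OF one G_mult])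
      have yG: "y \<in> aspan G"
        using G_I[OF subring_one[OF srS0], of "[]" 1] by (simp add: aspan.base)
      have YaG: "Y p a \<in> aspan G" if "a \<in> A" for a
        using G_I[OF subring_one[OF srS0], of "[a]" 0] that by (simp add: aspan.base)
      have "lower p J1 \<subseteq> aspan G"
        unfolding lower_def
      proof (rule hull_minimal[where S = is_subring, OF _ srG])
        have "rest J1 \<subseteq> aspan G"
          unfolding rest_def
        proof (rule supp_subset_subring[OF srG])
          fix e assume e: "e \<in> {e. \<forall>j\<in>J1. expo e j = 0}"
          have "lmon (e - single k (expo e k)) \<in> S0"
            using e by (intro pol_S0) (auto simp: lookup_minus lookup_single when_def J1_def)
          moreover have "xpow k (expo e k) \<in> aspan G"
          proof (cases "expo e k \<ge> 0")
            case True
            then have "xpow k (expo e k) = X k ^ nat (expo e k)" by (simp add: X_power)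
            then show ?thesis using S0_G[OF subring_power[OF srS0 Xk_S0]] by simp
          next
            case False
            then have "xpow k (expo e k) = y ^ nat (- expo e k)" by (simp add: y_pow)
            then show ?thesis using subring_power[OF srG yG] by simp
          qed
          moreover have "lmon e = lmon (e - single k (expo e k)) * xpow k (expo e k)"
            by (simp flip: lmon_add)
          ultimately show "lmon e \<in> aspan G" using S0_G subring_mult[OF srG] by simp
        qed
        moreover have "X j \<in> aspan G" for j
          by (intro S0_G pol_S0) (simp add: lookup_single when_def)
        moreover have "Y p j \<in> aspan G" if "j \<in> J1" for j
          using that YaG S0_G YW W_S0 by (cases "j \<in> A") (auto simp: J2_def)
        ultimately show "rest J1 \<union> X ` J1 \<union> Y p ` J1 \<subseteq> aspan G" by blast
      qed
      also have "aspan G \<subseteq> T"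
      proof (rule aspan_minimal)
        show "G \<subseteq> T" using yT T_mult unfolding G_def by blast
      qed (use T_diff lower_T subring_zero[OF is_subring_lower] in auto)
      finally show ?thesis .
    qed
    \<comment> \<open>All of \<open>W\<close> has degree 0 in \<open>x_k\<close>, so the components
      of a Laurent polynomial in \<open>x_k\<close> over \<open>W\<close> are its terms.\<close>
    have Wx_hpart: "xpow k (- s) * hpart (deg k) s w \<in> W" if "w \<in> Wx" for w s
    proof -
      define G where "G = {v * xpow k s | v s. v \<in> W}"
      have G_I: "v * xpow k s \<in> G" if "v \<in> W" for v s using that by (auto simp: G_def)
      have G_mult: "g * h \<in> aspan G" if gh: "g \<in> G" "h \<in> G" for g h
      proof -
        obtain v s v' s' where *: "v \<in> W" "v' \<in> W" "g = v * xpow k s"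
          "h = v' * lmon (single k s')" using gh by (auto simp: G_def)
        then have "g * h = (v * v') * xpow k (s + s')"
          by (simp add: single_add lmon_add mult_ac)
        then show ?thesis using G_I[OF subring_mult[OF srW *(1,2)]] by (simp add: aspan.base)
      qed
      have W_G: "v \<in> G" if "v \<in> W" for v using G_I[OF that, of 0] by simp
      have "Wx \<subseteq> aspan G"
        unfolding Wx_def
      proof (rule hull_subset_aspan[OF _ _ G_mult])
        show "1 \<in> aspan G" using W_G[OF subring_one[OF srW]] by (rule aspan.base)
        show "W \<union> {X k, y} \<subseteq> aspan G"
          using W_G G_I[OF subring_one[OF srW], of 1] G_I[OF subring_one[OF srW], of "- 1"]
          by (auto simp: X_def y_def intro: aspan.base)
      qed
      with that have "w \<in> aspan G" by blast
      then show ?thesis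
      proof induction
        case (base g)
        then obtain v t where v: "v \<in> W" "g = v * xpow k t" by (auto simp: G_def)
        have g: "deg k e = t" if "e \<in> keys g" for e
          using that v W_rest by (auto simp: rest_iff deg_def lookup_add elim!: keys_mult_cases)
        show ?case
        proof (cases "s = t")
          case True
          then have "hpart (deg k) s g = g" using g by (intro hpart_id) auto
          then have "xpow k (- s) * hpart (deg k) s g = v"
            using True by (simp add: v single_uminus mult.left_commute)
          then show ?thesis using v by simp
        next
          case False
          then have "hpart (deg k) s g = 0" using g by (intro hpart_eq_0) auto
          then show ?thesis using subring_zero[OF srW] by simp
        qed
      next
        case zero
        then show ?case using subring_zero[OF srW] by simp
      next
        case (diff a b)
        then show ?case using subring_diff[OF srW] by (simp add: hpart_diff right_diff_distrib)
      qed
    qed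
    have lower_lower: "lower p J \<subseteq> lower p {i}" if "i \<in> J" for i
      by (rule lower_mono) (use that tri(3) in auto)
    \<comment> \<open>Nonzero degrees in \<open>x_k\<close> cannot be cancelled by
      \<open>p k\<close>, which has degree 0; negative powers of \<open>x_a\<close> are excluded
      because \<open>p k\<close> is a unit monomial modulo \<open>x_a\<close>.\<close>
    have coef: "c \<in> W0" if c: "c \<in> rest J2" "p k * c \<in> W0" for c
      unfolding W0_iff
    proof (intro ballI conjI)
      fix e assume e: "e \<in> keys c"
      show "expo e j = 0" if "j \<in> J2" for j using c(1) e that by (auto simp: rest_iff)
      show "expo e k = 0"
      proof (rule ccontr)
        assume ne: "expo e k \<noteq> 0"
        have "hpart (deg k) (expo e k) (p k * c) = p k * hpart (deg k) (expo e k - 0) c"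
          using p_rest[OF k(1)] by (intro hpart_mult_hom) (auto simp: rest_iff deg_def)
        moreover have "hpart (deg k) (expo e k) (p k * c) = 0"
          using c(2) ne by (intro hpart_eq_0) (auto simp: W0_iff deg_def)
        ultimately have "hpart (deg k) (expo e k) c = 0" using p0[OF k(1)] by simp
        then have "keys (hpart (deg k) (expo e k) c) = {}" by simp
        then show False using e by (auto simp: keys_hpart deg_def)
      qed
      show "expo e a \<ge> 0" if "a \<in> A" for a
        by (rule nonneg_of_mult[of e0 a "p k" c])
          (use c(2) e that e0 in \<open>auto simp: W0_iff A_def\<close>)
    qed
    \<comment> \<open>Coprimality and induction put \<open>h\<close> into the lower bound for \<open>J2\<close>; comparing the unique
      standard coefficients of \<open>h\<close> and \<open>p\<^sub>k h\<close> then excludes negative powers of the \<open>x\<^sub>a\<close>.\<close>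
    have sat: "h \<in> W" if h: "p k * h \<in> W" for h
    proof -
      have "h \<in> lower p {i}" if i: "i \<in> J2" for i
      proof (rule lower_singleI)
        have iJ: "i \<in> J" and ik: "i \<noteq> k" using i J_split by auto
        show pi: "p i \<in> rest {i}" by (rule p_rest[OF iJ])
        fix r :: nat
        \<comment> \<open>\<open>p k\<close> is free of \<open>x_i\<close>, as \<open>i\<close> is
          no neighbour of \<open>k\<close>. Hence it is a factor of every component in
          \<open>x_i\<close>, and coprimality removes it.\<close>
        have "p k * h \<in> lower p {i}" using h W_lower lower_lower[OF iJ] by blast
        from lower_singleD[OF this pi, of r]
        have "p i ^ r dvd hpart (deg i) (- int r) (p k * h)" .
        also have "\<dots> = p k * hpart (deg i) (- int r - 0) h"
          using pk_J2 i by (intro hpart_mult_hom) (auto simp: deg_def)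
        finally have *: "p i ^ r dvd p k * hpart (deg i) (- int r) h" by simp
        show "p i ^ r dvd hpart (deg i) (- int r) h"
          by (rule power_dvd_cancel[OF p0[OF iJ] _ *])
            (rule less.prems(5)[unfolded pairwise_coprime_def, rule_format, OF iJ k(1) ik])
      qed
      then have "h \<in> lower p J2" using IH[of J2] by (auto simp: J2_def)
      also have "lower p J2 \<subseteq> lin_span (rest J2) (int_exps J2) (std_mon X (Y p) J2)"
        unfolding lower_def
      proof (rule hull_subset_std_span[OF is_subring_rest finA(3)])
        fix j assume "j \<in> J2"
        then show "X j * Y p j \<in> is_subring hull (rest J2 \<union> X ` J2)"
          unfolding X_Y using tri(3)[of j] J_split by (intro pol_in_hull[OF finA(3)]) auto
      qed
      finally obtain T1 c where T1: "finite T1" "T1 \<subseteq> int_exps J2" "c ` T1 \<subseteq> rest J2"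
        "h = (\<Sum>z\<in>T1. c z * std_mon X (Y p) J2 z)" by (auto simp: lin_span_def)
      have "W \<subseteq> lin_span W0 (int_exps J2) (std_mon X (Y p) J2)"
        unfolding W_def
      proof (rule hull_subset_std_span[OF srW0 finA(3)])
        fix j assume j: "j \<in> J2"
        let ?R = "is_subring hull (W0 \<union> X ` J2)"
        define Q where "Q = {e. expo e k = 0 \<and> (\<forall>i\<in>J. expo e i \<ge> 0)}"
        have "supp Q \<subseteq> ?R"
        proof (rule supp_subset_pol[OF finA(3) is_subring_hull])
          show "X ` J2 \<subseteq> ?R" by (auto intro: hull_inc)
          show "\<forall>j\<in>J2. expo e j \<ge> 0" if "e \<in> Q" for e using that J_split by (auto simp: Q_def)
          fix e f assume "e \<in> Q" "\<And>i. expo f i = (if i \<in> J2 then 0 else expo e i)"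
          then have "lmon f \<in> W0" using J_split by (auto simp: W0_iff Q_def)
          then show "lmon f \<in> ?R" by (auto intro: hull_inc)
        qed
        moreover have "p j \<in> supp Q"
          unfolding supp_iff Q_def using j J2_pk[OF j] tri(3)[of j] J_split by auto
        ultimately show "X j * Y p j \<in> ?R" unfolding X_Y by blast
      qed
      then obtain T2 c' where T2: "finite T2" "T2 \<subseteq> int_exps J2" "c' ` T2 \<subseteq> W0"
        "p k * h = (\<Sum>z\<in>T2. c' z * std_mon X (Y p) J2 z)" using h by (auto simp: lin_span_def)
      \<comment> \<open>Both expansions are padded with zeros to a common index set, where
        independence of standard monomials equates the coefficients of \<open>p k * h\<close> with
        \<open>p k\<close> times those of \<open>h\<close>.\<close>
      define d where "d = (\<lambda>z. if z \<in> T1 then c z else 0)"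
      define d' where "d' = (\<lambda>z. if z \<in> T2 then c' z else 0)"
      have d: "d z \<in> rest J2" and d': "d' z \<in> W0" for z
        using T1(3) T2(3) subring_zero[OF is_subring_rest] subring_zero[OF srW0] by (auto simp: d_def d'_def)
      have h_d: "h = (\<Sum>z\<in>T1 \<union> T2. d z * std_mon X (Y p) J2 z)"
        unfolding T1(4) by (rule sum.mono_neutral_cong_left) (use T1 T2 in \<open>auto simp: d_def\<close>)
      have ph_d: "p k * h = (\<Sum>z\<in>T1 \<union> T2. d' z * std_mon X (Y p) J2 z)"
        unfolding T2(4) by (rule sum.mono_neutral_cong_left) (use T1 T2 in \<open>auto simp: d'_def\<close>)
      have sum0: "(\<Sum>z\<in>T1 \<union> T2. (p k * d z - d' z) * std_mon X (Y p) J2 z) = 0"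
      proof -
        have "(\<Sum>z\<in>T1 \<union> T2. (p k * d z - d' z) * std_mon X (Y p) J2 z) =
          p k * (\<Sum>z\<in>T1 \<union> T2. d z * std_mon X (Y p) J2 z) - (\<Sum>z\<in>T1 \<union> T2. d' z * std_mon X (Y p) J2 z)"
          by (simp add: left_diff_distrib sum_subtractf sum_distrib_left mult.assoc)
        also have "\<dots> = 0" using h_d ph_d by simp
        finally show ?thesis .
      qed
      have "p k \<in> rest J2" using pk_J2 by (auto simp: rest_iff)
      moreover have "W0 \<subseteq> rest J2" by (auto simp: W0_iff rest_iff)
      ultimately have cr: "p k * d z - d' z \<in> rest J2" for z
        using d[of z] d'[of z] by (intro subring_diff subring_mult is_subring_rest) auto
      have J2J: "J2 \<subseteq> J" by (auto simp: J2_def J1_def)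
      have li: "lin_indep (rest J2) (int_exps J2) (std_mon X (Y p) J2)"
        by (rule triangular_independent[OF finA(3) sourced_mono[OF less.prems(2) J2J]
            triangular_mono[OF less.prems(3) J2J]])
      have "p k * d z - d' z = 0" if "z \<in> T1 \<union> T2" for z
        by (rule lin_indepD[OF li _ _ cr sum0 that]) (use T1 T2 in auto)
      then have dW: "d z \<in> W0" if "z \<in> T1 \<union> T2" for z
        using coef[OF d, of z] d'[of z] that by simp
      show ?thesis
        unfolding h_d
      proof (rule subring_sum[OF srW])
        fix z assume "z \<in> T1 \<union> T2"
        then have "d z \<in> W" using dW W0_W by blast
        moreover have "std_mon X (Y p) J2 z \<in> W"
          unfolding std_mon_def
          by (intro subring_prod[OF srW] subring_mult[OF srW] subring_power[OF srW] XW YW)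
        ultimately show "d z * std_mon X (Y p) J2 z \<in> W" by (rule subring_mult[OF srW])
      qed
    qed
    have sat_pow: "h \<in> W" if "p k ^ r * h \<in> W" for r h
      using that by (induction r) (auto simp: mult.assoc dest: sat)
    show ?thesis
    proof
      fix F assume F: "F \<in> (\<Inter>j\<in>J. lower p {j})"
      then have "F \<in> lower p J1" using IH[of J1] by (auto simp: J1_def)
      then obtain l w where lw: "l \<in> lower p J" "w \<in> Wx" "F = l + w" using LL1_T by (auto simp: T_def)
      \<comment> \<open>Passing to \<open>w\<close> keeps the condition at \<open>k\<close>, because
        the discarded \<open>l\<close> satisfies it as well.\<close>
      have "w = F - l" using lw by simp
      moreover have "F \<in> lower p {k}" "l \<in> lower p {k}" using F lw(1) k(1) lower_lower by auto
      ultimately have wk: "w \<in> lower p {k}" using subring_diff[OF is_subring_lower] by blast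
      have "hpart (deg k) s w \<in> lower p J" for s
      proof (cases "s \<ge> 0")
        case True
        have eq: "X k ^ nat s * (xpow k (- s) * hpart (deg k) s w) = hpart (deg k) s w"
          using True hpart_deg_times_X[of k s w, symmetric] by (simp add: X_power)
        have "X k ^ nat s * (xpow k (- s) * hpart (deg k) s w) \<in> lower p J"
          using W_lower Wx_hpart[OF lw(2), of s] X_in_lower[OF k(1)]
          by (intro subring_mult[OF is_subring_lower, of "_ ^ _"] subring_power is_subring_lower) auto
        then show ?thesis by (simp only: eq)
      next
        case False
        define r where "r = nat (- s)"
        have s: "s = - int r" using False by (simp add: r_def)
        obtain h where h: "hpart (deg k) s w = p k ^ r * h"
          using lower_singleD[OF wk p_rest[OF k(1)], of r] unfolding s by (auto simp: dvd_def)
        have "p k ^ r * (xpow k (- s) * h) \<in> W"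
          using Wx_hpart[OF lw(2), of s] by (simp add: h mult_ac)
        then have hW: "xpow k (- s) * h \<in> W" by (rule sat_pow)
        have "Y p k ^ r * (xpow k (- s) * h) =
          p k ^ r * h * (xpow k s * xpow k (- s))"
          by (simp add: Y_power s mult_ac)
        then have eq: "Y p k ^ r * (xpow k (- s) * h) = hpart (deg k) s w"
          by (simp add: h single_uminus)
        have "Y p k ^ r * (xpow k (- s) * h) \<in> lower p J"
          using W_lower hW Y_in_lower[OF k(1)]
          by (intro subring_mult[OF is_subring_lower, of "_ ^ _"] subring_power is_subring_lower) auto
        then show ?thesis by (simp only: eq)
      qed
      then have "(\<Sum>s\<in>deg k ` keys w. hpart (deg k) s w) \<in> lower p J" by (intro subring_sum is_subring_lower)
      then have "w \<in> lower p J" using hpart_decomp[of "deg k ` keys w" "deg k" w] by simp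
      then show "F \<in> lower p J" using lw subring_add[OF is_subring_lower] by blast
    qed
  qed
qed


section \<open>Exchange polynomials\<close>

text \<open>In lowest weight the product \<open>Q * g\<close> is the unit \<open>lmon e0\<close>
  times the lowest part of \<open>g\<close>. A homogeneous \<open>P\<close> divides every component
  of what it divides, hence it divides this lowest part, which is then subtracted from
  \<open>g\<close>.\<close>

lemma weight_coprime:
  assumes \<delta>: "additive_deg \<delta>" and P: "\<And>e. e \<in> keys P \<Longrightarrow> \<delta> e = a"
    and Q: "\<And>e. e \<in> keys (Q - lmon e0) \<Longrightarrow> \<delta> e > \<delta> e0" and dvd: "P dvd Q * g"
  shows "P dvd g"
  using dvd
proof (induction "card (keys g)" arbitrary: g rule: less_induct)
  case less
  show ?case
  proof (cases "g = 0")
    case False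
    have add: "\<delta> (e + f) = \<delta> e + \<delta> f" for e f using \<delta> by (simp add: additive_deg_def)
    define s where "s = Min (\<delta> ` keys g)"
    have "s \<in> \<delta> ` keys g" unfolding s_def using False by (intro Min_in) auto
    then obtain e1 where e1: "e1 \<in> keys g" "\<delta> e1 = s" by auto
    have s_le: "s \<le> \<delta> e" if "e \<in> keys g" for e using that by (simp add: s_def)
    define g' where "g' = hpart \<delta> s g"
    obtain h where h: "Q * g = P * h" using less.prems by auto
    have "Q * g = lmon e0 * g + (Q - lmon e0) * g" by (simp add: algebra_simps)
    moreover have "hpart \<delta> (\<delta> e0 + s) ((Q - lmon e0) * g) = 0"
    proof (rule hpart_eq_0)
      fix e assume "e \<in> keys ((Q - lmon e0) * g)"
      then obtain f1 f2 where f: "f1 \<in> keys (Q - lmon e0)" "f2 \<in> keys g" "e = f1 + f2"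
        by (rule keys_mult_cases)
      show "\<delta> e \<noteq> \<delta> e0 + s" using Q[OF f(1)] s_le[OF f(2)] by (simp add: f(3) add)
    qed
    moreover have "hpart \<delta> (\<delta> e0 + s) (lmon e0 * g) = lmon e0 * g'"
      using hpart_mult_hom[OF \<delta>, of "lmon e0" "\<delta> e0" "\<delta> e0 + s" g] by (simp add: g'_def)
    ultimately have "lmon e0 * g' = hpart \<delta> (\<delta> e0 + s) (P * h)" by (simp add: hpart_add h[symmetric])
    also have "\<dots> = P * hpart \<delta> (\<delta> e0 + s - a) h" using P by (rule hpart_mult_hom[OF \<delta>])
    finally have "lmon (- e0) * (lmon e0 * g') = P * (lmon (- e0) * hpart \<delta> (\<delta> e0 + s - a) h)"
      by (simp add: mult_ac)
    then have Pg': "P dvd g'" by (simp add: mult.assoc[symmetric])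
    have "P dvd Q * g - Q * g'" by (rule dvd_diff[OF less.prems dvd_mult[OF Pg']])
    then have "P dvd Q * (g - g')" by (simp add: right_diff_distrib)
    moreover have "keys (g - g') \<subseteq> keys g - {e1}"
      using e1 by (auto simp: g'_def in_keys_iff lookup_minus lookup_hpart)
    then have "card (keys (g - g')) < card (keys g)"
      using e1 by (intro psubset_card_mono) auto
    ultimately have "P dvd g - g'" using less.hyps by blast
    then show ?thesis using Pg' by (metis diff_add_cancel dvd_add)
  qed simp
qed

section \<open>Exchange polynomials and their exponents\<close>

definition beta :: "(nat \<Rightarrow> nat) \<Rightarrow> (nat \<Rightarrow> nat \<Rightarrow> int) \<Rightarrow> nat \<Rightarrow> nat \<Rightarrow> int" where
  "beta d b l i = b l i div int (d i)"

definition ex_exp :: "nat \<Rightarrow> (nat \<Rightarrow> nat) \<Rightarrow> (nat \<Rightarrow> nat \<Rightarrow> int) \<Rightarrow> nat \<Rightarrow> nat \<Rightarrow> nat \<Rightarrow>\<^sub>0 int" where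
  "ex_exp m d b i r = (\<Sum>j=1..m. single j
     (int (r * nat (beta d b j i) + (d i - r) * nat (- beta d b j i))))"

definition ex_pol :: "nat \<Rightarrow> (nat \<Rightarrow> nat) \<Rightarrow> (nat \<Rightarrow> nat \<Rightarrow> lau) \<Rightarrow> (nat \<Rightarrow> nat \<Rightarrow> int) \<Rightarrow> nat \<Rightarrow> lau" where
  "ex_pol m d R b i = (\<Sum>r=0..d i. R i r * lmon (ex_exp m d b i r))"

lemma expo_ex_exp:
  "expo (ex_exp m d b i r) j = (if j \<in> {1..m} then
     int (r * nat (beta d b j i) + (d i - r) * nat (- beta d b j i)) else 0)"
  unfolding ex_exp_def by (subst lookup_sum_single) auto

text \<open>Positive part minus negative part of \<open>\<beta>\<close> is \<open>\<beta>\<close>,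
  so exponents in the \<open>r\<close>-th term are affine in \<open>r\<close>. Up to the
  coefficients, the weights of the terms of an exchange polynomial thus form an arithmetic
  progression.\<close>

lemma nat_pos_neg_part: "r \<le> D \<Longrightarrow> int (r * nat \<beta> + (D - r) * nat (- \<beta>)) = int D * int (nat (- \<beta>)) + int r * \<beta>"
  by (cases "\<beta> \<ge> 0") (auto simp: algebra_simps of_nat_diff)

text \<open>\<open>Z\<close> holds the variables that may occur in the coefficient strings. Weights
  use variables outside \<open>Z\<close> only, so that the coefficients are invisible to them; the
  new variables of the deformation stay outside \<open>Z\<close>.\<close>

definition coef_data :: "nat \<Rightarrow> (nat \<Rightarrow> nat) \<Rightarrow> nat set \<Rightarrow> (nat \<Rightarrow> nat \<Rightarrow> lau) \<Rightarrow> bool" where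
  "coef_data n d Z R \<longleftrightarrow> Z \<inter> {1..n} = {} \<and> (\<forall>i\<in>{1..n}. R i 0 = 1 \<and> R i (d i) = 1 \<and>
     (\<forall>r. \<forall>e\<in>keys (R i r). \<forall>j. j \<notin> Z \<longrightarrow> expo e j = 0))"

definition exch_data :: "nat \<Rightarrow> nat \<Rightarrow> (nat \<Rightarrow> nat) \<Rightarrow> (nat \<Rightarrow> nat \<Rightarrow> int) \<Rightarrow> bool" where
  "exch_data m n d b \<longleftrightarrow> n \<le> m \<and> skew_symmetrizable n b \<and>
     (\<forall>s\<in>{1..n}. d s > 0 \<and> (\<forall>i\<in>{1..m}. int (d s) dvd b i s))"

lemma skew_signs:
  assumes "skew_symmetrizable n b" "i \<in> {1..n}" "j \<in> {1..n}"
  shows "b i j > 0 \<longleftrightarrow> b j i < 0" "b i j < 0 \<longleftrightarrow> b j i > 0" "b i j = 0 \<longleftrightarrow> b j i = 0"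
proof -
  obtain D where D: "D i > 0" "D j > 0" "D i * b i j = - (D j * b j i)"
    using assms unfolding skew_symmetrizable_def by blast
  show 1: "b i j > 0 \<longleftrightarrow> b j i < 0"
    using D by (metis neg_0_less_iff_less mult_less_0_iff not_less_iff_gr_or_eq zero_less_mult_iff)
  show 2: "b i j < 0 \<longleftrightarrow> b j i > 0"
    using D by (metis neg_less_0_iff_less mult_less_0_iff not_less_iff_gr_or_eq zero_less_mult_iff)
  show "b i j = 0 \<longleftrightarrow> b j i = 0" using 1 2 by linarith
qed

lemma skew_diag: "skew_symmetrizable n b \<Longrightarrow> i \<in> {1..n} \<Longrightarrow> b i i = 0"
  using skew_signs[of n b i i] by force

lemma exch_data_div:
  assumes "exch_data m n d b" "i \<in> {1..n}" "j \<in> {1..m}"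
  shows "beta d b j i * int (d i) = b j i" "d i > 0"
    "b j i > 0 \<longleftrightarrow> beta d b j i > 0" "b j i < 0 \<longleftrightarrow> beta d b j i < 0"
proof -
  show 1: "beta d b j i * int (d i) = b j i" and 2: "d i > 0"
    using assms by (auto simp: exch_data_def beta_def)
  obtain q where q: "b j i = q * int (d i)" using 1 by metis
  then have "beta d b j i = q" using 2 by (simp add: beta_def)
  then show "b j i > 0 \<longleftrightarrow> beta d b j i > 0" "b j i < 0 \<longleftrightarrow> beta d b j i < 0"
    using 2 by (simp_all add: q zero_less_mult_iff mult_less_0_iff)
qed

lemma beta_eq_0: "b j i = 0 \<Longrightarrow> beta d b j i = 0"
  by (simp add: beta_def)

lemma ex_pol_keys:
  assumes "e \<in> keys (\<Sum>r\<in>A. R i r * lmon (ex_exp m d b i r))"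
  obtains r f where "r \<in> A" "f \<in> keys (R i r)" "e = f + ex_exp m d b i r"
proof -
  have "e \<in> (\<Union>r\<in>A. keys (R i r * lmon (ex_exp m d b i r)))"
    using assms keys_sum[of "\<lambda>r. R i r * lmon (ex_exp m d b i r)" A] by blast
  then obtain r where r: "r \<in> A" "e \<in> keys (R i r * lmon (ex_exp m d b i r))" by blast
  from r(2) show ?thesis by (rule keys_mult_cases) (use r that in auto)
qed

lemma ex_pol_expo:
  assumes "coef_data n d Z R" "i \<in> {1..n}" "f \<in> keys (R i r)" "j \<notin> Z"
  shows "expo (f + ex_exp m d b i r) j = expo (ex_exp m d b i r) j"
  using assms by (auto simp: coef_data_def lookup_add)

lemma ex_pol_ends:
  assumes "coef_data n d Z R" "i \<in> {1..n}"
  shows "ex_pol m d R b i - lmon (ex_exp m d b i 0) = (\<Sum>r\<in>{1..d i}. R i r * lmon (ex_exp m d b i r))"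
    and "ex_pol m d R b i - lmon (ex_exp m d b i (d i)) = (\<Sum>r\<in>{0..<d i}. R i r * lmon (ex_exp m d b i r))"
proof -
  have R: "R i 0 = 1" "R i (d i) = 1" using assms by (auto simp: coef_data_def)
  show "ex_pol m d R b i - lmon (ex_exp m d b i 0) = (\<Sum>r\<in>{1..d i}. R i r * lmon (ex_exp m d b i r))"
    unfolding ex_pol_def by (simp add: sum.atLeast_Suc_atMost R)
  show "ex_pol m d R b i - lmon (ex_exp m d b i (d i)) = (\<Sum>r\<in>{0..<d i}. R i r * lmon (ex_exp m d b i r))"
    unfolding ex_pol_def by (simp add: sum.last_plus R atLeastLessThanSuc_atLeastAtMost)
qed

text \<open>Two rows suffice to separate two columns: \<open>x\<close> and \<open>y\<close> are
  later chosen so that the weight vanishes on one column and is positive on the other.\<close>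

definition wdeg :: "nat \<Rightarrow> nat \<Rightarrow> int \<Rightarrow> int \<Rightarrow> (nat \<Rightarrow>\<^sub>0 int) \<Rightarrow> int" where
  "wdeg l l' x y e = x * expo e l + y * expo e l'"

lemma additive_wdeg [simp]: "additive_deg (wdeg l l' x y)"
  by (simp add: additive_deg_def wdeg_def lookup_add algebra_simps)

lemma wdeg_ex_exp:
  assumes "l \<in> {1..m}" "l' \<in> {1..m}" "r \<le> d i"
  shows "wdeg l l' x y (ex_exp m d b i r) = wdeg l l' x y (ex_exp m d b i 0) +
    int r * (x * beta d b l i + y * beta d b l' i)"
  using assms by (simp only: wdeg_def expo_ex_exp nat_pos_neg_part if_True le0) (simp add: algebra_simps)

lemma ex_pol_low_end:
  assumes "coef_data n d Z R" "i \<in> {1..n}" "l \<in> {1..m}" "l' \<in> {1..m}" "l \<notin> Z" "l' \<notin> Z"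
    and pos: "x * beta d b l i + y * beta d b l' i > 0"
    and e: "e \<in> keys (ex_pol m d R b i - lmon (ex_exp m d b i 0))"
  shows "wdeg l l' x y e > wdeg l l' x y (ex_exp m d b i 0)"
proof -
  from e obtain r f where r: "r \<in> {1..d i}" "f \<in> keys (R i r)" "e = f + ex_exp m d b i r"
    unfolding ex_pol_ends(1)[OF assms(1,2)] by (rule ex_pol_keys)
  have "wdeg l l' x y e = wdeg l l' x y (ex_exp m d b i r)"
    using ex_pol_expo[OF assms(1,2) r(2)] assms(5,6) by (simp add: wdeg_def r(3))
  also have "\<dots> = wdeg l l' x y (ex_exp m d b i 0) + int r * (x * beta d b l i + y * beta d b l' i)"
    by (rule wdeg_ex_exp) (use assms r in auto)
  finally show ?thesis using pos r(1) by simp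
qed

lemma ex_pol_low_key:
  assumes "coef_data n d Z R" "i \<in> {1..n}" "l \<in> {1..m}" "l' \<in> {1..m}" "l \<notin> Z" "l' \<notin> Z"
    and pos: "x * beta d b l i + y * beta d b l' i > 0"
  shows "ex_exp m d b i 0 \<in> keys (ex_pol m d R b i)"
proof -
  have "ex_exp m d b i 0 \<notin> keys (ex_pol m d R b i - lmon (ex_exp m d b i 0))"
    using ex_pol_low_end[OF assms] by blast
  then show ?thesis by (auto simp: in_keys_iff lookup_minus lmon_def)
qed

lemma ex_pol_nonzero:
  assumes "coef_data n d Z R" "i \<in> {1..n}" "l \<in> {1..m}" "l \<notin> Z" "exch_data m n d b" "b l i \<noteq> 0"
  shows "ex_pol m d R b i \<noteq> 0"
proof -
  have q: "beta d b l i \<noteq> 0" using exch_data_div(1)[OF assms(5,2,3)] assms(6) by auto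
  \<comment> \<open>The sign makes the term \<open>r = 0\<close>, whose coefficient is 1, the only
    one of lowest weight.\<close>
  define x where "x = sgn (beta d b l i)"
  have "x * beta d b l i + 0 * beta d b l i > 0"
    using q by (simp add: x_def zero_less_mult_iff sgn_if)
  from ex_pol_low_key[OF assms(1-3,3,4,4) this] show ?thesis by auto
qed

definition edges :: "nat \<Rightarrow> (nat \<Rightarrow> nat \<Rightarrow> int) \<Rightarrow> (nat \<times> nat) set" where
  "edges n b = {(i, j). i \<in> {1..n} \<and> j \<in> {1..n} \<and> b i j > 0}"

text \<open>The witness is the term \<open>r = 0\<close>: variables with positive entry in column
  \<open>j\<close> do not occur in it. A single positive entry ensures that it is not cancelled;
  without in-neighbours in \<open>J\<close> any term will do, which is where nonvanishing
  enters.\<close>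

lemma ex_pol_triangular:
  assumes C: "coef_data n d Z R" and B: "exch_data m n d b" and J: "J \<subseteq> {1..n}"
    and nz: "\<And>j. j \<in> J \<Longrightarrow> ex_pol m d R b j \<noteq> 0"
  shows "triangular (edges n b) J (ex_pol m d R b)"
  unfolding triangular_def
proof (intro ballI conjI impI)
  have nm: "n \<le> m" and skew: "skew_symmetrizable n b" using B by (auto simp: exch_data_def)
  have JZ: "i \<in> {1..n}" "i \<in> {1..m}" "i \<notin> Z" if "i \<in> J" for i
    using J C that nm by (auto simp: coef_data_def)
  fix j assume j: "j \<in> J"
  show "\<exists>e\<in>keys (ex_pol m d R b j). \<forall>i\<in>J. (i, j) \<in> edges n b \<longrightarrow> expo e i = 0"
  proof (cases "\<exists>i\<in>J. (i, j) \<in> edges n b")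
    case True
    then obtain i where i: "i \<in> J" "b i j > 0" by (auto simp: edges_def)
    have "1 * beta d b i j + 0 * beta d b i j > 0"
      using exch_data_div(3)[OF B JZ(1)[OF j] JZ(2)[OF i(1)]] i(2) by simp
    then have "ex_exp m d b j 0 \<in> keys (ex_pol m d R b j)"
      by (rule ex_pol_low_key[rotated 6]) (use C JZ i j in auto)
    moreover have "expo (ex_exp m d b j 0) i = 0" if "i \<in> J" "(i, j) \<in> edges n b" for i
      using exch_data_div(3)[OF B JZ(1)[OF j] JZ(2)[OF that(1)]] that(2)
      by (auto simp: expo_ex_exp edges_def)
    ultimately show ?thesis by blast
  next
    case False
    have "keys (ex_pol m d R b j) \<noteq> {}" using nz[OF j] by simp
    with False show ?thesis by blast
  qed
  fix e assume "e \<in> keys (ex_pol m d R b j)"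
  then obtain r f where r: "r \<in> {0..d j}" "f \<in> keys (R j r)" "e = f + ex_exp m d b j r"
    unfolding ex_pol_def by (rule ex_pol_keys)
  have e: "expo e i = expo (ex_exp m d b j r) i" if "i \<in> J" for i
    unfolding r(3) by (rule ex_pol_expo[OF C JZ(1)[OF j] r(2) JZ(3)[OF that]])
  show "expo e j = 0" using skew_diag[OF skew JZ(1)[OF j]] by (simp add: e[OF j] expo_ex_exp beta_eq_0)
  fix i assume i: "i \<in> J"
  show "expo e i \<ge> 0" by (simp add: e[OF i] expo_ex_exp)
  assume "(i, j) \<notin> edges n b \<and> (j, i) \<notin> edges n b"
  then have "b i j = 0"
    using skew_signs[OF skew JZ(1)[OF i] JZ(1)[OF j]] JZ(1)[OF i] JZ(1)[OF j] by (auto simp: edges_def)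
  then show "expo e i = 0" by (simp add: e[OF i] expo_ex_exp beta_eq_0)
qed

text \<open>The exponent of \<open>x_a\<close> in the \<open>r\<close>-th term is a positive
  multiple of \<open>d k - r\<close>, so only the term \<open>r = d k\<close> can avoid
  \<open>x_a\<close>.\<close>

lemma ex_pol_high_end:
  assumes C: "coef_data n d Z R" and B: "exch_data m n d b" and k: "k \<in> {1..n}"
    and a: "a \<in> {1..m}" "a \<notin> Z" "b a k < 0"
    and e: "e \<in> keys (ex_pol m d R b k - lmon (ex_exp m d b k (d k)))"
  shows "expo e a \<ge> 1"
proof -
  from e obtain r f where r: "r \<in> {0..<d k}" "f \<in> keys (R k r)" "e = f + ex_exp m d b k r"
    unfolding ex_pol_ends(2)[OF C k] by (rule ex_pol_keys)
  have neg: "beta d b a k < 0" using exch_data_div(4)[OF B k a(1)] a(3) by simp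
  have "expo e a = expo (ex_exp m d b k r) a"
    unfolding r(3) by (rule ex_pol_expo[OF C k r(2) a(2)])
  also have "\<dots> = int ((d k - r) * nat (- beta d b a k))"
    using a(1) neg by (simp add: expo_ex_exp)
  also have "\<dots> \<ge> 1"
  proof -
    have "0 < (d k - r) * nat (- beta d b a k)" using r(1) neg by simp
    then show ?thesis by linarith
  qed
  finally show ?thesis .
qed

text \<open>The unit monomial is the term \<open>r = d k\<close>. Of the variables of
  \<open>J'\<close> it could contain only those of in-neighbours of \<open>k\<close>, and a source
  has none.\<close>

lemma ex_pol_peelable:
  assumes C: "coef_data n d Z R" and B: "exch_data m n d b" and J: "J \<subseteq> {1..n}"
  shows "peelable (edges n b) J (ex_pol m d R b)"
  unfolding peelable_def
proof (intro allI impI ballI)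
  have nm: "n \<le> m" and skew: "skew_symmetrizable n b" using B by (auto simp: exch_data_def)
  fix J' k assume J': "J' \<subseteq> J" "k \<in> J'" and src: "\<forall>i\<in>J'. (i, k) \<notin> edges n b"
  have JZ: "i \<in> {1..n}" "i \<in> {1..m}" "i \<notin> Z" if "i \<in> J'" for i
    using J J' C that nm by (auto simp: coef_data_def)
  have "expo (ex_exp m d b k (d k)) i = 0" if i: "i \<in> J'" for i
  proof -
    have "\<not> b i k > 0" using src i JZ(1)[OF i] JZ(1)[OF J'(2)] by (auto simp: edges_def)
    then show ?thesis
      using exch_data_div(3)[OF B JZ(1)[OF J'(2)] JZ(2)[OF i]] by (simp add: expo_ex_exp)
  qed
  moreover have "expo e a \<ge> 1"
    if e: "e \<in> keys (ex_pol m d R b k - lmon (ex_exp m d b k (d k)))" and a: "a \<in> J'" "(k, a) \<in> edges n b" for e a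
  proof -
    have "b a k < 0" using a(2) skew_signs(1)[OF skew JZ(1)[OF J'(2)] JZ(1)[OF a(1)]] by (auto simp: edges_def)
    then show ?thesis by (rule ex_pol_high_end[OF C B JZ(1)[OF J'(2)] JZ(2,3)[OF a(1)] _ e])
  qed
  ultimately show "\<exists>e0. (\<forall>i\<in>J'. expo e0 i = 0) \<and>
      (\<forall>e\<in>keys (ex_pol m d R b k - lmon e0). \<forall>a\<in>J'. (k, a) \<in> edges n b \<longrightarrow> 1 \<le> expo e a)"
    by blast
qed

text \<open>Linear independence of the columns restricted to the rows in \<open>L\<close>. Speaking
  of kernel vectors suits mutation, which transforms them by an explicit formula.\<close>

definition full_rank :: "nat set \<Rightarrow> nat \<Rightarrow> (nat \<Rightarrow> nat \<Rightarrow> int) \<Rightarrow> bool" where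
  "full_rank L n b \<longleftrightarrow>
     (\<forall>v. (\<forall>l\<in>L. (\<Sum>i=1..n. b l i * v i) = 0) \<longrightarrow> (\<forall>i\<in>{1..n}. v i = 0))"

lemma full_rankD:
  assumes "full_rank L n b" "\<And>l. l \<in> L \<Longrightarrow> (\<Sum>i=1..n. b l i * v i) = 0" "i \<in> {1..n}"
  shows "v i = 0"
  using assms(1)[unfolded full_rank_def, THEN spec, of v] assms(2,3) by blast

text \<open>If all minors through a nonzero entry \<open>b l i\<close> vanished, \<open>v\<close>
  with \<open>v i = b l j\<close> and \<open>v j = - b l i\<close> would be a kernel vector.\<close>

lemma full_rank_minor:
  assumes fr: "full_rank L n b" and ij: "i \<in> {1..n}" "j \<in> {1..n}" "i \<noteq> j"
  obtains l l' where "l \<in> L" "l' \<in> L" "b l i * b l' j \<noteq> b l' i * b l j"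
proof -
  have col: "\<exists>l\<in>L. b l i \<noteq> 0" if "i \<in> {1..n}" for i
  proof (rule ccontr)
    assume "\<not> ?thesis"
    then have "\<forall>l\<in>L. (\<Sum>k=1..n. b l k * (if k = i then 1 else 0)) = 0"
      by (auto simp: if_distrib cong: if_cong)
    with full_rankD[OF fr, of "\<lambda>k. if k = i then 1 else 0" i] that show False by simp
  qed
  obtain l where l: "l \<in> L" "b l i \<noteq> 0" using col[OF ij(1)] by blast
  have "\<exists>l'\<in>L. b l i * b l' j \<noteq> b l' i * b l j"
  proof (rule ccontr)
    assume "\<not> ?thesis"
    then have eq: "b l i * b l' j = b l' i * b l j" if "l' \<in> L" for l' using that by blast
    define v where "v = (\<lambda>k. if k = i then b l j else if k = j then - b l i else 0)"
    have "(\<Sum>k=1..n. b l' k * v k) = 0" if "l' \<in> L" for l'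
    proof -
      have "(\<Sum>k=1..n. b l' k * v k) = (\<Sum>k\<in>{i, j}. b l' k * v k)"
        by (rule sum.mono_neutral_right) (use ij in \<open>auto simp: v_def\<close>)
      also have "\<dots> = 0" using ij(3) eq[OF that] by (simp add: v_def mult.commute)
      finally show ?thesis .
    qed
    then have "v j = 0" by (rule full_rankD[OF fr _ ij(2)])
    then show False using l ij by (simp add: v_def)
  qed
  then show ?thesis using that l by blast
qed

lemma ex_pol_coprime:
  assumes C: "coef_data n d Z R" and B: "exch_data m n d b" and fr: "full_rank L n b"
    and L: "L \<subseteq> {1..m}" "L \<inter> Z = {}"
  shows "pairwise_coprime {1..n} (ex_pol m d R b)"
  unfolding pairwise_coprime_def
proof (intro ballI impI allI)
  fix i j g assume ij: "i \<in> {1..n}" "j \<in> {1..n}" "i \<noteq> j" and dv: "ex_pol m d R b i dvd ex_pol m d R b j * g"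
  obtain l l' where l: "l \<in> L" "l' \<in> L" "b l i * b l' j \<noteq> b l' i * b l j"
    using full_rank_minor[OF fr ij] by blast
  have lm: "l \<in> {1..m}" "l' \<in> {1..m}" "l \<notin> Z" "l' \<notin> Z" using l L by auto
  define \<beta> where "\<beta> = beta d b"
  have \<beta>: "b l i = \<beta> l i * int (d i)" if "l \<in> {1..m}" "i \<in> {1..n}" for l i
    unfolding \<beta>_def by (rule exch_data_div(1)[OF B that(2,1), symmetric])
  have "\<beta> l' i * \<beta> l j - \<beta> l i * \<beta> l' j \<noteq> 0"
    using l(3) \<beta>[OF lm(1) ij(1)] \<beta>[OF lm(2) ij(1)] \<beta>[OF lm(1) ij(2)] \<beta>[OF lm(2) ij(2)] by auto
  then obtain s :: int where s: "s * (\<beta> l' i * \<beta> l j - \<beta> l i * \<beta> l' j) > 0"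
    by (metis (no_types) linorder_neqE_linordered_idom mult_1 mult_minus1 neg_0_less_iff_less)
  \<comment> \<open>This weight is orthogonal to column \<open>i\<close>, so \<open>P_i\<close> is
    homogeneous. On column \<open>j\<close> it equals \<open>s\<close> times the nonzero minor, and
    \<open>s\<close> was taken with the sign that makes it positive.\<close>
  define x where "x = s * \<beta> l' i"
  define y where "y = - (s * \<beta> l i)"
  have xi: "x * beta d b l i + y * beta d b l' i = 0"
    unfolding \<beta>_def[symmetric] by (simp add: x_def y_def)
  have xj: "x * beta d b l j + y * beta d b l' j > 0"
    unfolding \<beta>_def[symmetric] using s by (simp add: x_def y_def algebra_simps)
  show "ex_pol m d R b i dvd g"
  proof (rule weight_coprime[OF additive_wdeg _ _ dv])
    fix e assume "e \<in> keys (ex_pol m d R b i)"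
    then obtain r f where r: "r \<in> {0..d i}" "f \<in> keys (R i r)" "e = f + ex_exp m d b i r"
      unfolding ex_pol_def by (rule ex_pol_keys)
    have "wdeg l l' x y e = wdeg l l' x y (ex_exp m d b i r)"
      using ex_pol_expo[OF C ij(1) r(2)] lm(3,4) by (simp add: wdeg_def r(3))
    also have "\<dots> = wdeg l l' x y (ex_exp m d b i 0)"
      using wdeg_ex_exp[of l m l' r d i x y b] lm r(1) xi by simp
    finally show "wdeg l l' x y e = wdeg l l' x y (ex_exp m d b i 0)" .
  next
    fix e assume "e \<in> keys (ex_pol m d R b j - lmon (ex_exp m d b j 0))"
    then show "wdeg l l' x y e > wdeg l l' x y (ex_exp m d b j 0)"
      by (rule ex_pol_low_end[OF C ij(2) lm xj])
  qed
qed

lemma ex_pol_upper_subset_lower: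
  assumes C: "coef_data n d Z R" and B: "exch_data m n d b" and fr: "full_rank L n b"
    and L: "L \<subseteq> {1..m}" "L \<inter> Z = {}" and J: "J \<subseteq> {1..n}" and src: "sourced (edges n b) J"
    and nz: "\<And>j. j \<in> J \<Longrightarrow> ex_pol m d R b j \<noteq> 0"
  shows "(\<Inter>j\<in>J. lower (ex_pol m d R b) {j}) \<subseteq> lower (ex_pol m d R b) J"
proof (rule upper_subset_lower[OF _ src])
  show "finite J" using J by (rule finite_subset) simp
  show "pairwise_coprime J (ex_pol m d R b)"
    using ex_pol_coprime[OF C B fr L] J unfolding pairwise_coprime_def by blast
qed (use ex_pol_triangular[OF C B J nz] ex_pol_peelable[OF C B J] in auto)

lemma sourced_acyclic:
  assumes "acyclic (edges n b)"
  shows "sourced (edges n b) {1..n}"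
  unfolding sourced_def
proof (intro allI impI)
  fix J' :: "nat set" assume J': "J' \<subseteq> {1..n}" "J' \<noteq> {}"
  have "finite (edges n b)"
    by (rule finite_subset[of _ "{1..n} \<times> {1..n}"]) (auto simp: edges_def)
  then have "wf (edges n b)" using assms by (rule finite_acyclic_wf)
  moreover obtain x where "x \<in> J'" using J' by blast
  ultimately obtain k where "k \<in> J'" "\<And>y. (y, k) \<in> edges n b \<Longrightarrow> y \<notin> J'" by (rule wfE_min) blast
  then show "\<exists>k\<in>J'. \<forall>i\<in>J'. (i, k) \<notin> edges n b" by blast
qed

text \<open>\<open>b i j\<close> and \<open>b j i\<close> have opposite signs, so two directions
  never form a cycle. Thus the result for acyclic sets applies to pairs in every seed, acyclic or
  not.\<close>

lemma sourced_pair: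
  assumes skew: "skew_symmetrizable n b" and ij: "i \<in> {1..n}" "j \<in> {1..n}"
  shows "sourced (edges n b) {i, j}"
  unfolding sourced_def
proof (intro allI impI)
  have no: "(i, i) \<notin> edges n b" "(j, j) \<notin> edges n b" "(i, j) \<notin> edges n b \<or> (j, i) \<notin> edges n b"
    using skew_signs[OF skew ij] skew_diag[OF skew ij(1)] skew_diag[OF skew ij(2)]
    by (auto simp: edges_def)
  fix J' assume J': "J' \<subseteq> {i, j}" "J' \<noteq> {}"
  show "\<exists>k\<in>J'. \<forall>l\<in>J'. (l, k) \<notin> edges n b"
  proof (cases "J' = {i, j}")
    case True
    then show ?thesis using no by auto
  next
    case False
    then obtain k where "J' = {k}" "k = i \<or> k = j" using J' by blast
    then show ?thesis using no by auto
  qed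
qed


section \<open>Evaluation of Laurent polynomials\<close>

definition mon :: "(nat \<Rightarrow> 'a::field_char_0) \<Rightarrow> (nat \<Rightarrow>\<^sub>0 int) \<Rightarrow> 'a" where
  "mon x e = (\<Prod>j\<in>keys e. x j powi expo e j)"

definition ev :: "(nat \<Rightarrow> 'a::field_char_0) \<Rightarrow> lau \<Rightarrow> 'a" where
  "ev x F = (\<Sum>e\<in>keys F. of_int (lookup F e) * mon x e)"

lemma mon_superset: "finite B \<Longrightarrow> keys e \<subseteq> B \<Longrightarrow> mon x e = (\<Prod>j\<in>B. x j powi expo e j)"
  unfolding mon_def by (rule prod.mono_neutral_left) (auto simp: in_keys_iff)

lemma ev_superset:
  "finite B \<Longrightarrow> keys F \<subseteq> B \<Longrightarrow> ev x F = (\<Sum>e\<in>B. of_int (lookup F e) * mon x e)"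
  unfolding ev_def by (rule sum.mono_neutral_left) (auto simp: in_keys_iff)

lemma mon_add:
  assumes "\<And>j. x j \<noteq> 0"
  shows "mon x (e + f) = mon x e * mon x f"
proof -
  have *: "finite (keys e \<union> keys f)" "keys (e + f) \<subseteq> keys e \<union> keys f"
    by (auto simp: in_keys_iff lookup_add)
  show ?thesis
    using mon_superset[OF *, of x] mon_superset[OF *(1), of e x] mon_superset[OF *(1), of f x] assms
    by (simp add: lookup_add power_int_add prod.distrib)
qed

lemma ev_0 [simp]: "ev x 0 = 0"
  by (simp add: ev_def)

lemma ev_add: "ev x (F + G) = ev x F + ev x G"
proof -
  have *: "finite (keys F \<union> keys G)" "keys (F + G) \<subseteq> keys F \<union> keys G"
    by (auto simp: in_keys_iff lookup_add)
  show ?thesis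
    using ev_superset[OF *, of x] ev_superset[OF *(1), of F x] ev_superset[OF *(1), of G x]
    by (simp add: lookup_add distrib_right sum.distrib)
qed

lemma ev_uminus: "ev x (- F) = - ev x F"
  using ev_add[of x F "- F"] by (simp add: add_eq_0_iff)

lemma ev_diff: "ev x (F - G) = ev x F - ev x G"
  using ev_add[of x F "- G"] by (simp add: ev_uminus)

lemma ev_sum: "ev x (\<Sum>i\<in>A. f i) = (\<Sum>i\<in>A. ev x (f i))"
  by (induction A rule: infinite_finite_induct) (auto simp: ev_add)

lemma ev_lmon [simp]: "ev x (lmon e) = mon x e"
  by (simp add: ev_def) (simp add: lmon_def)

lemma ev_of_int_lmon: "ev x (of_int c * lmon e) = of_int c * mon x e"
  unfolding of_int_lmon by (simp add: ev_superset[of "{e}"])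

lemma ev_mult:
  assumes x: "\<And>j. x j \<noteq> 0"
  shows "ev x (F * G) = ev x F * ev x G"
proof -
  let ?c = "\<lambda>F e. of_int (lookup F e) :: lau"
  have "F * G = (\<Sum>e\<in>keys F. \<Sum>f\<in>keys G. of_int (lookup F e * lookup G f) * lmon (e + f))"
    by (subst lau_expand[of F], subst lau_expand[of G]) (simp add: sum_product lmon_add mult_ac)
  then have "ev x (F * G) = (\<Sum>e\<in>keys F. \<Sum>f\<in>keys G.
      of_int (lookup F e) * mon x e * (of_int (lookup G f) * mon x f))"
    by (simp only: ev_sum ev_of_int_lmon mon_add[OF x]) (simp add: mult_ac)
  then show ?thesis by (simp add: ev_def sum_product)
qed

lemma ev_1 [simp]: "ev x 1 = 1"
  using ev_lmon[of x 0] by (simp add: mon_def del: ev_lmon)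

lemma ev_prod:
  assumes "\<And>j. x j \<noteq> 0"
  shows "ev x (\<Prod>i\<in>A. f i) = (\<Prod>i\<in>A. ev x (f i))"
  by (induction A rule: infinite_finite_induct) (auto simp: ev_mult[OF assms])

lemma ev_power: "(\<And>j. x j \<noteq> 0) \<Longrightarrow> ev x (F ^ k) = ev x F ^ k"
  by (induction k) (auto simp: ev_mult)

lemma mon_single [simp]: "mon x (single j k) = x j powi k"
  by (cases "k = 0") (auto simp: mon_def)

lemma ev_X [simp]: "ev x (X j) = x j"
  by (simp add: X_def)

lemma mon_cong: "(\<And>j. expo e j \<noteq> 0 \<Longrightarrow> x j = y j) \<Longrightarrow> mon x e = mon y e"
  unfolding mon_def by (rule prod.cong) (auto simp: in_keys_iff)

lemma ev_cong: "(\<And>e j. e \<in> keys F \<Longrightarrow> expo e j \<noteq> 0 \<Longrightarrow> x j = y j) \<Longrightarrow> ev x F = ev y F"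
  unfolding ev_def by (intro sum.cong refl arg_cong2[where f = "(*)"] mon_cong) auto

lemma ev_in_subring:
  assumes "is_subring R" "\<And>e. e \<in> keys F \<Longrightarrow> mon x e \<in> R"
  shows "ev x F \<in> R"
  unfolding ev_def using assms by (intro subring_sum subring_mult subring_of_int)

lemma is_subring_ev_image:
  assumes "\<And>j. x j \<noteq> 0" "is_subring R"
  shows "is_subring (ev x ` R)"
  using assms(2) unfolding is_subring_def
  by (auto simp: ev_mult[OF assms(1), symmetric] ev_diff[symmetric] intro: image_eqI[of _ _ 1])

text \<open>With the default 1, nonzero variables give nonzero values at all indices, so evaluation
  is a ring homomorphism on all of \<open>lau\<close>. Applied to the deformation it also is the
  specialisation of the extra variables.\<close>

definition ext :: "nat \<Rightarrow> (nat \<Rightarrow> 'a::field_char_0) \<Rightarrow> nat \<Rightarrow> 'a" where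
  "ext m x j = (if j \<in> {1..m} then x j else 1)"

definition vars :: "nat \<Rightarrow> lau set" where
  "vars m = supp {e. \<forall>j. j \<notin> {1..m} \<longrightarrow> expo e j = 0}"

lemma vars_iff: "F \<in> vars m \<longleftrightarrow> (\<forall>e\<in>keys F. \<forall>j. j \<notin> {1..m} \<longrightarrow> expo e j = 0)"
  by (simp add: vars_def supp_iff)

lemma is_subring_vars: "is_subring (vars m)"
  unfolding vars_def by (rule is_subring_supp) (auto simp: lookup_add)

lemma lmon_single_vars: "j \<in> {1..m} \<Longrightarrow> xpow j k \<in> vars m"
  by (auto simp: vars_iff lookup_single when_def)

text \<open>Algebraic independence for integer Laurent polynomials: it lets identities in the
  ambient field be read back as identities in \<open>lau\<close>.\<close>

definition laurent_indep :: "nat \<Rightarrow> (nat \<Rightarrow> 'a::field_char_0) \<Rightarrow> bool" where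
  "laurent_indep m x \<longleftrightarrow> (\<forall>j\<in>{1..m}. x j \<noteq> 0) \<and> (\<forall>F\<in>vars m. ev (ext m x) F = 0 \<longrightarrow> F = 0)"

lemma ext_nonzero: "laurent_indep m x \<Longrightarrow> ext m x j \<noteq> 0"
  by (simp add: laurent_indep_def ext_def)

lemma laurent_indep_inj:
  assumes "laurent_indep m x" "F \<in> vars m" "G \<in> vars m" "ev (ext m x) F = ev (ext m x) G"
  shows "F = G"
  using assms subring_diff[OF is_subring_vars assms(2,3)] unfolding laurent_indep_def
  by (metis ev_diff eq_iff_diff_eq_0)

lemma ev_range_vars:
  assumes "\<And>j. ext m x j \<noteq> 0"
  obtains G where "G \<in> vars m" "ev (ext m x) F = ev (ext m x) G"
proof -
  have "ev (ext m x) F \<in> ev (ext m x) ` vars m"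
  proof (rule ev_in_subring[OF is_subring_ev_image[OF assms is_subring_vars]])
    fix e :: "nat \<Rightarrow>\<^sub>0 int"
    define f where "f = (\<Sum>j\<in>{1..m}. single j (expo e j))"
    have f: "expo f i = (if i \<in> {1..m} then expo e i else 0)" for i
      unfolding f_def by (rule lookup_sum_single) simp
    have "mon (ext m x) e = (\<Prod>j\<in>keys e \<union> {1..m}. ext m x j powi expo e j)"
      by (rule mon_superset) auto
    also have "\<dots> = (\<Prod>j\<in>keys e \<union> {1..m}. ext m x j powi expo f j)"
      by (rule prod.cong) (auto simp: f ext_def)
    also have "\<dots> = mon (ext m x) f"
      by (rule mon_superset[symmetric]) (auto simp: in_keys_iff f split: if_splits)
    finally have "mon (ext m x) e = ev (ext m x) (lmon f)" by simp
    moreover have "lmon f \<in> vars m" by (simp add: vars_iff f)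
    ultimately show "mon (ext m x) e \<in> ev (ext m x) ` vars m" by blast
  qed
  then show ?thesis using that by blast
qed

text \<open>Substituting \<open>P / x_i\<close> for \<open>x_i\<close> turns degree \<open>s\<close>
  into \<open>- s\<close> and produces \<open>P powi s\<close>; the factor
  \<open>ev (ext m x) p ^ N\<close> clears negative powers of \<open>P\<close>. The components of
  \<open>F\<close> and \<open>G\<close> correspond to each other, which transports both independence
  and divisibility.\<close>

lemma ev_exchange:
  assumes x: "\<And>j. ext m x j \<noteq> 0" and i: "i \<in> {1..m}" and p: "p \<in> vars m" "p \<in> rest {i}"
    and P0: "ev (ext m x) p \<noteq> 0"
    and x': "x' = x(i := inverse (x i) * ev (ext m x) p)" and F: "F \<in> vars m"
  obtains N :: nat and G where "G \<in> vars m" "ev (ext m x') F * ev (ext m x) p ^ N = ev (ext m x) G"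
    "\<And>s. hpart (deg i) (- s) G = hpart (deg i) s F * xpow i (- 2 * s) * p ^ nat (int N + s)"
proof -
  \<comment> \<open>Minus the lowest degree of \<open>F\<close> in \<open>x_i\<close>, or 0 if that
    degree is positive, so that \<open>int N + s\<close> is nonnegative for every degree
    \<open>s\<close> that occurs.\<close>
  define N where "N = nat (- Min ((deg i) ` keys F))"
  have N: "int N + s \<ge> 0" if "s \<in> deg i ` keys F" for s
  proof -
    have "Min ((deg i) ` keys F) \<le> s" using that by (intro Min_le) auto
    then show ?thesis unfolding N_def by linarith
  qed
  define t where "t = (\<lambda>s. hpart (deg i) s F * xpow i (- 2 * s) * p ^ nat (int N + s))"
  define G where "G = (\<Sum>s\<in>deg i ` keys F. t s)"
  have pw: "p ^ k \<in> rest {i}" "p ^ k \<in> vars m" for k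
    using p by (auto intro: subring_power is_subring_rest is_subring_vars)
  have tdeg: "deg i e = - s" if "e \<in> keys (t s)" for e s
  proof -
    from that[unfolded t_def]
    obtain f h where "f \<in> keys (hpart (deg i) s F * xpow i (- 2 * s))"
      "h \<in> keys (p ^ nat (int N + s))" "e = f + h"
      by (rule keys_mult_cases)
    moreover from this(1) obtain g where "g \<in> keys (hpart (deg i) s F)" "f = g + single i (- 2 * s)"
      by (auto elim!: keys_mult_cases)
    ultimately show ?thesis
      using pw(1)[of "nat (int N + s)"] by (auto simp: deg_def lookup_add keys_hpart rest_iff)
  qed
  have tvars: "t s \<in> vars m" for s
  proof -
    have "hpart (deg i) s F \<in> vars m" using F by (auto simp: vars_iff keys_hpart)
    then show ?thesis unfolding t_def
      by (intro subring_mult[OF is_subring_vars] lmon_single_vars[OF i] pw)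
  qed
  have cG: "hpart (deg i) (- s) G = t s" for s
  proof -
    have "hpart (deg i) (- s) G = (\<Sum>u\<in>deg i ` keys F. hpart (deg i) (- s) (t u))"
      by (simp add: G_def hpart_sum)
    also have "\<dots> = (\<Sum>u\<in>deg i ` keys F. if u = s then t s else 0)"
    proof (rule sum.cong[OF refl])
      fix u
      show "hpart (deg i) (- s) (t u) = (if u = s then t s else 0)"
      proof (cases "u = s")
        case True
        then show ?thesis using tdeg[of _ s] by (auto intro: hpart_id)
      next
        case False
        then have "hpart (deg i) (- s) (t u) = 0" using tdeg[of _ u] by (intro hpart_eq_0) auto
        then show ?thesis using False by simp
      qed
    qed
    also have "\<dots> = t s"
    proof (cases "s \<in> deg i ` keys F")
      case False
      then have "hpart (deg i) s F = 0" by (intro hpart_eq_0) auto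
      then show ?thesis using False by (simp add: t_def)
    qed simp
    finally show ?thesis .
  qed
  let ?x = "ext m x" and ?x' = "ext m x'" and ?P = "ev (ext m x) p"
  have xi: "x i \<noteq> 0" using x[of i] i by (simp add: ext_def)
  have x'i: "?x' i = ?P / x i" using i by (simp add: ext_def x' field_simps)
  have x'0: "?x' j \<noteq> 0" for j using x[of j] xi P0 i by (auto simp: ext_def x')
  have part: "ev ?x' (hpart (deg i) s F) * ?P ^ N = ev ?x (t s)" if s: "s \<in> deg i ` keys F" for s
  proof -
    define H where "H = xpow i (- s) * hpart (deg i) s F"
    have Hr: "H \<in> rest {i}" unfolding H_def by (rule shifted_cmp_in_rest)
    have cH: "hpart (deg i) s F = xpow i s * H"
      unfolding H_def by (rule hpart_deg_times_X)
    have eH: "ev ?x' H = ev ?x H"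
      by (rule ev_cong) (use Hr in \<open>auto simp: rest_iff ext_def x'\<close>)
    have Ppow: "?P powi s * ?P ^ N = ?P ^ nat (int N + s)"
    proof -
      have "?P powi s * ?P ^ N = ?P powi (s + int N)" using P0 by (simp add: power_int_add)
      also have "\<dots> = ?P ^ nat (int N + s)" using N[OF s] by (simp add: power_int_def add.commute)
      finally show ?thesis .
    qed
    have "ev ?x' (hpart (deg i) s F) * ?P ^ N = (?P / x i) powi s * ev ?x H * ?P ^ N"
      unfolding cH by (simp add: ev_mult[OF x'0] eH x'i)
    also have "\<dots> = ev ?x H * x i powi (- s) * (?P powi s * ?P ^ N)"
      unfolding power_int_divide_distrib power_int_minus by (simp add: divide_inverse)
    also have "\<dots> = ev ?x H * x i powi (- s) * ?P ^ nat (int N + s)" by (simp only: Ppow)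
    also have "x i powi (- s) = x i powi s * x i powi (- 2 * s)"
      using xi by (simp flip: power_int_add)
    also have "ev ?x H * (x i powi s * x i powi (- 2 * s)) * ?P ^ nat (int N + s) = ev ?x (t s)"
    proof -
      have exi: "ext m x i = x i" using i by (simp add: ext_def)
      show ?thesis
        unfolding t_def cH ev_mult[OF x] ev_power[OF x] ev_lmon mon_single exi by (simp add: mult_ac)
    qed
    finally show ?thesis .
  qed
  have "ev ?x' F = (\<Sum>s\<in>deg i ` keys F. ev ?x' (hpart (deg i) s F))"
    using hpart_decomp[of "deg i ` keys F" "deg i" F] by (simp flip: ev_sum)
  then have "ev ?x' F * ?P ^ N = (\<Sum>s\<in>deg i ` keys F. ev ?x' (hpart (deg i) s F) * ?P ^ N)"
    by (simp add: sum_distrib_right)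
  also have "\<dots> = ev ?x G" by (simp add: G_def ev_sum part)
  finally have "ev ?x' F * ?P ^ N = ev ?x G" .
  moreover have "G \<in> vars m" unfolding G_def by (intro subring_sum[OF is_subring_vars] tvars)
  ultimately show ?thesis using that cG unfolding t_def by blast
qed

text \<open>A relation in the new variables gives \<open>G = 0\<close>, and then every component of
  \<open>F\<close> vanishes, as \<open>p\<close> is no zero divisor.\<close>

lemma laurent_indep_exchange:
  assumes x: "laurent_indep m x" and i: "i \<in> {1..m}" and p: "p \<in> vars m" "p \<in> rest {i}" "p \<noteq> 0"
  shows "laurent_indep m (x(i := inverse (x i) * ev (ext m x) p))"
proof -
  have P0: "ev (ext m x) p \<noteq> 0" using x p(1,3) unfolding laurent_indep_def by blast
  have x0: "x j \<noteq> 0" if "j \<in> {1..m}" for j using x that by (simp add: laurent_indep_def)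
  have "F = 0" if F: "F \<in> vars m" and F0: "ev (ext m (x(i := inverse (x i) * ev (ext m x) p))) F = 0" for F
  proof -
    obtain N G where G: "G \<in> vars m"
      "ev (ext m (x(i := inverse (x i) * ev (ext m x) p))) F * ev (ext m x) p ^ N = ev (ext m x) G"
      "\<And>s. hpart (deg i) (- s) G = hpart (deg i) s F * xpow i (- 2 * s) * p ^ nat (int N + s)"
      using ev_exchange[OF ext_nonzero[OF x] i p(1,2) P0 refl F] by metis
    have "G = 0" using G(1,2) F0 x unfolding laurent_indep_def by simp
    then have "hpart (deg i) s F = 0" for s using G(3)[of s] p(3) by simp
    then show "F = 0" using hpart_decomp[of "deg i ` keys F" "deg i" F] by simp
  qed
  then show ?thesis using x0 P0 i unfolding laurent_indep_def by auto
qed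

text \<open>In the identity \<open>p i ^ N * F = G\<close>, the component of degree
  \<open>- r\<close> of \<open>G\<close> carries the factor \<open>p i ^ (N + r)\<close>. Cancelling
  \<open>p i ^ N\<close> leaves the divisibility demanded by \<open>lower_singleI\<close>.\<close>

lemma common_laurent_in_lower:
  assumes x: "laurent_indep m x" and i: "i \<in> {1..m}" and p: "p i \<in> vars m" "p i \<in> rest {i}" "p i \<noteq> 0"
    and F: "F \<in> vars m" and F': "F' \<in> vars m"
    and eq: "ev (ext m x) F = ev (ext m (x(i := inverse (x i) * ev (ext m x) (p i)))) F'"
  shows "F \<in> lower p {i}"
proof (rule lower_singleI[where p = p and k = i, OF _ p(2)])
  have P0: "ev (ext m x) (p i) \<noteq> 0" using x p(1,3) unfolding laurent_indep_def by blast
  obtain N G where G: "G \<in> vars m"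
    "ev (ext m (x(i := inverse (x i) * ev (ext m x) (p i)))) F' * ev (ext m x) (p i) ^ N = ev (ext m x) G"
    "\<And>s. hpart (deg i) (- s) G = hpart (deg i) s F' * xpow i (- 2 * s) * p i ^ nat (int N + s)"
    using ev_exchange[OF ext_nonzero[OF x] i p(1,2) P0 refl F'] by metis
  have "ev (ext m x) (p i ^ N * F) = ev (ext m x) G"
    using G(2) eq by (simp add: ev_mult[OF ext_nonzero[OF x]] ev_power[OF ext_nonzero[OF x]] mult.commute)
  from laurent_indep_inj[OF x _ G(1) this] have FG: "p i ^ N * F = G"
    by (rule meta_mp) (use p F in \<open>auto intro: subring_mult subring_power is_subring_vars\<close>)
  fix r :: nat
  have "p i ^ N \<in> rest {i}" using p(2) by (intro subring_power is_subring_rest)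
  then have "hpart (deg i) (- int r) (p i ^ N * F) = p i ^ N * hpart (deg i) (- int r - 0) F"
    by (intro hpart_mult_hom) (auto simp: rest_iff deg_def)
  then have "p i ^ N * hpart (deg i) (- int r) F =
      hpart (deg i) (int r) F' * xpow i (- 2 * int r) * p i ^ nat (int N + int r)"
    using FG G(3)[of "int r"] by simp
  also have "\<dots> = p i ^ N * (p i ^ r * (hpart (deg i) (int r) F' * xpow i (- 2 * int r)))"
    by (simp add: nat_add_distrib power_add mult_ac)
  finally have "hpart (deg i) (- int r) F = p i ^ r * (hpart (deg i) (int r) F' * xpow i (- 2 * int r))"
    using p(3) by simp
  then show "p i ^ r dvd hpart (deg i) (- int r) F" by simp
qed

section \<open>Mutation of seeds\<close>

definition bmut :: "nat \<Rightarrow> (nat \<Rightarrow> nat \<Rightarrow> int) \<Rightarrow> nat \<Rightarrow> nat \<Rightarrow> int" where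
  "bmut i b = (\<lambda>k l. if k = i \<or> l = i then - b k l
     else b k l + max (b i l) 0 * b k i + b i l * max (- b k i) 0)"

definition rmut :: "nat \<Rightarrow> (nat \<Rightarrow> nat) \<Rightarrow> (nat \<Rightarrow> nat \<Rightarrow> 'a) \<Rightarrow> nat \<Rightarrow> nat \<Rightarrow> 'a" where
  "rmut i d R = R(i := (\<lambda>r. R i (d i - r)))"

lemma mutate_sel [simp]:
  "clus (mutate m d i S) = (clus S)(i := new_var m d S i)"
  "rho (mutate m d i S) = rmut i d (rho S)"
  "bmat (mutate m d i S) = bmut i (bmat S)"
  by (simp_all add: mutate_def bmut_def rmut_def fun_eq_iff)

text \<open>The same symmetrizer \<open>D\<close> works: it exchanges the two correction terms of
  the mutation rule, because \<open>D k * max (b k l) 0 = D l * max (- b l k) 0\<close>.\<close>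

lemma skew_symmetrizable_bmut:
  assumes "skew_symmetrizable n b" "i \<in> {1..n}"
  shows "skew_symmetrizable n (bmut i b)"
proof -
  obtain D :: "nat \<Rightarrow> int" where D: "\<And>i. i \<in> {1..n} \<Longrightarrow> D i > 0"
    "\<And>i j. i \<in> {1..n} \<Longrightarrow> j \<in> {1..n} \<Longrightarrow> D i * b i j = - (D j * b j i)"
    using assms unfolding skew_symmetrizable_def by blast
  have max: "D k * max (b k l) 0 = D l * max (- b l k) 0" if "k \<in> {1..n}" "l \<in> {1..n}" for k l
    using D(1)[OF that(1)] D(1)[OF that(2)] D(2)[OF that]
    by (simp add: max_mult_distrib_left[symmetric] max_def)
      (smt (verit) mult_less_0_iff mult_minus_right zero_less_mult_iff mult_eq_0_iff)
  have "D k * bmut i b k l = - (D l * bmut i b l k)" if kl: "k \<in> {1..n}" "l \<in> {1..n}" for k l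
  proof (cases "k = i \<or> l = i")
    case True
    then show ?thesis using D(2)[OF kl] by (auto simp: bmut_def)
  next
    case False
    have 1: "D k * b k i = - (D i * b i k)" "D l * b l i = - (D i * b i l)"
      by (rule D(2); use kl assms in simp)+
    have 2: "D k * max (- b k i) 0 = D i * max (b i k) 0" "D l * max (- b l i) 0 = D i * max (b i l) 0"
      using max[OF assms(2) kl(1)] max[OF assms(2) kl(2)] by simp_all
    have "D k * (b k l + max (b i l) 0 * b k i + b i l * max (- b k i) 0) =
      D k * b k l + max (b i l) 0 * (D k * b k i) + b i l * (D k * max (- b k i) 0)"
      by (simp add: algebra_simps)
    also have "\<dots> = - (D l * b l k + max (b i k) 0 * (D l * b l i) + b i k * (D l * max (- b l i) 0))"
      unfolding 1 2 D(2)[OF kl] by (simp add: algebra_simps)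
    also have "\<dots> = - (D l * (b l k + max (b i k) 0 * b l i + b i k * max (- b l i) 0))"
      by (simp add: algebra_simps)
    finally show ?thesis using False by (simp add: bmut_def)
  qed
  then show ?thesis unfolding skew_symmetrizable_def using D(1) by blast
qed

lemma exch_data_bmut:
  assumes "exch_data m n d b" "i \<in> {1..n}"
  shows "exch_data m n d (bmut i b)"
proof -
  have "int (d l) dvd bmut i b k l" if "l \<in> {1..n}" "k \<in> {1..m}" for k l
  proof -
    have "i \<in> {1..m}" using assms by (auto simp: exch_data_def)
    then have "int (d l) dvd b k l" "int (d l) dvd b i l" using assms that by (auto simp: exch_data_def)
    moreover from this(2) have "int (d l) dvd max (b i l) 0" by (simp add: max_def)
    ultimately show ?thesis by (auto simp: bmut_def)
  qed
  then show ?thesis using assms skew_symmetrizable_bmut by (auto simp: exch_data_def)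
qed

text \<open>A kernel vector of the mutated matrix becomes one of \<open>b\<close> by changing its
  entry at \<open>i\<close> alone. The remaining correction is a multiple of row \<open>i\<close>
  applied to \<open>v\<close>, which vanishes because \<open>L\<close> contains
  \<open>i\<close>.\<close>

lemma full_rank_bmut:
  assumes fr: "full_rank L n b" and L: "{1..n} \<subseteq> L" and i: "i \<in> {1..n}" and bii: "b i i = 0"
  shows "full_rank L n (bmut i b)"
  unfolding full_rank_def
proof (intro allI impI)
  fix v assume v: "\<forall>l\<in>L. (\<Sum>k=1..n. bmut i b l k * v k) = 0"
  define w where "w = v(i := (\<Sum>k\<in>{1..n} - {i}. max (b i k) 0 * v k) - v i)"
  have row_i: "(\<Sum>k\<in>{1..n} - {i}. b i k * v k) = 0"
  proof -
    have "i \<in> L" using L i by blast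
    then have "(\<Sum>k=1..n. bmut i b i k * v k) = 0" using v by blast
    then have "(\<Sum>k=1..n. - b i k * v k) = 0" by (simp add: bmut_def)
    then show ?thesis using i bii by (simp add: sum.remove sum_negf)
  qed
  have "(\<Sum>k=1..n. b l k * w k) = 0" if l: "l \<in> L" for l
  proof (cases "l = i")
    case True
    then show ?thesis using row_i i bii by (simp add: sum.remove w_def)
  next
    case False
    have "0 = (\<Sum>k=1..n. bmut i b l k * v k)" using v l by simp
    also have "\<dots> = (\<Sum>k\<in>{1..n} - {i}. (b l k + max (b i k) 0 * b l i + b i k * max (- b l i) 0) * v k) - b l i * v i"
      using i False by (simp add: sum.remove bmut_def)
    also have "(\<Sum>k\<in>{1..n} - {i}. (b l k + max (b i k) 0 * b l i + b i k * max (- b l i) 0) * v k) =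
      (\<Sum>k\<in>{1..n} - {i}. b l k * v k) + b l i * (\<Sum>k\<in>{1..n} - {i}. max (b i k) 0 * v k)
        + max (- b l i) 0 * (\<Sum>k\<in>{1..n} - {i}. b i k * v k)"
      by (simp add: sum_distrib_left algebra_simps sum.distrib)
    also have "\<dots> - b l i * v i = (\<Sum>k=1..n. b l k * w k)"
      unfolding row_i using i by (simp add: sum.remove w_def algebra_simps)
    finally show ?thesis by simp
  qed
  then have w0: "w k = 0" if "k \<in> {1..n}" for k using that by (rule full_rankD[OF fr])
  have "v k = 0" if k: "k \<in> {1..n} - {i}" for k
  proof -
    have "w k = 0" using w0 k by blast
    then show ?thesis using k by (simp add: w_def)
  qed
  moreover from this have "v i = 0" using w0[OF i] by (simp add: w_def)
  ultimately show "\<forall>k\<in>{1..n}. v k = 0" by blast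
qed

lemma coef_data_rmut:
  assumes "coef_data n d Z R"
  shows "coef_data n d Z (rmut i d R)"
  using assms unfolding coef_data_def rmut_def by (auto simp: fun_upd_def)

text \<open>Mutation negates column \<open>i\<close> and reverses the string \<open>i\<close>; the
  index change from \<open>r\<close> to \<open>d i - r\<close> undoes both at once.\<close>

lemma ex_pol_mut_self:
  assumes "i \<in> {1..n}" "exch_data m n d b"
  shows "ex_pol m d (rmut i d R) (bmut i b) i = ex_pol m d R b i"
proof -
  have "ex_exp m d (bmut i b) i r = ex_exp m d b i (d i - r)" if "r \<le> d i" for r
  proof (rule poly_mapping_eqI)
    fix j
    have "beta d (bmut i b) j i = - beta d b j i" if "j \<in> {1..m}"
      using assms that unfolding exch_data_def beta_def bmut_def by (auto simp: dvd_neg_div)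
    then show "expo (ex_exp m d (bmut i b) i r) j = expo (ex_exp m d b i (d i - r)) j"
      using \<open>r \<le> d i\<close> by (simp add: expo_ex_exp)
  qed
  then have "ex_pol m d (rmut i d R) (bmut i b) i = (\<Sum>r=0..d i. R i (d i - r) * lmon (ex_exp m d b i (d i - r)))"
    unfolding ex_pol_def by (intro sum.cong) (auto simp: rmut_def)
  also have "\<dots> = ex_pol m d R b i"
    unfolding ex_pol_def by (rule sum.reindex_bij_witness[of _ "\<lambda>r. d i - r" "\<lambda>r. d i - r"]) auto
  finally show ?thesis .
qed

text \<open>\<open>R\<close> lifts the coefficient strings to Laurent polynomials, so that exchange
  polynomials exist in \<open>lau\<close> and are not merely values in the field. Nonvanishing is
  demanded in this formal sense and is inherited by mutations.\<close>

definition good_seed :: "nat \<Rightarrow> nat \<Rightarrow> (nat \<Rightarrow> nat) \<Rightarrow> nat set \<Rightarrow> (nat \<Rightarrow> nat \<Rightarrow> lau) \<Rightarrow> 'a::field_char_0 gseed \<Rightarrow> bool" where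
  "good_seed m n d Z R S \<longleftrightarrow> laurent_indep m (clus S) \<and> exch_data m n d (bmat S) \<and> coef_data n d Z R \<and>
     Z \<subseteq> {1..m} \<and> (\<forall>i\<in>{1..n}. \<forall>r\<le>d i. rho S i r = ev (ext m (clus S)) (R i r)) \<and>
     (\<forall>i\<in>{1..n}. ex_pol m d R (bmat S) i \<noteq> 0)"

lemma ex_pol_vars:
  assumes C: "coef_data n d Z R" and Z: "Z \<subseteq> {1..m}" and i: "i \<in> {1..n}"
  shows "ex_pol m d R b i \<in> vars m"
  unfolding vars_iff
proof (intro ballI allI impI)
  fix e j assume "e \<in> keys (ex_pol m d R b i)" and j: "j \<notin> {1..m}"
  then obtain r f where r: "f \<in> keys (R i r)" "e = f + ex_exp m d b i r"
    unfolding ex_pol_def by (elim ex_pol_keys)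
  have "j \<notin> Z" using Z j by blast
  from ex_pol_expo[OF C i r(1) this, of m b] have "expo e j = expo (ex_exp m d b i r) j" by (simp only: r(2))
  also have "\<dots> = 0" unfolding expo_ex_exp using j by (simp only: if_False)
  finally show "expo e j = 0" .
qed

lemma ex_pol_rest:
  assumes C: "coef_data n d Z R" and B: "exch_data m n d b" and i: "i \<in> {1..n}"
  shows "ex_pol m d R b i \<in> rest {i}"
  unfolding rest_iff
proof (intro ballI)
  fix e j assume "e \<in> keys (ex_pol m d R b i)" and j: "j \<in> {i}"
  then obtain r f where r: "f \<in> keys (R i r)" "e = f + ex_exp m d b i r"
    unfolding ex_pol_def by (elim ex_pol_keys)
  have "i \<notin> Z" using C i by (auto simp: coef_data_def)
  from ex_pol_expo[OF C i r(1) this, of m b] have "expo e i = expo (ex_exp m d b i r) i" by (simp add: r(2))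
  also have "\<dots> = 0" using skew_diag[of n b i] B i by (auto simp: expo_ex_exp beta_def exch_data_def)
  finally show "expo e j = 0" using j by simp
qed

lemma ev_ex_exp:
  assumes "\<And>j. ext m x j \<noteq> 0"
  shows "mon (ext m x) (ex_exp m d b i r) =
    (\<Prod>j=1..m. x j ^ (r * nat (beta d b j i) + (d i - r) * nat (- beta d b j i)))"
proof -
  have "mon (ext m x) (ex_exp m d b i r) = ev (ext m x) (lmon (ex_exp m d b i r))" by simp
  also have "\<dots> = (\<Prod>j=1..m. ext m x j ^ (r * nat (beta d b j i) + (d i - r) * nat (- beta d b j i)))"
    unfolding ex_exp_def lmon_sum ev_prod[OF assms]
    by (intro prod.cong refl) (simp only: X_power[symmetric] ev_power[OF assms] ev_X)
  also have "\<dots> = (\<Prod>j=1..m. x j ^ (r * nat (beta d b j i) + (d i - r) * nat (- beta d b j i)))"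
    by (rule prod.cong) (auto simp: ext_def)
  finally show ?thesis .
qed

lemma ev_ex_pol:
  assumes "\<And>j. ext m (clus S) j \<noteq> 0" "\<And>r. r \<le> d i \<Longrightarrow> rho S i r = ev (ext m (clus S)) (R i r)"
  shows "ev (ext m (clus S)) (ex_pol m d R (bmat S) i) = exch_poly m d S i"
  unfolding ex_pol_def exch_poly_def ev_sum
  by (rule sum.cong) (auto simp: ev_mult[OF assms(1)] assms(2) ev_ex_exp[OF assms(1)] beta_def Let_def)

lemma good_seedD:
  assumes "good_seed m n d Z R S"
  shows "laurent_indep m (clus S)" "exch_data m n d (bmat S)" "coef_data n d Z R" "Z \<subseteq> {1..m}"
    "\<And>i r. i \<in> {1..n} \<Longrightarrow> r \<le> d i \<Longrightarrow> rho S i r = ev (ext m (clus S)) (R i r)"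
    "\<And>i. i \<in> {1..n} \<Longrightarrow> ex_pol m d R (bmat S) i \<noteq> 0" "n \<le> m"
    "\<And>j. ext m (clus S) j \<noteq> 0"
    "\<And>i. i \<in> {1..n} \<Longrightarrow> ev (ext m (clus S)) (ex_pol m d R (bmat S) i) = exch_poly m d S i"
  using assms ext_nonzero[of m "clus S"]
  by (auto simp: good_seed_def exch_data_def intro!: ev_ex_pol)

lemma good_seed_mutate:
  assumes g: "good_seed m n d Z R S" and i: "i \<in> {1..n}"
  shows "good_seed m n d Z (rmut i d R) (mutate m d i S)"
proof -
  note gd = good_seedD[OF g]
  have im: "i \<in> {1..m}" using i gd(7) by auto
  have iZ: "i \<notin> Z" using gd(3) i by (auto simp: coef_data_def)
  let ?p = "ex_pol m d R (bmat S) i" and ?S = "mutate m d i S"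
  have nv: "new_var m d S i = inverse (clus S i) * ev (ext m (clus S)) ?p"
    using gd(9)[OF i] by (simp add: new_var_def)
  have LI: "laurent_indep m (clus ?S)"
    unfolding mutate_sel nv
    by (rule laurent_indep_exchange[OF gd(1) im ex_pol_vars[OF gd(3,4) i] ex_pol_rest[OF gd(3,2) i] gd(6)[OF i]])
  have evR: "ev (ext m (clus ?S)) (R j r) = ev (ext m (clus S)) (R j r)" if "j \<in> {1..n}" for j r
    by (rule ev_cong) (use gd(3) that iZ in \<open>auto simp: coef_data_def ext_def\<close>)
  have rho: "rho ?S j r = ev (ext m (clus ?S)) (rmut i d R j r)" if "j \<in> {1..n}" "r \<le> d j" for j r
    using evR[OF that(1)] gd(5)[OF that(1)] that(2) by (auto simp: rmut_def)
  have nz: "ex_pol m d (rmut i d R) (bmat ?S) j \<noteq> 0" if j: "j \<in> {1..n}" for j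
  proof (cases "j = i")
    case True
    then show ?thesis using ex_pol_mut_self[OF i gd(2)] gd(6)[OF i] by simp
  next
    case ji: False
    show ?thesis
    proof (cases "\<exists>l\<in>{1..n}. bmat ?S l j \<noteq> 0")
      case True
      then obtain l where l: "l \<in> {1..n}" "bmat ?S l j \<noteq> 0" by blast
      have "l \<in> {1..m}" "l \<notin> Z" using l(1) gd(3,7) by (auto simp: coef_data_def)
      then show ?thesis
        using ex_pol_nonzero[OF coef_data_rmut[OF gd(3), of i] j, of l m "bmat ?S"] l(2)
          exch_data_bmut[OF gd(2) i] by simp
    next
      \<comment> \<open>Column \<open>j\<close> vanishes in all mutable rows, in particular at
        \<open>i\<close>, so mutation at \<open>i\<close> left the whole column alone.\<close>
      case False
      then have "bmat ?S i j = 0" using i by blast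
      then have b0: "bmat S i j = 0" by (simp add: bmut_def)
      then have "bmat ?S l j = bmat S l j" for l using ji by (simp add: bmut_def)
      then have "ex_exp m d (bmat ?S) j r = ex_exp m d (bmat S) j r" for r
        by (simp add: ex_exp_def beta_def)
      moreover have "rmut i d R j = R j" using ji by (simp add: rmut_def)
      ultimately show ?thesis using gd(6)[OF j] by (simp add: ex_pol_def)
    qed
  qed
  show ?thesis
    unfolding good_seed_def
    using LI exch_data_bmut[OF gd(2) i] coef_data_rmut[OF gd(3)] gd(4) rho nz by simp
qed


section \<open>Upper bounds under mutation\<close>

definition laurent_ring :: "nat \<Rightarrow> 'a::field_char_0 gseed \<Rightarrow> 'a set" where
  "laurent_ring m S = range (ev (ext m (clus S)))"

definition upper_bound :: "nat \<Rightarrow> nat \<Rightarrow> (nat \<Rightarrow> nat) \<Rightarrow> 'a::field_char_0 gseed \<Rightarrow> 'a set" where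
  "upper_bound m n d S = laurent_ring m S \<inter> (\<Inter>i\<in>{1..n}. laurent_ring m (mutate m d i S))"

lemma is_subring_laurent_ring: "laurent_indep m (clus S) \<Longrightarrow> is_subring (laurent_ring m S)"
  unfolding laurent_ring_def
  by (rule is_subring_ev_image) (auto simp: ext_nonzero is_subring_def)

lemma powi_in_laurent_ring: "ext m (clus S) l powi k \<in> laurent_ring m S"
  unfolding laurent_ring_def by (metis ev_lmon mon_single rangeI)

text \<open>\<open>P_i\<close> is the same polynomial before and after the mutation, and it is free
  of \<open>x_i\<close>, so both exchange relations have the same right-hand side.\<close>

lemma mutate_mutate_clus:
  assumes g: "good_seed m n d Z R S" and i: "i \<in> {1..n}"
  shows "clus (mutate m d i (mutate m d i S)) = clus S"
proof -
  note gd = good_seedD[OF g]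
  let ?S = "mutate m d i S" and ?p = "ex_pol m d R (bmat S) i"
  note gd' = good_seedD[OF good_seed_mutate[OF g i]]
  have im: "i \<in> {1..m}" using i gd(7) by auto
  have "exch_poly m d ?S i = ev (ext m (clus ?S)) (ex_pol m d (rmut i d R) (bmat ?S) i)"
    using gd'(9)[OF i] by simp
  also have "\<dots> = ev (ext m (clus ?S)) ?p" using ex_pol_mut_self[OF i gd(2), of R] by simp
  also have "\<dots> = ev (ext m (clus S)) ?p"
    by (rule ev_cong) (use ex_pol_rest[OF gd(3,2) i] in \<open>auto simp: rest_iff ext_def\<close>)
  also have "\<dots> = exch_poly m d S i" by (rule gd(9)[OF i])
  finally have eq: "exch_poly m d ?S i = exch_poly m d S i" .
  have "clus ?S i \<noteq> 0" using gd'(1) im unfolding laurent_indep_def by blast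
  then have "exch_poly m d S i \<noteq> 0" by (auto simp: new_var_def)
  then have "new_var m d ?S i = clus S i"
    unfolding new_var_def[of m d ?S] eq by (simp add: new_var_def)
  then show ?thesis by (simp add: fun_upd_idem_iff)
qed

lemma power_diff_in_ideal:
  fixes a b :: "'a::comm_ring_1"
  assumes R: "is_subring R" and ab: "a \<in> R" "b \<in> R" "a - b = c * h" "h \<in> R"
  shows "\<exists>g\<in>R. a ^ k - b ^ k = c * g"
proof (induction k)
  case 0
  show ?case using subring_zero[OF R] by (intro bexI[of _ 0]) auto
next
  case (Suc k)
  then obtain g where g: "g \<in> R" "a ^ k - b ^ k = c * g" by blast
  have "a ^ Suc k - b ^ Suc k = a * (a ^ k - b ^ k) + (a - b) * b ^ k" by (simp add: algebra_simps)
  also have "\<dots> = c * (a * g + h * b ^ k)" unfolding g(2) ab(3) by (simp add: algebra_simps)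
  finally show ?case
    using g(1) ab R by (intro bexI[of _ "a * g + h * b ^ k"]) (auto intro: subring_intros)
qed

text \<open>Taken over all variables, this makes an exchange polynomial a monomial times a
  polynomial in the single Laurent monomial with exponents \<open>\<beta>\<close>.\<close>

lemma power_split:
  fixes x :: "'a::field"
  assumes "x \<noteq> 0" "r \<le> D"
  shows "x ^ (r * nat \<beta> + (D - r) * nat (- \<beta>)) = x ^ (D * nat (- \<beta>)) * (x powi \<beta>) ^ r"
proof -
  have "x ^ (r * nat \<beta> + (D - r) * nat (- \<beta>)) = x powi int (r * nat \<beta> + (D - r) * nat (- \<beta>))"
    by (simp only: power_int_of_nat)
  also have "\<dots> = x powi (int (D * nat (- \<beta>)) + \<beta> * int r)"
    unfolding nat_pos_neg_part[OF assms(2)] by (simp add: mult.commute)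
  also have "\<dots> = x ^ (D * nat (- \<beta>)) * (x powi \<beta>) ^ r"
    using assms(1) by (simp only: power_int_add power_int_of_nat power_int_mult disj_not1 simp_thms)
  finally show ?thesis .
qed

lemma prod_powi: "(\<Prod>i\<in>A. f i :: 'a::field) powi k = (\<Prod>i\<in>A. f i powi k)"
  by (induction A rule: infinite_finite_induct) (auto simp: power_int_mult_distrib)

text \<open>Once the sign of \<open>b i j\<close> is fixed, the two correction terms of the mutation
  rule combine into one multiple of \<open>b i j\<close>, with a factor that depends on column
  \<open>j\<close> only through that sign.\<close>

lemma bmut_beta:
  assumes B: "exch_data m n d b" and i: "i \<in> {1..n}" and j: "j \<in> {1..n}" "j \<noteq> i" and l: "l \<in> {1..m}" "l \<noteq> i"
  shows "beta d (bmut i b) l j =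
    beta d b l j + beta d b i j * (if beta d b i j > 0 then max (b l i) 0 else max (- b l i) 0)"
proof -
  have im: "i \<in> {1..m}" using i B by (auto simp: exch_data_def)
  note b = exch_data_div[OF B j(1) l(1)] exch_data_div[OF B j(1) im]
  have "bmut i b l j = b l j + b i j * (if beta d b i j > 0 then max (b l i) 0 else max (- b l i) 0)"
    using j l b(7,8) by (auto simp: bmut_def max_def algebra_simps)
  also have "\<dots> = (beta d b l j + beta d b i j * (if beta d b i j > 0 then max (b l i) 0 else max (- b l i) 0)) * int (d j)"
    unfolding b(1)[symmetric] b(5)[symmetric] by (simp add: algebra_simps beta_def)
  finally show ?thesis using b(2) by (simp add: beta_def)
qed

text \<open>Modulo \<open>x\<^sub>j\<close> the new variable \<open>x'\<^sub>i\<close> is the Laurent monomial \<open>N / x\<^sub>i\<close>, and substituting this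
  monomial into the new exchange polynomial at \<open>j\<close> gives a unit multiple of the old one.\<close>

lemma new_var_mutate_in_laurent_ring:
  assumes g: "good_seed m n d Z R S" and i: "i \<in> {1..n}" and j: "j \<in> {1..n}" "j \<noteq> i"
  shows "new_var m d (mutate m d i S) j \<in> laurent_ring m (mutate m d j S)"
    and "new_var m d S i \<in> laurent_ring m (mutate m d j S)"
    and "clus S j \<in> laurent_ring m (mutate m d j S)"
proof -
  note gd = good_seedD[OF g]
  let ?S = "mutate m d i S" and ?A = "laurent_ring m (mutate m d j S)"
  let ?b = "bmat S" and ?x = "clus S" and ?xx = "ext m (clus S)"
  let ?pi = "ex_pol m d R ?b i"
  note gj = good_seedD[OF good_seed_mutate[OF g j(1)]]
  have skew: "skew_symmetrizable n ?b" using gd(2) by (simp add: exch_data_def)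
  have im: "i \<in> {1..m}" and jm: "j \<in> {1..m}" using i j gd(7) by auto
  have Z: "i \<notin> Z" "j \<notin> Z" using gd(3) i j by (auto simp: coef_data_def)
  have A: "is_subring ?A" by (rule is_subring_laurent_ring[OF gj(1)])
  have x0: "?x l \<noteq> 0" if "l \<in> {1..m}" for l using gd(1) that unfolding laurent_indep_def by blast
  have xl: "?x l powi k \<in> ?A" if "l \<noteq> j" "l \<in> {1..m}" for l k
    using powi_in_laurent_ring[of m "mutate m d j S" l k] that by (simp add: ext_def)
  have xj': "new_var m d S j powi k \<in> ?A" for k
    using powi_in_laurent_ring[of m "mutate m d j S" j k] jm by (simp add: ext_def)
  have "clus (mutate m d j S) j \<noteq> 0" using gj(1) jm unfolding laurent_indep_def by blast
  then have xj'0: "new_var m d S j \<noteq> 0" by simp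
  have mon_j: "mon ?xx e \<in> ?A" if "expo e j = 0" for e
    unfolding mon_def
  proof (rule subring_prod[OF A])
    fix l assume "l \<in> keys e"
    then have "l \<noteq> j" using that by (auto simp: in_keys_iff)
    then show "?xx l powi expo e l \<in> ?A" using xl subring_one[OF A] by (auto simp: ext_def)
  qed
  have Pj: "exch_poly m d S j \<in> ?A"
    unfolding gd(9)[OF j(1), symmetric]
    by (rule ev_in_subring[OF A mon_j]) (use ex_pol_rest[OF gd(3,2) j(1)] in \<open>auto simp: rest_iff\<close>)
  have xj_eq: "?x j = exch_poly m d S j * inverse (new_var m d S j)"
    using xj'0 x0[OF jm] by (auto simp: new_var_def)
  show xjA: "?x j \<in> ?A"
    unfolding xj_eq using xj'[of "- 1"] by (intro subring_mult[OF A] Pj) (simp add: power_int_minus)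
  have pol_j: "ev ?xx F \<in> ?A" if F: "\<And>e. e \<in> keys F \<Longrightarrow> expo e j \<ge> 0" for F
  proof (rule ev_in_subring[OF A])
    fix e assume e: "e \<in> keys F"
    show "mon ?xx e \<in> ?A"
      unfolding mon_def
    proof (rule subring_prod[OF A])
      fix l assume "l \<in> keys e"
      show "?xx l powi expo e l \<in> ?A"
      proof (cases "l = j")
        case True
        then show ?thesis using F[OF e] subring_power[OF A xjA] jm by (simp add: ext_def power_int_def)
      next
        case False
        then show ?thesis using xl subring_one[OF A] by (auto simp: ext_def)
      qed
    qed
  qed
  have pi_nn: "expo e j \<ge> 0" if "e \<in> keys ?pi" for e
  proof -
    obtain r f where r: "f \<in> keys (R i r)" "e = f + ex_exp m d ?b i r"
      using \<open>e \<in> keys ?pi\<close> unfolding ex_pol_def by (elim ex_pol_keys)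
    show ?thesis unfolding r(2) ex_pol_expo[OF gd(3) i r(1) Z(2)] by (simp add: expo_ex_exp)
  qed
  have nv_i: "new_var m d S i = inverse (?x i) * ev ?xx ?pi"
    using gd(9)[OF i] by (simp add: new_var_def)
  have xi_inv: "inverse (?x i) \<in> ?A" using xl[of i "- 1"] j im by (simp add: power_int_minus)
  show nvA: "new_var m d S i \<in> ?A"
    unfolding nv_i by (intro subring_mult[OF A] xi_inv pol_j pi_nn)

  \<comment> \<open>For \<open>\<beta> \<noteq> 0\<close>, \<open>N\<close> is the end term of
    \<open>P_i\<close> that avoids \<open>x_j\<close>; which end depends on the sign of
    \<open>\<beta>\<close>, and \<open>c\<close> lists its exponents. Then
    \<open>w = N / x_i\<close> is the value of \<open>x'_i\<close> modulo \<open>x_j\<close>. The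
    monomials \<open>t\<close>, \<open>\<kappa>\<close> and \<open>t'\<close>,
    \<open>\<kappa>'\<close> bring the old and the new \<open>P_j\<close> into the form given by
    \<open>power_split\<close>, with the variable of index \<open>i\<close> kept apart.\<close>
  define D where "D = d j"
  define \<beta> where "\<beta> = beta d ?b i j"
  define c where "c = (\<lambda>l. if \<beta> > 0 then max (?b l i) 0 else max (- ?b l i) 0)"
  define I where "I = {1..m} - {i}"
  define N where "N = (\<Prod>l\<in>I. ?x l powi c l)"
  define t where "t = (\<Prod>l\<in>I. ?x l powi beta d ?b l j)"
  define t' where "t' = (\<Prod>l\<in>I. ?x l powi beta d (bmat ?S) l j)"
  define \<kappa> where "\<kappa> = (\<Prod>l\<in>I. ?x l ^ (D * nat (- beta d ?b l j)))"
  define \<kappa>' where "\<kappa>' = (\<Prod>l\<in>I. ?x l ^ (D * nat (- beta d (bmat ?S) l j)))"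
  define w where "w = N * inverse (?x i)"
  define kr where "kr = (\<lambda>r. r * nat (- \<beta>) + (D - r) * nat \<beta>)"
  have I: "finite I" "I \<subseteq> {1..m}" "i \<notin> I" by (auto simp: I_def)
  have prod_split: "(\<Prod>l=1..m. f l) = f i * (\<Prod>l\<in>I. f l)" for f :: "nat \<Rightarrow> 'a"
    unfolding I_def by (rule prod.remove) (use im in auto)
  have b'_ii: "beta d (bmat ?S) i j = - \<beta>"
  proof -
    have "bmat ?S i j = - \<beta> * int (d j)"
      using exch_data_div(1)[OF gd(2) j(1) im] by (simp add: \<beta>_def bmut_def)
    then show ?thesis
      using exch_data_div(2)[OF gd(2) j(1) im] by (simp add: beta_def del: mutate_sel mult_minus_left)
  qed
  have b'_l: "beta d (bmat ?S) l j = beta d ?b l j + \<beta> * c l" if "l \<in> I" for l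
    using bmut_beta[OF gd(2) i j, of l] that by (simp add: I_def \<beta>_def c_def)
  have N0: "N \<noteq> 0" unfolding N_def using x0 I by auto
  have w0: "w \<noteq> 0" using N0 x0[OF im] by (simp add: w_def)
  have t'_eq: "t' = t * N powi \<beta>"
  proof -
    have "t' = (\<Prod>l\<in>I. ?x l powi beta d ?b l j * (?x l powi c l) powi \<beta>)"
      unfolding t'_def
      by (rule prod.cong) (use x0 I b'_l in \<open>auto simp: power_int_add power_int_mult[symmetric] mult.commute\<close>)
    then show ?thesis by (simp add: t_def N_def prod.distrib prod_powi)
  qed
  have \<kappa>0: "\<kappa> \<noteq> 0" unfolding \<kappa>_def using x0 I by auto

  have Pj_eq: "exch_poly m d S j = \<kappa> * ?x i ^ (D * nat (- \<beta>)) * (\<Sum>r=0..D. rho S j r * (t * ?x i powi \<beta>) ^ r)"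
  proof -
    have "exch_poly m d S j = (\<Sum>r=0..D. rho S j r *
        (\<Prod>l=1..m. ?x l ^ (r * nat (beta d ?b l j) + (D - r) * nat (- beta d ?b l j))))"
      by (simp add: exch_poly_def Let_def beta_def D_def)
    also have "\<dots> = (\<Sum>r=0..D. rho S j r *
        (\<Prod>l=1..m. ?x l ^ (D * nat (- beta d ?b l j)) * (?x l powi beta d ?b l j) ^ r))"
      by (intro sum.cong refl arg_cong2[where f = "(*)"] prod.cong power_split x0) auto
    also have "\<dots> = (\<Sum>r=0..D. \<kappa> * ?x i ^ (D * nat (- \<beta>)) * (rho S j r * (t * ?x i powi \<beta>) ^ r))"
      unfolding prod_split prod.distrib
      by (intro sum.cong refl) (simp add: \<kappa>_def t_def \<beta>_def prod_power_distrib power_mult_distrib mult_ac)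
    finally show ?thesis by (simp add: sum_distrib_left)
  qed
  have Pj'_eq: "exch_poly m d ?S j = \<kappa>' * (\<Sum>r=0..D. rho S j r * t' ^ r * new_var m d S i ^ kr r)"
  proof -
    have "exch_poly m d ?S j = (\<Sum>r=0..D. rho S j r *
        (\<Prod>l=1..m. clus ?S l ^ (r * nat (beta d (bmat ?S) l j) + (D - r) * nat (- beta d (bmat ?S) l j))))"
      using j by (simp add: exch_poly_def Let_def beta_def D_def rmut_def del: mutate_sel(1,3))
    also have "\<dots> = (\<Sum>r=0..D. rho S j r * (new_var m d S i ^ kr r *
        (\<Prod>l\<in>I. ?x l ^ (r * nat (beta d (bmat ?S) l j) + (D - r) * nat (- beta d (bmat ?S) l j)))))"
      unfolding prod_split
      by (intro sum.cong refl arg_cong2[where f = "(*)"] prod.cong)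
        (use I b'_ii in \<open>auto simp: kr_def simp del: mutate_sel(3)\<close>)
    also have "\<dots> = (\<Sum>r=0..D. rho S j r * (new_var m d S i ^ kr r *
        (\<Prod>l\<in>I. ?x l ^ (D * nat (- beta d (bmat ?S) l j)) * (?x l powi beta d (bmat ?S) l j) ^ r)))"
      by (intro sum.cong refl arg_cong2[where f = "(*)"] prod.cong power_split x0) (use I in auto)
    also have "\<dots> = (\<Sum>r=0..D. \<kappa>' * (rho S j r * t' ^ r * new_var m d S i ^ kr r))"
      unfolding prod.distrib
      by (intro sum.cong refl) (simp add: \<kappa>'_def t'_def prod_power_distrib mult_ac)
    finally show ?thesis by (simp add: sum_distrib_left)
  qed
  \<comment> \<open>At \<open>x'_i = w\<close> the powers of \<open>N\<close> from \<open>t'\<close>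
    and from \<open>w\<close> cancel and leave \<open>x_i powi \<beta>\<close>: the sum becomes that
    of the old \<open>P_j\<close>, up to a monomial.\<close>
  have subst: "(\<Sum>r=0..D. rho S j r * t' ^ r * w ^ kr r) =
      w ^ (D * nat \<beta>) * (\<Sum>r=0..D. rho S j r * (t * ?x i powi \<beta>) ^ r)"
    unfolding sum_distrib_left
  proof (rule sum.cong[OF refl])
    fix r assume "r \<in> {0..D}"
    then have "w ^ kr r = w ^ (D * nat \<beta>) * (w powi (- \<beta>)) ^ r"
      using power_split[OF w0, of r D "- \<beta>"] by (simp add: kr_def)
    moreover have "N powi \<beta> * w powi (- \<beta>) = ?x i powi \<beta>"
    proof -
      have "N * inverse w = ?x i" using N0 x0[OF im] by (simp add: w_def)
      then have "(N * inverse w) powi \<beta> = ?x i powi \<beta>" by simp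
      then show ?thesis by (simp only: power_int_mult_distrib power_int_minus power_int_inverse)
    qed
    ultimately show "rho S j r * t' ^ r * w ^ kr r = w ^ (D * nat \<beta>) * (rho S j r * (t * ?x i powi \<beta>) ^ r)"
      unfolding t'_eq by (simp add: power_mult_distrib[symmetric] mult_ac)
  qed

  have bjj: "?b j j = 0" by (rule skew_diag[OF skew j(1)])
  have "bmat ?S j j = 0" by (rule skew_diag[OF skew_symmetrizable_bmut[OF skew i] j(1), folded mutate_sel(3)[of m d i S]])
  then have b'jj: "beta d (bmat ?S) j j = 0" by (simp add: beta_def)
  \<comment> \<open>\<open>b i j\<close> and \<open>b j i\<close> have opposite signs, so
    \<open>N\<close> is free of \<open>x_j\<close> and thus lies in \<open>?A\<close>.\<close>
  have cj: "c j = 0"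
    using skew_signs[OF skew i j(1)] exch_data_div(3,4)[OF gd(2) j(1) im] by (auto simp: c_def \<beta>_def)
  have prodA: "(\<Prod>l\<in>I. ?x l powi f l) \<in> ?A" if "f j = 0" for f :: "nat \<Rightarrow> int"
  proof (rule subring_prod[OF A])
    fix l assume "l \<in> I"
    then show "?x l powi f l \<in> ?A" using xl[of l] I(2) that subring_one[OF A] by (cases "l = j") auto
  qed
  have NA: "N \<in> ?A" unfolding N_def by (rule prodA[of c, OF cj])
  have t'A: "t' \<in> ?A" unfolding t'_def by (rule prodA[of "\<lambda>l. beta d (bmat ?S) l j", OF b'jj])
  have wA: "w \<in> ?A" unfolding w_def by (intro subring_mult[OF A] NA xi_inv)
  have \<kappa>'A: "\<kappa>' \<in> ?A"
    using prodA[of "\<lambda>l. int (D * nat (- beta d (bmat ?S) l j))"] b'jj unfolding \<kappa>'_def power_int_of_nat by simp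
  have \<kappa>A: "inverse \<kappa> \<in> ?A"
  proof -
    have "inverse \<kappa> = (\<Prod>l\<in>I. ?x l powi - int (D * nat (- beta d ?b l j)))"
      unfolding \<kappa>_def power_int_minus power_int_of_nat
      by (simp add: prod_inversef[symmetric] o_def)
    also have "\<dots> \<in> ?A" by (rule prodA) (simp add: beta_eq_0 bjj)
    finally show ?thesis .
  qed
  have rhoA: "rho S j r \<in> ?A" if "r \<le> D" for r
  proof -
    have "expo e j = 0" if "e \<in> keys (R j r)" for e
      using gd(3) j Z that by (auto simp: coef_data_def)
    then have "ev ?xx (R j r) \<in> ?A" by (intro pol_j) simp
    then show ?thesis using gd(5)[OF j(1)] that by (simp add: D_def)
  qed

  have diff: "\<exists>h\<in>?A. new_var m d S i ^ kr r - w ^ kr r = ?x j * h" for r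
  proof (cases "\<beta> = 0")
    case True
    then show ?thesis using subring_zero[OF A] by (auto simp: kr_def intro!: bexI[of _ 0])
  next
    case False
    \<comment> \<open>All terms of \<open>P_i\<close> except this one contain \<open>x_j\<close>, so
      dividing the difference by \<open>x_j\<close> gives \<open>G\<close> without negative powers
      of \<open>x_j\<close>.\<close>
    define e0 where "e0 = ex_exp m d ?b i (if \<beta> > 0 then d i else 0)"
    have e0_N: "mon ?xx e0 = N"
    proof -
      have "mon ?xx e0 = (\<Prod>l=1..m. ?x l powi c l)"
        unfolding e0_def ev_ex_exp[OF gd(8)]
      proof (rule prod.cong[OF refl])
        fix l assume l: "l \<in> {1..m}"
        note bl = exch_data_div[OF gd(2) i l]
        have 1: "int (d i * nat (beta d ?b l i)) = max (?b l i) 0"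
        proof (cases "beta d ?b l i > 0")
          case True
          then have "max (?b l i) 0 = ?b l i" using bl(3) by simp
          with True bl(1) show ?thesis by (simp add: mult.commute)
        next
          case False
          then have "max (?b l i) 0 = 0" using bl(3) by simp
          with False show ?thesis by simp
        qed
        have 2: "int (d i * nat (- beta d ?b l i)) = max (- ?b l i) 0"
        proof (cases "beta d ?b l i < 0")
          case True
          then have "max (- ?b l i) 0 = - ?b l i" using bl(4) by simp
          with True bl(1) show ?thesis by (simp add: mult.commute)
        next
          case False
          then have "max (- ?b l i) 0 = 0" using bl(4) by simp
          with False show ?thesis by simp
        qed
        let ?r = "if \<beta> > 0 then d i else 0"
        have "int (?r * nat (beta d ?b l i) + (d i - ?r) * nat (- beta d ?b l i)) = c l"
          using 1 2 by (simp add: c_def)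
        then show "?x l ^ (?r * nat (beta d ?b l i) + (d i - ?r) * nat (- beta d ?b l i)) = ?x l powi c l"
          by (metis power_int_of_nat)
      qed
      also have "\<dots> = N"
        unfolding prod_split N_def using skew_diag[OF skew i] by (simp add: c_def)
      finally show ?thesis .
    qed
    have e_pos: "expo e j \<ge> 1" if e: "e \<in> keys (?pi - lmon e0)" for e
    proof (cases "\<beta> > 0")
      case True
      then have "?b j i < 0"
        using skew_signs(1)[OF skew i j(1)] exch_data_div(3)[OF gd(2) j(1) im] by (simp add: \<beta>_def)
      then show ?thesis
        using ex_pol_high_end[OF gd(3,2) i jm Z(2)] e True by (simp add: e0_def)
    next
      case F: False
      then have "?b j i > 0"
        using False skew_signs(2)[OF skew i j(1)] exch_data_div(4)[OF gd(2) j(1) im] by (simp add: \<beta>_def)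
      then have bp: "beta d ?b j i > 0" using exch_data_div(3)[OF gd(2) i jm] by simp
      then have "1 * beta d ?b j i + 0 * beta d ?b j i > 0" by simp
      from ex_pol_low_end[OF gd(3) i jm jm Z(2) Z(2) this, of e]
      show ?thesis using e F bp jm by (simp add: e0_def wdeg_def expo_ex_exp)
    qed
    define G where "G = xpow j (- 1) * (?pi - lmon e0)"
    have "ev ?xx G \<in> ?A"
    proof (rule pol_j)
      fix e assume "e \<in> keys G"
      then obtain f where "f \<in> keys (?pi - lmon e0)" "e = single j (- 1) + f"
        by (auto simp: G_def keys_lmon_mult)
      then show "expo e j \<ge> 0" using e_pos[of f] by (simp add: lookup_add)
    qed
    moreover have "ev ?xx ?pi - N = ?x j * ev ?xx G"
    proof -
      have "X j * G = ?pi - lmon e0" by (simp add: G_def mult.assoc[symmetric])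
      then have "ev ?xx (X j * G) = ev ?xx ?pi - N" by (simp add: ev_diff e0_N)
      moreover have "?xx j = ?x j" using jm by (simp add: ext_def)
      ultimately show ?thesis by (simp add: ev_mult[OF gd(8)])
    qed
    then have "new_var m d S i - w = ?x j * (inverse (?x i) * ev ?xx G)"
      unfolding nv_i w_def by (simp add: algebra_simps)
    ultimately show ?thesis
      using power_diff_in_ideal[OF A nvA wA _ subring_mult[OF A xi_inv]] by blast
  qed
  then obtain h where h: "\<And>r. h r \<in> ?A" "\<And>r. new_var m d S i ^ kr r = w ^ kr r + ?x j * h r"
    by (metis diff_eq_eq add.commute)
  have "exch_poly m d ?S j = \<kappa>' * (\<Sum>r=0..D. rho S j r * t' ^ r * w ^ kr r) +
      ?x j * (\<kappa>' * (\<Sum>r=0..D. rho S j r * t' ^ r * h r))"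
    unfolding Pj'_eq h(2) by (simp add: distrib_left sum.distrib sum_distrib_left mult_ac)
  also have "(\<Sum>r=0..D. rho S j r * t' ^ r * w ^ kr r) =
      w ^ (D * nat \<beta>) * inverse (?x i) ^ (D * nat (- \<beta>)) * inverse \<kappa> * exch_poly m d S j"
    unfolding subst Pj_eq using \<kappa>0 x0[OF im] by (simp add: power_inverse field_simps)
  \<comment> \<open>Dividing by \<open>x_j\<close> turns the first summand into a monomial multiple
    of \<open>x'_j\<close>, a variable of the seed mutated at \<open>j\<close>; in the second the
    factor \<open>x_j\<close> cancels.\<close>
  finally have "inverse (?x j) * exch_poly m d ?S j =
      \<kappa>' * (w ^ (D * nat \<beta>) * inverse (?x i) ^ (D * nat (- \<beta>)) * inverse \<kappa> * (inverse (?x j) * exch_poly m d S j)) +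
      \<kappa>' * (\<Sum>r=0..D. rho S j r * t' ^ r * h r)"
    using x0[OF jm] by (simp add: distrib_left mult_ac)
  also have "\<dots> \<in> ?A"
    using xj'[of 1] unfolding new_var_def[symmetric]
    by (intro subring_add[OF A] subring_mult[OF A] subring_power[OF A] subring_sum[OF A] \<kappa>'A wA xi_inv \<kappa>A rhoA t'A h(1))
      auto
  finally show "new_var m d ?S j \<in> ?A" using j by (simp add: new_var_def)
qed

lemma upper_boundE:
  assumes g: "good_seed m n d Z R S" and f: "f \<in> upper_bound m n d S"
  obtains F where "F \<in> vars m" "f = ev (ext m (clus S)) F"
    "\<And>j. j \<in> {1..n} \<Longrightarrow> F \<in> lower (ex_pol m d R (bmat S)) {j}"
proof -
  note gd = good_seedD[OF g]
  let ?p = "ex_pol m d R (bmat S)"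
  have fS: "f \<in> laurent_ring m S" and fj: "\<And>j. j \<in> {1..n} \<Longrightarrow> f \<in> laurent_ring m (mutate m d j S)"
    using f by (auto simp: upper_bound_def)
  obtain F where F: "F \<in> vars m" "f = ev (ext m (clus S)) F"
    using fS ev_range_vars[of m "clus S", OF gd(8)] unfolding laurent_ring_def by (metis imageE)
  have "F \<in> lower ?p {j}" if j: "j \<in> {1..n}" for j
  proof -
    have jm: "j \<in> {1..m}" using j gd(7) by auto
    obtain F' where F': "F' \<in> vars m" "f = ev (ext m (clus (mutate m d j S))) F'"
      using fj[OF j] ev_range_vars[of m "clus (mutate m d j S)", OF good_seedD(8)[OF good_seed_mutate[OF g j]]]
      unfolding laurent_ring_def by (metis imageE)
    have "clus (mutate m d j S) = (clus S)(j := inverse (clus S j) * ev (ext m (clus S)) (?p j))"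
      using gd(9)[OF j] by (simp add: new_var_def)
    then show ?thesis
      using common_laurent_in_lower[where p = ?p, OF gd(1) jm ex_pol_vars[OF gd(3,4) j]
          ex_pol_rest[OF gd(3,2) j] gd(6)[OF j] F(1) F'(1)] F(2) F'(2) by metis
  qed
  with F show ?thesis using that by blast
qed

text \<open>For \<open>j \<noteq> i\<close> the pair \<open>{i, j}\<close> reduces the claim to
  generators. Variables other than \<open>x_i\<close>, \<open>x_j\<close> are common to the seeds,
  and \<open>x_i\<close>, \<open>x'_i\<close>, \<open>x_j\<close> are easily Laurent after mutation
  of \<open>S\<close> at \<open>j\<close>. The variable obtained by mutating at \<open>i\<close> and
  then at \<open>j\<close> is the hard case, settled by
  \<open>new_var_mutate_in_laurent_ring\<close>.\<close>

lemma upper_bound_mutate: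
  assumes g: "good_seed m n d Z R S" and i: "i \<in> {1..n}"
    and fr: "full_rank L n (bmat S)" and L: "{1..n} \<subseteq> L" "L \<subseteq> {1..m}" "L \<inter> Z = {}"
  shows "upper_bound m n d (mutate m d i S) \<subseteq> upper_bound m n d S"
proof
  note gd = good_seedD[OF g]
  let ?S = "mutate m d i S"
  note g' = good_seed_mutate[OF g i]
  note gd' = good_seedD[OF g']
  have im: "i \<in> {1..m}" using i gd(7) by auto
  let ?p = "ex_pol m d (rmut i d R) (bmat ?S)"
  fix f assume f: "f \<in> upper_bound m n d ?S"
  have fS': "f \<in> laurent_ring m ?S" and fj: "\<And>j. j \<in> {1..n} \<Longrightarrow> f \<in> laurent_ring m (mutate m d j ?S)"
    using f by (auto simp: upper_bound_def)
  have fS: "f \<in> laurent_ring m S"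
    using fj[OF i] unfolding laurent_ring_def mutate_mutate_clus[OF g i] .
  obtain F where F: "F \<in> vars m" "f = ev (ext m (clus ?S)) F"
    and FLL: "\<And>j. j \<in> {1..n} \<Longrightarrow> F \<in> lower ?p {j}"
    using upper_boundE[OF g' f] by metis
  have "f \<in> laurent_ring m (mutate m d j S)" if j: "j \<in> {1..n}" for j
  proof (cases "j = i")
    case True
    then show ?thesis using fS' by simp
  next
    case False
    let ?A = "laurent_ring m (mutate m d j S)" and ?x' = "ext m (clus ?S)"
    have A: "is_subring ?A"
      by (rule is_subring_laurent_ring[OF good_seedD(1)[OF good_seed_mutate[OF g j]]])
    have jm: "j \<in> {1..m}" using j gd(7) by auto
    have "full_rank L n (bmat ?S)"
      using full_rank_bmut[OF fr L(1) i] skew_diag[of n "bmat S" i] gd(2) i by (simp add: exch_data_def)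
    moreover have "sourced (edges n (bmat ?S)) {i, j}"
      using sourced_pair[OF _ i j] gd'(2) by (simp add: exch_data_def)
    ultimately have "(\<Inter>k\<in>{i, j}. lower ?p {k}) \<subseteq> lower ?p {i, j}"
      using gd'(6) i j by (intro ex_pol_upper_subset_lower[OF gd'(3,2) _ L(2,3)]) auto
    then have "F \<in> lower ?p {i, j}" using FLL i j by blast
    also have "lower ?p {i, j} \<subseteq> {F. ev ?x' F \<in> ?A}"
      unfolding lower_def
    proof (rule hull_minimal)
      show "is_subring {F. ev ?x' F \<in> ?A}"
        using A unfolding is_subring_def by (auto simp: ev_mult[OF gd'(8)] ev_diff simp del: mutate_sel)
      have "ev ?x' F \<in> ?A" if F: "F \<in> rest {i, j}" for F
      proof (rule ev_in_subring[OF A])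
        fix e assume e: "e \<in> keys F"
        have "mon ?x' e = mon (ext m (clus (mutate m d j S))) e"
          by (rule mon_cong) (use e F in \<open>auto simp: rest_iff ext_def\<close>)
        then show "mon ?x' e \<in> ?A" unfolding laurent_ring_def by (metis ev_lmon rangeI)
      qed
      moreover have "ev ?x' (X i) \<in> ?A" "ev ?x' (X j) \<in> ?A"
        using new_var_mutate_in_laurent_ring(2,3)[OF g i j False] False im jm by (auto simp: ext_def)
      moreover have Yk: "ev ?x' (Y ?p k) = new_var m d ?S k" if "k \<in> {1..n}" for k
      proof -
        have "?x' k = clus ?S k" using that gd(7) by (simp add: ext_def)
        then show ?thesis
          unfolding Y_def ev_mult[OF gd'(8)] new_var_def ev_lmon mon_single gd'(9)[OF that]
          by (simp only: power_int_minus power_int_1_right mult.commute)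
      qed
      moreover have "new_var m d ?S i \<in> ?A"
      proof -
        have "new_var m d ?S i = clus (mutate m d i ?S) i" by simp
        also have "\<dots> = clus S i" by (simp only: mutate_mutate_clus[OF g i])
        also have "\<dots> \<in> ?A"
          using powi_in_laurent_ring[of m "mutate m d j S" i 1] False im by (simp add: ext_def)
        finally show ?thesis .
      qed
      moreover have "new_var m d ?S j \<in> ?A"
        by (rule new_var_mutate_in_laurent_ring(1)[OF g i j False])
      ultimately show "rest {i, j} \<union> X ` {i, j} \<union> Y ?p ` {i, j} \<subseteq> {F. ev ?x' F \<in> ?A}"
        using i j by auto
    qed
    finally show ?thesis by (simp add: F(2))
  qed
  then show "f \<in> upper_bound m n d S" using fS by (simp add: upper_bound_def)
qed


section \<open>The generic deformation of a seed\<close>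

text \<open>The deformed seed lives in the fraction field of \<open>lau\<close>, and seeds are
  defined over fields of characteristic 0.\<close>

instance fract :: ("{idom, ring_char_0}") field_char_0
  by standard (simp add: inj_on_def of_nat_fract eq_fract)

lemma to_fract_sum: "to_fract (\<Sum>i\<in>A. f i) = (\<Sum>i\<in>A. to_fract (f i))"
  by (induction A rule: infinite_finite_induct) auto

lemma to_fract_prod: "to_fract (\<Prod>i\<in>A. f i) = (\<Prod>i\<in>A. to_fract (f i))"
  by (induction A rule: infinite_finite_induct) auto

lemma to_fract_power: "to_fract (x ^ k) = to_fract x ^ k"
  by (induction k) auto

lemma to_fract_of_int: "to_fract (of_int k :: 'a::idom) = of_int k"
proof -
  have "to_fract (of_nat k :: 'a) = of_nat k" for k by (induction k) auto
  then show ?thesis by (cases k rule: int_diff_cases) auto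
qed

definition lx :: "nat \<Rightarrow> lau fract" where
  "lx j = to_fract (X j)"

lemma lx_nonzero [simp]: "lx j \<noteq> 0"
  by (simp add: lx_def)

lemma mon_lx: "mon lx e = to_fract (lmon e)"
proof -
  have s: "lx j powi k = to_fract (xpow j k)" for j k
  proof (cases "k \<ge> 0")
    case True
    then show ?thesis
      by (simp add: lx_def power_int_def X_power flip: to_fract_power)
  next
    case False
    define l where "l = nat (- k)"
    have k: "k = - int l" using False by (simp add: l_def)
    have "to_fract (xpow j k) * lx j ^ l = 1"
      unfolding lx_def to_fract_power[symmetric] to_fract_mult[symmetric] X_power k
      by (simp add: single_uminus)
    then have "to_fract (xpow j k) = inverse (lx j ^ l)"
      by (simp add: field_simps)
    then show ?thesis by (simp add: k power_int_minus)
  qed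
  have "e = (\<Sum>j\<in>keys e. single j (expo e j))"
    by (rule poly_mapping_eqI) (auto simp: lookup_sum_single in_keys_iff)
  then have "lmon e = (\<Prod>j\<in>keys e. xpow j (expo e j))"
    by (metis lmon_sum)
  then show ?thesis by (simp add: mon_def s to_fract_prod)
qed

lemma ev_lx: "ev lx F = to_fract F"
  unfolding ev_def mon_lx to_fract_of_int[symmetric] to_fract_mult[symmetric] to_fract_sum[symmetric]
  using lau_expand[of F] by simp

lemma ev_ext_lx: "F \<in> vars m \<Longrightarrow> ev (ext m lx) F = to_fract F"
  unfolding ev_lx[symmetric] by (rule ev_cong) (auto simp: vars_iff ext_def)

lemma laurent_indep_lx: "laurent_indep m lx"
  unfolding laurent_indep_def by (auto simp: ev_ext_lx)

text \<open>Multiplication with a large monomial clears all negative exponents, after which a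
  Laurent relation is an ordinary polynomial relation with integer, hence rational,
  coefficients.\<close>

lemma alg_indep_laurent_indep:
  assumes a: "alg_indep m x"
  shows "laurent_indep m x"
proof -
  let ?E = "{e :: nat \<Rightarrow> nat. \<forall>j. j \<notin> {1..m} \<longrightarrow> e j = 0}"
  let ?M = "\<lambda>e. \<Prod>j=1..m. x j ^ e j"
  have li: "lin_indep \<rat> ?E ?M" using a by (simp add: alg_indep_def)
  have x0: "x j \<noteq> 0" if j: "j \<in> {1..m}" for j
  proof
    assume "x j = 0"
    then have "?M (\<lambda>l. if l = j then 1 else 0) = 0"
      using j by (intro prod_zero) auto
    then have "(\<Sum>e\<in>{\<lambda>l. if l = j then 1 else 0}. 1 * ?M e) = 0" by simp
    from lin_indepD[OF li _ _ _ this] j have "(1::'a) = 0" by force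
    then show False by simp
  qed
  have "F = 0" if F: "F \<in> vars m" "ev (ext m x) F = 0" for F
  proof -
    \<comment> \<open>A crude bound for all exponents of all terms; a sum, unlike a maximum, needs
      no separate case for \<open>F = 0\<close>.\<close>
    define N where "N = (\<Sum>e\<in>keys F. \<Sum>j=1..m. nat \<bar>expo e j\<bar>)"
    have N: "int N + expo e j \<ge> 0" if "e \<in> keys F" "j \<in> {1..m}" for e j
    proof -
      have "nat \<bar>expo e j\<bar> \<le> (\<Sum>j=1..m. nat \<bar>expo e j\<bar>)" by (rule member_le_sum) (use that in auto)
      also have "\<dots> \<le> N" unfolding N_def by (rule member_le_sum[of e]) (use that in auto)
      finally show ?thesis by linarith
    qed
    define s where "s = (\<Sum>j\<in>{1..m}. single j (int N))"
    have s: "expo s j = (if j \<in> {1..m} then int N else 0)" for j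
      unfolding s_def by (rule lookup_sum_single) simp
    define \<phi> where "\<phi> = (\<lambda>e j. nat (expo (s + e) j))"
    have \<phi>: "int (\<phi> e j) = expo (s + e) j" if "e \<in> keys F" for e j
    proof (cases "j \<in> {1..m}")
      case True
      then show ?thesis using N[OF that True] by (simp add: \<phi>_def lookup_add s)
    next
      case False
      then have "expo e j = 0" using F(1) that unfolding vars_iff by blast
      then show ?thesis using False by (simp only: \<phi>_def lookup_add s if_False)
    qed
    have inj: "inj_on \<phi> (keys F)"
    proof (rule inj_onI)
      fix e f assume ef: "e \<in> keys F" "f \<in> keys F" "\<phi> e = \<phi> f"
      then have "expo (s + e) j = expo (s + f) j" for j using \<phi>[OF ef(1), of j] \<phi>[OF ef(2), of j] by simp
      then have "s + e = s + f" by (rule poly_mapping_eqI)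
      then show "e = f" by simp
    qed
    have ext0: "ext m x j \<noteq> 0" for j using x0 by (auto simp: ext_def)
    have M: "mon (ext m x) (s + e) = ?M (\<phi> e)" if e: "e \<in> keys F" for e
    proof -
      have "keys (s + e) \<subseteq> {1..m}"
      proof
        fix j assume "j \<in> keys (s + e)"
        then have "expo (s + e) j \<noteq> 0" by (simp add: in_keys_iff)
        then show "j \<in> {1..m}" using F(1) e s[of j] unfolding vars_iff lookup_add by (metis add_0)
      qed
      then have "mon (ext m x) (s + e) = (\<Prod>j=1..m. ext m x j powi expo (s + e) j)"
        by (intro mon_superset) auto
      also have "\<dots> = ?M (\<phi> e)"
        unfolding \<phi>[OF e, symmetric] by (rule prod.cong) (auto simp: ext_def)
      finally show ?thesis .
    qed
    let ?c = "\<lambda>e. of_int (lookup F e) :: 'a"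
    have "(\<Sum>e\<in>keys F. ?c e * ?M (\<phi> e)) = mon (ext m x) s * ev (ext m x) F"
      unfolding ev_def sum_distrib_left
    proof (rule sum.cong[OF refl])
      fix e assume e: "e \<in> keys F"
      show "?c e * ?M (\<phi> e) = mon (ext m x) s * (?c e * mon (ext m x) e)"
        unfolding M[OF e, symmetric] mon_add[OF ext0] by (simp only: mult_ac)
    qed
    then have "(\<Sum>e\<in>keys F. ?c e * ?M (\<phi> e)) = 0" using F(2) by simp
    then have "(\<Sum>w\<in>\<phi> ` keys F. ?c (the_inv_into (keys F) \<phi> w) * ?M w) = 0"
      by (simp add: sum.reindex[OF inj] the_inv_into_f_f[OF inj])
    moreover have "\<phi> ` keys F \<subseteq> ?E"
    proof -
      have "\<phi> e j = 0" if "e \<in> keys F" "j \<notin> {1..m}" for e j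
      proof -
        have "expo e j = 0" using F(1) that unfolding vars_iff by blast
        then show ?thesis using that(2) by (simp only: \<phi>_def lookup_add s if_False)
      qed
      then show ?thesis by (intro subsetI) (auto simp del: atLeastAtMost_iff)
    qed
    ultimately have "?c (the_inv_into (keys F) \<phi> w) = 0" if "w \<in> \<phi> ` keys F" for w
      using that by (intro lin_indepD[OF li, of "\<phi> ` keys F" "\<lambda>w. ?c (the_inv_into (keys F) \<phi> w)"]) auto
    then have "lookup F e = 0" if "e \<in> keys F" for e
      using the_inv_into_f_f[OF inj that] that by force
    then show "F = 0" by (intro poly_mapping_eqI) (metis in_keys_iff lookup_zero)
  qed
  then show ?thesis using x0 by (auto simp: laurent_indep_def)
qed

lemma generalized_seed_good:
  assumes S: "generalized_seed m n d S" and mu: "mutable_seed m n d S" and nm: "n \<le> m"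
  obtains R where "good_seed m n d {n+1..m} R S"
proof -
  let ?x = "ext m (clus S)" and ?Z = "{n+1..m}"
  have LI: "laurent_indep m (clus S)"
    using S by (auto simp: generalized_seed_def intro: alg_indep_laurent_indep)
  have B: "exch_data m n d (bmat S)" using S nm by (auto simp: generalized_seed_def exch_data_def)
  define P where "P = (\<lambda>i r F. (\<forall>e\<in>keys F. \<forall>j. j \<notin> ?Z \<longrightarrow> expo e j = 0) \<and> rho S i r = ev ?x F)"
  have ex: "\<exists>F. P i r F" if i: "i \<in> {1..n}" and r: "r \<in> {1..<d i}" for i r
  proof -
    obtain c :: int and e :: "nat \<Rightarrow> nat" where ce: "rho S i r = of_int c * (\<Prod>j=n+1..m. clus S j ^ e j)"
      using S i r unfolding generalized_seed_def frozen_monomial_def by blast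
    define f where "f = (\<Sum>j\<in>?Z. single j (int (e j)))"
    have f: "expo f j = (if j \<in> ?Z then int (e j) else 0)" for j
      unfolding f_def by (rule lookup_sum_single) simp
    have "mon ?x f = (\<Prod>j\<in>?Z. ?x j powi expo f j)"
      by (rule mon_superset) (auto simp: in_keys_iff f split: if_splits)
    also have "\<dots> = (\<Prod>j=n+1..m. clus S j ^ e j)"
      by (rule prod.cong) (auto simp: f ext_def)
    finally have "rho S i r = ev ?x (of_int c * lmon f)" by (simp add: ce ev_of_int_lmon)
    moreover have "keys (of_int c * lmon f) \<subseteq> {f}" unfolding of_int_lmon by simp
    ultimately show ?thesis unfolding P_def using f by (intro exI[of _ "of_int c * lmon f"]) auto
  qed
  \<comment> \<open>The default 1 is the prescribed value at both ends \<open>r = 0\<close> and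
    \<open>r = d i\<close>.\<close>
  define R where "R = (\<lambda>i r. if i \<in> {1..n} \<and> r \<in> {1..<d i} then SOME F. P i r F else 1)"
  have R: "P i r (R i r)" if "i \<in> {1..n}" "r \<in> {1..<d i}" for i r
    using someI_ex[OF ex[OF that]] that by (simp add: R_def)
  have R1: "R i r = 1" if "r \<notin> {1..<d i}" for i r using that by (auto simp: R_def)
  have C: "coef_data n d ?Z R"
    unfolding coef_data_def
  proof (intro conjI ballI allI impI)
    fix i r e j assume "i \<in> {1..n}" "e \<in> keys (R i r)" "j \<notin> ?Z"
    then show "expo e j = 0"
      using R[of i r] R1[of r i] unfolding P_def by (cases "r \<in> {1..<d i}") auto
  qed (auto simp: R1)
  have rho: "rho S i r = ev ?x (R i r)" if "i \<in> {1..n}" "r \<le> d i" for i r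
  proof (cases "r \<in> {1..<d i}")
    case True
    then show ?thesis using R[OF that(1)] by (simp add: P_def)
  next
    case False
    then have "r = 0 \<or> r = d i" using that by auto
    then show ?thesis using S that(1) R1[OF False] by (auto simp: generalized_seed_def)
  qed
  have "ex_pol m d R (bmat S) i \<noteq> 0" if i: "i \<in> {1..n}" for i
  proof
    assume "ex_pol m d R (bmat S) i = 0"
    then have "exch_poly m d S i = 0"
      using ev_ex_pol[of m S d i R] ext_nonzero[OF LI] rho[OF i] by simp
    then show False using mu i by (simp add: mutable_seed_def)
  qed
  then have "good_seed m n d ?Z R S" unfolding good_seed_def using LI B C rho by auto
  then show ?thesis by (rule that)
qed

text \<open>There is one extra frozen variable \<open>x\<^bsub>m+i\<^esub>\<close> for every \<open>i \<le> n\<close>, occurring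
  only in \<open>P\<^sub>i\<close>. It makes the extended exchange matrix have full rank, hence all exchange polynomials
  coprime in every seed.\<close>

definition deform :: "nat \<Rightarrow> (nat \<Rightarrow> nat) \<Rightarrow> (nat \<Rightarrow> nat \<Rightarrow> lau) \<Rightarrow> (nat \<Rightarrow> nat \<Rightarrow> int) \<Rightarrow> lau fract gseed" where
  "deform m d R b = \<lparr> clus = lx, rho = (\<lambda>i r. to_fract (R i r)),
     bmat = (\<lambda>k l. if k \<le> m then b k l else if k = m + l then int (d l) else 0) \<rparr>"

lemma good_seed_deform:
  assumes g: "good_seed m n d {n+1..m} R S"
  shows "good_seed (m + n) n d {n+1..m} R (deform m d R (bmat S))"
    and "full_rank ({1..n} \<union> {m+1..m+n}) n (bmat (deform m d R (bmat S)))"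
proof -
  note gd = good_seedD[OF g]
  let ?T = "deform m d R (bmat S)" and ?b = "bmat (deform m d R (bmat S))"
  have b: "?b k l = (if k \<le> m then bmat S k l else if k = m + l then int (d l) else 0)" for k l
    by (simp add: deform_def)
  have dpos: "d l > 0" if "l \<in> {1..n}" for l using gd(2) that by (simp add: exch_data_def)
  have "skew_symmetrizable n ?b"
    using gd(2,7) by (simp add: exch_data_def skew_symmetrizable_def b)
  then have B: "exch_data (m + n) n d ?b" using gd(2) by (auto simp: exch_data_def b)
  \<comment> \<open>The entry \<open>d i\<close> in row \<open>m + i\<close> is divisible by
    \<open>d i\<close>, as a seed requires, and being nonzero it alone makes the deformed
    \<open>P_i\<close> nonzero.\<close>
  have "ex_pol (m + n) d R ?b i \<noteq> 0" if i: "i \<in> {1..n}" for i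
    by (rule ex_pol_nonzero[OF gd(3) i, of "m + i"]) (use i B dpos[OF i] in \<open>auto simp: b\<close>)
  moreover have "rho ?T i r = ev (ext (m + n) (clus ?T)) (R i r)" if i: "i \<in> {1..n}" for i r
  proof -
    have "R i r \<in> vars (m + n)" using gd(3) i by (force simp: coef_data_def vars_iff)
    then show ?thesis by (simp add: deform_def ev_ext_lx)
  qed
  moreover have "laurent_indep (m + n) (clus ?T)" by (simp add: deform_def laurent_indep_lx)
  ultimately show "good_seed (m + n) n d {n+1..m} R ?T"
    unfolding good_seed_def using B gd(3) by auto
  show "full_rank ({1..n} \<union> {m+1..m+n}) n ?b"
    unfolding full_rank_def
  proof (intro allI impI ballI)
    fix v i assume v: "\<forall>l\<in>{1..n} \<union> {m+1..m+n}. (\<Sum>k=1..n. ?b l k * v k) = 0" and i: "i \<in> {1..n}"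
    \<comment> \<open>Row \<open>m + i\<close> is \<open>d i\<close> times a unit vector, so it
      isolates \<open>v i\<close>.\<close>
    have "(\<Sum>k=1..n. ?b (m + i) k * v k) = 0" using v i by auto
    also have "(\<Sum>k=1..n. ?b (m + i) k * v k) = (\<Sum>k=1..n. if k = i then int (d i) * v i else 0)"
      by (rule sum.cong) (use i in \<open>auto simp: b\<close>)
    finally show "v i = 0" using i dpos[OF i] by simp
  qed
qed

text \<open>The mutated variable is recovered as \<open>x_k = P_k / x'_k\<close>; all others are
  shared with the neighbouring seed.\<close>

lemma clus_in_upper_bound:
  assumes g: "good_seed m n d Z R S" and k: "k \<in> {1..m}"
  shows "clus S k \<in> upper_bound m n d S"
proof -
  have self: "clus S' k \<in> laurent_ring m S'" for S' :: "'a gseed"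
    using powi_in_laurent_ring[of m S' k 1] k by (simp add: ext_def)
  have "clus S k \<in> laurent_ring m (mutate m d i S)" if i: "i \<in> {1..n}" for i
  proof (cases "k = i")
    case False
    then show ?thesis using self[of "mutate m d i S"] by simp
  next
    case True
    let ?S = "mutate m d i S"
    note g' = good_seed_mutate[OF g i]
    have A: "is_subring (laurent_ring m ?S)" by (rule is_subring_laurent_ring[OF good_seedD(1)[OF g']])
    have "clus S k = clus (mutate m d i ?S) i" by (simp only: mutate_mutate_clus[OF g i] True)
    also have "\<dots> = inverse (clus ?S i) * exch_poly m d ?S i" by (simp add: new_var_def)
    also have "exch_poly m d ?S i \<in> laurent_ring m ?S"
      unfolding good_seedD(9)[OF g' i, symmetric] laurent_ring_def by blast
    moreover have "inverse (clus ?S i) \<in> laurent_ring m ?S"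
      using powi_in_laurent_ring[of m ?S i "- 1"] k True by (simp add: ext_def power_int_minus)
    ultimately show ?thesis by (simp add: subring_mult[OF A])
  qed
  then show ?thesis using self by (auto simp: upper_bound_def)
qed

text \<open>Specialising the extra frozen variables of the deformation to 1 maps the seeds equivalent to the
  deformed seed onto those equivalent to the original one. As the deformed cluster variables are Laurent
  polynomials, no denominators have to be specialised.\<close>

lemma deformed_cluster:
  assumes g: "good_seed m n d {n+1..m} R S" and eqv: "mutation_equivalent m n d S S'"
  shows "\<exists>T R' F. good_seed m n d {n+1..m} R' S' \<and> good_seed (m + n) n d {n+1..m} R' T \<and>
    full_rank ({1..n} \<union> {m+1..m+n}) n (bmat T) \<and>
    upper_bound (m + n) n d T \<subseteq> upper_bound (m + n) n d (deform m d R (bmat S)) \<and>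
    (\<forall>k\<in>{1..m}. \<forall>l\<in>{1..n}. bmat T k l = bmat S' k l) \<and>
    (\<forall>i\<in>{1..n}. \<forall>r\<le>d i. rho T i r = to_fract (R' i r) \<and> rho S' i r = ev (ext m (clus S)) (R' i r)) \<and>
    (\<forall>j\<in>{1..m+n}. F j \<in> vars (m + n) \<and> clus T j = to_fract (F j) \<and>
       ev (ext m (clus S)) (F j) = ext m (clus S') j)"
  using eqv unfolding mutation_equivalent_def
proof induction
  case base
  show ?case
    using g good_seed_deform[OF g] good_seedD(5)[OF g] good_seedD(7)[OF g]
    by (intro exI[of _ "deform m d R (bmat S)"] exI[of _ R] exI[of _ X])
      (auto simp: deform_def lx_def vars_iff lookup_single when_def)
next
  case (step S1 S2)
  let ?M = "m + n" and ?Def = "deform m d R (bmat S)" and ?\<psi> = "ext m (clus S)" and ?L = "{1..n} \<union> {m+1..m+n}"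
  note \<psi>0 = good_seedD(8)[OF g]
  obtain i where i: "i \<in> {1..n}" and S2: "S2 = mutate m d i S1" using step.hyps(2) by blast
  obtain T R' F where g1: "good_seed m n d {n+1..m} R' S1" and gT: "good_seed ?M n d {n+1..m} R' T"
    and fr: "full_rank ?L n (bmat T)"
    and ub: "upper_bound ?M n d T \<subseteq> upper_bound ?M n d ?Def"
    and bm: "\<And>k l. k \<in> {1..m} \<Longrightarrow> l \<in> {1..n} \<Longrightarrow> bmat T k l = bmat S1 k l"
    and rh: "\<And>i r. i \<in> {1..n} \<Longrightarrow> r \<le> d i \<Longrightarrow> rho T i r = to_fract (R' i r) \<and> rho S1 i r = ev ?\<psi> (R' i r)"
    and F: "\<And>j. j \<in> {1..?M} \<Longrightarrow> F j \<in> vars ?M \<and> clus T j = to_fract (F j) \<and> ev ?\<psi> (F j) = ext m (clus S1) j"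
    using step.IH by blast
  note gd = good_seedD[OF g1] and gdT = good_seedD[OF gT]
  have im: "i \<in> {1..m}" and iM: "i \<in> {1..?M}" using i gd(7) by auto
  let ?T = "mutate ?M d i T"
  have gT': "good_seed ?M n d {n+1..m} (rmut i d R') ?T" by (rule good_seed_mutate[OF gT i])
  have L: "{1..n} \<subseteq> ?L" "?L \<subseteq> {1..?M}" "?L \<inter> {n+1..m} = {}" using gd(7) by auto
  have ub': "upper_bound ?M n d ?T \<subseteq> upper_bound ?M n d ?Def"
    using upper_bound_mutate[OF gT i fr L] ub by blast
  \<comment> \<open>This is the Laurent phenomenon for the deformation: the upper bound of the
    current seed lies in the initial one, so the new variable is a Laurent polynomial
    \<open>H\<close> in the initial variables.\<close>
  have "clus ?T i \<in> upper_bound ?M n d ?Def" using clus_in_upper_bound[OF gT' iM] ub' by blast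
  then obtain H where "H \<in> vars ?M" "clus ?T i = ev (ext ?M (clus ?Def)) H"
    using upper_boundE[OF good_seed_deform(1)[OF g]] by metis
  then have H: "H \<in> vars ?M" "new_var ?M d T i = to_fract H"
    by (simp_all add: deform_def ev_ext_lx)
  \<comment> \<open>The exchange relation \<open>F i * H = Q\<close> is first pulled back from the
    fraction field to \<open>lau\<close>, where it can be specialised; \<open>F i\<close>
    specialises to a nonzero cluster variable, which determines the value of
    \<open>H\<close>.\<close>
  define Q where "Q = (\<Sum>r=0..d i. R' i r *
    (\<Prod>j=1..?M. F j ^ (r * nat (beta d (bmat T) j i) + (d i - r) * nat (- beta d (bmat T) j i))))"
  have "to_fract (F i * H) = exch_poly ?M d T i"
  proof -
    have "clus T i \<noteq> 0" using gdT(1) iM unfolding laurent_indep_def by blast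
    then show ?thesis using F[OF iM] H(2) by (simp flip: H(2) add: new_var_def)
  qed
  also have "exch_poly ?M d T i = to_fract Q"
    unfolding exch_poly_def Q_def to_fract_sum Let_def
    using rh[OF i] F by (intro sum.cong refl) (simp add: to_fract_prod to_fract_power beta_def)
  finally have FH: "F i * H = Q" by (simp only: to_fract_eq_iff)
  have "ev ?\<psi> Q = exch_poly m d S1 i"
  proof -
    have "ev ?\<psi> Q = (\<Sum>r=0..d i. rho S1 i r * (\<Prod>j=1..?M. ext m (clus S1) j ^
        (r * nat (beta d (bmat T) j i) + (d i - r) * nat (- beta d (bmat T) j i))))"
      unfolding Q_def ev_sum using rh[OF i] F
      by (intro sum.cong refl) (simp add: ev_mult[OF \<psi>0] ev_prod[OF \<psi>0] ev_power[OF \<psi>0])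
    \<comment> \<open>The extra variables have become 1, which removes the factors beyond
      \<open>m\<close>; the rows up to \<open>m\<close> of both matrices agree.\<close>
    also have "\<dots> = (\<Sum>r=0..d i. rho S1 i r * (\<Prod>j=1..m. clus S1 j ^
        (r * nat (beta d (bmat S1) j i) + (d i - r) * nat (- beta d (bmat S1) j i))))"
    proof (intro sum.cong refl arg_cong2[where f = "(*)"] prod.mono_neutral_cong_right)
      fix r j assume "j \<in> {1..m}"
      then show "ext m (clus S1) j ^ (r * nat (beta d (bmat T) j i) + (d i - r) * nat (- beta d (bmat T) j i)) =
        clus S1 j ^ (r * nat (beta d (bmat S1) j i) + (d i - r) * nat (- beta d (bmat S1) j i))"
        using bm[OF _ i, of j] by (simp add: ext_def beta_def)
    qed (auto simp: ext_def)
    finally show ?thesis by (simp add: exch_poly_def beta_def Let_def)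
  qed
  moreover have "clus S1 i \<noteq> 0" using gd(1) im unfolding laurent_indep_def by blast
  moreover have "ev ?\<psi> (F i) = clus S1 i" using F[OF iM] im by (simp add: ext_def)
  moreover have "ev ?\<psi> Q = ev ?\<psi> (F i) * ev ?\<psi> H" unfolding FH[symmetric] by (rule ev_mult[OF \<psi>0])
  ultimately have evH: "ev ?\<psi> H = new_var m d S1 i" by (simp add: new_var_def field_simps)
  show ?case
  proof (intro exI conjI)
    show "good_seed m n d {n+1..m} (rmut i d R') S2" unfolding S2 by (rule good_seed_mutate[OF g1 i])
    show "good_seed ?M n d {n+1..m} (rmut i d R') ?T" by (rule gT')
    show "full_rank ?L n (bmat ?T)"
      using full_rank_bmut[OF fr L(1) i] skew_diag[of n "bmat T" i] gdT(2) i by (simp add: exch_data_def)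
    show "upper_bound ?M n d ?T \<subseteq> upper_bound ?M n d ?Def" by (rule ub')
    show "\<forall>k\<in>{1..m}. \<forall>l\<in>{1..n}. bmat ?T k l = bmat S2 k l"
      unfolding S2 using bm im i by (auto simp: bmut_def)
    show "\<forall>j\<in>{1..n}. \<forall>r\<le>d j. rho ?T j r = to_fract (rmut i d R' j r) \<and> rho S2 j r = ev ?\<psi> (rmut i d R' j r)"
      unfolding S2 using rh by (auto simp: rmut_def)
    show "\<forall>j\<in>{1..?M}. (F(i := H)) j \<in> vars ?M \<and> clus ?T j = to_fract ((F(i := H)) j) \<and>
       ev ?\<psi> ((F(i := H)) j) = ext m (clus S2) j"
      unfolding S2 using F H evH im by (auto simp: ext_def)
  qed
qed

lemma ev_deformed_ex_pol:
  assumes g: "good_seed m n d Z R S" and i: "i \<in> {1..n}"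
  shows "ev (ext m (clus S)) (ex_pol (m + n) d R (bmat (deform m d R (bmat S))) i) = exch_poly m d S i"
proof -
  note gd = good_seedD[OF g]
  let ?\<psi> = "ext m (clus S)" and ?b = "bmat (deform m d R (bmat S))"
  have "mon ?\<psi> (ex_exp (m + n) d ?b i r) = mon ?\<psi> (ex_exp m d (bmat S) i r)" for r
  proof -
    have "mon ?\<psi> (ex_exp (m + n) d ?b i r) = (\<Prod>j=1..m+n. ?\<psi> j powi expo (ex_exp (m + n) d ?b i r) j)"
      by (rule mon_superset) (auto simp: in_keys_iff expo_ex_exp split: if_splits)
    also have "\<dots> = (\<Prod>j=1..m+n. ?\<psi> j powi expo (ex_exp m d (bmat S) i r) j)"
      by (rule prod.cong) (auto simp: ext_def expo_ex_exp beta_def deform_def)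
    also have "\<dots> = mon ?\<psi> (ex_exp m d (bmat S) i r)"
      by (rule mon_superset[symmetric]) (auto simp: in_keys_iff expo_ex_exp split: if_splits)
    finally show ?thesis .
  qed
  then have "ev ?\<psi> (ex_pol (m + n) d R ?b i) = ev ?\<psi> (ex_pol m d R (bmat S) i)"
    by (simp add: ex_pol_def ev_sum ev_mult[OF gd(8)])
  then show ?thesis using gd(9)[OF i] by simp
qed

section \<open>Cluster variables and standard monomials of the original seed\<close>

definition lower_bound :: "nat \<Rightarrow> nat \<Rightarrow> (nat \<Rightarrow> nat) \<Rightarrow> 'a::field_char_0 gseed \<Rightarrow> 'a set" where
  "lower_bound m n d S = is_subring hull (ZP m n S \<union> clus S ` {1..n} \<union> new_var m d S ` {1..n})"

lemma is_subring_ZP: "is_subring (ZP m n S)"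
  unfolding ZP_def by (rule is_subring_hull)

lemma mon_in_ZP:
  assumes "\<And>j. j \<in> {1..n} \<Longrightarrow> expo e j = 0"
  shows "mon (ext m (clus S)) e \<in> ZP m n S"
  unfolding mon_def
proof (rule subring_prod[OF is_subring_ZP])
  fix j assume "j \<in> keys e"
  then have j: "j \<notin> {1..n}" using assms by (auto simp: in_keys_iff)
  show "ext m (clus S) j powi expo e j \<in> ZP m n S"
  proof (cases "j \<in> {1..m}")
    case True
    with j have "j \<in> {n+1..m}" by auto
    then have "clus S j \<in> ZP m n S" "inverse (clus S j) \<in> ZP m n S"
      unfolding ZP_def by (auto intro: hull_inc)
    then show ?thesis using True by (auto simp: ext_def power_int_def intro: subring_power is_subring_ZP)
  next
    case False
    then have "ext m (clus S) j = 1" by (simp only: ext_def if_False)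
    then show ?thesis by (simp add: subring_one[OF is_subring_ZP])
  qed
qed

text \<open>Acyclicity carries over to the deformation, which does not touch the mutable rows; so
  the Laurent form \<open>F k\<close> of the deformed variable lies in \<open>lower\<close> for all
  directions at once. Specialisation maps the generators of that ring into \<open>ZP\<close>, to
  \<open>x_j\<close> and to \<open>x'_j\<close>.\<close>

lemma cluster_variable_in_lower_bound:
  assumes g: "good_seed m n d {n+1..m} R S" and ac: "acyclic_seed n S"
    and eqv: "mutation_equivalent m n d S S'" and k: "k \<in> {1..n}"
  shows "clus S' k \<in> lower_bound m n d S"
proof -
  note gd = good_seedD[OF g]
  let ?M = "m + n" and ?Def = "deform m d R (bmat S)" and ?\<psi> = "ext m (clus S)" and ?L = "{1..n} \<union> {m+1..m+n}"
  let ?p = "ex_pol ?M d R (bmat ?Def)"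
  have km: "k \<in> {1..m}" and kM: "k \<in> {1..?M}" using k gd(7) by auto
  obtain T R' F where gT: "good_seed ?M n d {n+1..m} R' T"
    and ub: "upper_bound ?M n d T \<subseteq> upper_bound ?M n d ?Def"
    and F: "F k \<in> vars ?M" "clus T k = to_fract (F k)" "ev ?\<psi> (F k) = ext m (clus S') k"
    using deformed_cluster[OF g eqv] kM by blast
  note g0 = good_seed_deform[OF g]
  note gd0 = good_seedD[OF g0(1)]
  have "clus T k \<in> upper_bound ?M n d ?Def" using clus_in_upper_bound[OF gT kM] ub by blast
  then obtain G where G: "G \<in> vars ?M" "clus T k = ev (ext ?M (clus ?Def)) G"
    "\<And>j. j \<in> {1..n} \<Longrightarrow> G \<in> lower ?p {j}" using upper_boundE[OF g0(1)] by metis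
  have "clus ?Def = lx" by (simp add: deform_def)
  then have "G = F k" using G(1,2) F(2) by (simp add: ev_ext_lx)
  have "edges n (bmat ?Def) = {(i, j). i \<in> {1..n} \<and> j \<in> {1..n} \<and> bmat S i j > 0}"
    using gd(7) by (auto simp: edges_def deform_def)
  then have "acyclic (edges n (bmat ?Def))" using ac by (simp add: acyclic_seed_def)
  then have src: "sourced (edges n (bmat ?Def)) {1..n}" by (rule sourced_acyclic)
  have "(\<Inter>j\<in>{1..n}. lower ?p {j}) \<subseteq> lower ?p {1..n}"
    by (rule ex_pol_upper_subset_lower[OF gd0(3,2) g0(2) _ _ _ src gd0(6)]) (use gd(7) in auto)
  then have FL: "F k \<in> lower ?p {1..n}" using G(3) \<open>G = F k\<close> by blast
  have low: "is_subring (lower_bound m n d S)" unfolding lower_bound_def by (rule is_subring_hull)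
  have gens: "c \<in> ZP m n S \<Longrightarrow> c \<in> lower_bound m n d S"
    "j \<in> {1..n} \<Longrightarrow> clus S j \<in> lower_bound m n d S"
    "j \<in> {1..n} \<Longrightarrow> new_var m d S j \<in> lower_bound m n d S" for c j
    unfolding lower_bound_def by (auto intro: hull_inc)
  have "lower ?p {1..n} \<subseteq> {F. ev ?\<psi> F \<in> lower_bound m n d S}"
    unfolding lower_def
  proof (rule hull_minimal)
    show "is_subring {F. ev ?\<psi> F \<in> lower_bound m n d S}"
      using low unfolding is_subring_def by (auto simp: ev_mult[OF gd(8)] ev_diff)
    have "ev ?\<psi> F \<in> lower_bound m n d S" if "F \<in> rest {1..n}" for F
      by (rule ev_in_subring[OF low]) (use that in \<open>auto simp: rest_iff intro!: gens(1) mon_in_ZP\<close>)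
    moreover have "ev ?\<psi> (X j) \<in> lower_bound m n d S" if "j \<in> {1..n}" for j
      using gens(2)[OF that] that gd(7) by (simp add: ext_def)
    moreover have "ev ?\<psi> (Y ?p j) \<in> lower_bound m n d S" if j: "j \<in> {1..n}" for j
    proof -
      have "?\<psi> j = clus S j" using j gd(7) by (simp add: ext_def)
      then have "ev ?\<psi> (Y ?p j) = new_var m d S j"
        unfolding Y_def ev_mult[OF gd(8)] new_var_def ev_lmon mon_single ev_deformed_ex_pol[OF g j]
        by (simp only: power_int_minus power_int_1_right mult.commute)
      then show ?thesis using gens(3)[OF j] by simp
    qed
    ultimately show "rest {1..n} \<union> X ` {1..n} \<union> Y ?p ` {1..n} \<subseteq> {F. ev ?\<psi> F \<in> lower_bound m n d S}"
      by auto
  qed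
  then have "ev ?\<psi> (F k) \<in> lower_bound m n d S" using FL by blast
  then show ?thesis using F(3) km by (simp add: ext_def)
qed

lemma std_mon_independent:
  assumes g: "good_seed m n d {n+1..m} R S" and ac: "acyclic_seed n S"
  shows "lin_indep (ZP m n S) (int_exps {1..n}) (std_mon (clus S) (new_var m d S) {1..n})"
  unfolding lin_indep_def
proof (intro allI impI)
  note gd = good_seedD[OF g]
  let ?J = "{1..n}" and ?\<psi> = "ext m (clus S)" and ?p = "ex_pol m d R (bmat S)"
  fix T c assume T: "finite T \<and> T \<subseteq> int_exps ?J \<and> c ` T \<subseteq> ZP m n S \<and>
    (\<Sum>e\<in>T. c e * std_mon (clus S) (new_var m d S) ?J e) = 0"
  have sub: "is_subring (rest ?J \<inter> vars m)"
    using is_subring_rest[of ?J] is_subring_vars[of m] unfolding is_subring_def by blast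
  have "ZP m n S \<subseteq> ev ?\<psi> ` (rest ?J \<inter> vars m)"
    unfolding ZP_def
  proof (rule hull_minimal[where S = is_subring, OF _ is_subring_ev_image[OF gd(8) sub]])
    have "clus S j powi k \<in> ev ?\<psi> ` (rest ?J \<inter> vars m)" if j: "j \<in> {n+1..m}" for j k
    proof -
      have "xpow j k \<in> rest ?J \<inter> vars m"
        using j lmon_single_vars[of j m k] by (auto simp: rest_iff lookup_single when_def)
      moreover have "clus S j powi k = ev ?\<psi> (xpow j k)"
        using j by (simp add: ext_def)
      ultimately show ?thesis by blast
    qed
    from this[of _ 1] this[of _ "- 1"]
    show "clus S ` {n+1..m} \<union> inverse ` clus S ` {n+1..m} \<subseteq> ev ?\<psi> ` (rest ?J \<inter> vars m)"
      by (auto simp: power_int_minus)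
  qed
  then have "\<forall>z\<in>T. \<exists>C. C \<in> rest ?J \<inter> vars m \<and> c z = ev ?\<psi> C" using T by blast
  then obtain C where C: "\<And>z. z \<in> T \<Longrightarrow> C z \<in> rest ?J \<inter> vars m \<and> c z = ev ?\<psi> (C z)" by metis
  have \<psi>: "?\<psi> j = clus S j" if "j \<in> ?J" for j using that gd(7) by (simp add: ext_def)
  have Yj: "ev ?\<psi> (Y ?p j) = new_var m d S j" if "j \<in> ?J" for j
    unfolding Y_def ev_mult[OF gd(8)] new_var_def ev_lmon mon_single gd(9)[OF that] \<psi>[OF that]
    by (simp only: power_int_minus power_int_1_right mult.commute)
  have M: "std_mon (clus S) (new_var m d S) ?J z = ev ?\<psi> (std_mon X (Y ?p) ?J z)" for z
    unfolding std_mon_def ev_prod[OF gd(8)]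
    by (rule prod.cong) (simp_all add: ev_mult[OF gd(8)] ev_power[OF gd(8)] Yj \<psi> del: atLeastAtMost_iff)
  have Mv: "std_mon X (Y ?p) ?J z \<in> vars m" for z
    unfolding std_mon_def X_def Y_def using gd(7)
    by (intro subring_prod[OF is_subring_vars] subring_mult[OF is_subring_vars]
        subring_power[OF is_subring_vars] lmon_single_vars ex_pol_vars[OF gd(3,4)]) auto
  let ?G = "\<Sum>z\<in>T. C z * std_mon X (Y ?p) ?J z"
  have "ev ?\<psi> ?G = (\<Sum>z\<in>T. c z * std_mon (clus S) (new_var m d S) ?J z)"
    unfolding ev_sum ev_mult[OF gd(8)] M by (rule sum.cong) (use C in auto)
  then have "ev ?\<psi> ?G = 0" using T by simp
  moreover have "?G \<in> vars m"
    using C Mv by (intro subring_sum[OF is_subring_vars] subring_mult[OF is_subring_vars]) auto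
  ultimately have G0: "?G = 0" using gd(1) unfolding laurent_indep_def by blast
  have "acyclic (edges n (bmat S))" using ac by (simp add: acyclic_seed_def edges_def)
  then have "lin_indep (rest ?J) (int_exps ?J) (std_mon X (Y ?p) ?J)"
    by (intro triangular_independent[OF _ sourced_acyclic ex_pol_triangular[OF gd(3,2) subset_refl gd(6)]])
      auto
  from lin_indepD[OF this _ _ _ G0] T C have "C z = 0" if "z \<in> T" for z using that by blast
  then show "\<forall>z\<in>T. c z = 0" using C by auto
qed

section \<open>Translation between signed exponents and pairs of exponents\<close>

definition to_pair :: "(nat \<Rightarrow> int) \<Rightarrow> (nat \<Rightarrow> nat) \<times> (nat \<Rightarrow> nat)" where
  "to_pair z = (\<lambda>j. nat (z j), \<lambda>j. nat (- z j))"

definition of_pair :: "(nat \<Rightarrow> nat) \<times> (nat \<Rightarrow> nat) \<Rightarrow> nat \<Rightarrow> int" where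
  "of_pair = (\<lambda>(a, a') j. int (a j) - int (a' j))"

lemma of_to_pair: "of_pair (to_pair z) = z"
  by (auto simp: of_pair_def to_pair_def fun_eq_iff)

lemma to_of_pair:
  assumes "e \<in> standard_exps n"
  shows "to_pair (of_pair e) = e"
proof -
  obtain a a' where e: "e = (a, a')" by (rule prod.exhaust)
  have "a j = 0 \<or> a' j = 0" for j
    using assms unfolding e standard_exps_def by (cases "j \<in> {1..n}") auto
  then have "nat (int (a j) - int (a' j)) = a j" "nat (int (a' j) - int (a j)) = a' j" for j
    by (metis diff_zero nat_int nat_diff_distrib' diff_0_eq_0 of_nat_0 of_nat_0_le_iff)+
  then show ?thesis by (simp add: e of_pair_def to_pair_def)
qed

lemma to_pair_standard: "z \<in> int_exps {1..n} \<Longrightarrow> to_pair z \<in> standard_exps n"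
  by (auto simp: int_exps_def to_pair_def standard_exps_def)

lemma of_pair_int_exps: "e \<in> standard_exps n \<Longrightarrow> of_pair e \<in> int_exps {1..n}"
  by (auto simp: int_exps_def of_pair_def standard_exps_def)

lemma monomial_at_to_pair: "monomial_at m n d S (to_pair z) = std_mon (clus S) (new_var m d S) {1..n} z"
  by (simp add: monomial_at_def to_pair_def std_mon_def)

theorem corollary3p11:
  fixes m n :: nat and d :: "nat \<Rightarrow> nat" and S :: "'k::field_char_0 gseed"
  assumes "1 \<le> n" and "n \<le> m"
    and "generalized_seed m n d S"
    and "mutable_seed m n d S"
    and "acyclic_seed n S"
    and "coprime_seed m n d S"
  shows "is_basis (ZP m n S) (standard_exps n) (monomial_at m n d S)
           (generalized_cluster_algebra m n d S)"
proof -
  let ?A = "generalized_cluster_algebra m n d S" and ?v = "monomial_at m n d S"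
  let ?w = "std_mon (clus S) (new_var m d S) {1..n}"
  obtain R where g: "good_seed m n d {n+1..m} R S"
    using generalized_seed_good[OF assms(3,4,2)] by blast
  note gd = good_seedD[OF g]
  have v_of: "?v e = ?w (of_pair e)" if "e \<in> standard_exps n" for e
    using monomial_at_to_pair[of m n d S "of_pair e"] to_of_pair[OF that] by simp
  have "lin_indep (ZP m n S) (standard_exps n) ?v"
    unfolding lin_indep_def
  proof (intro allI impI ballI)
    fix T c e
    assume T: "finite T \<and> T \<subseteq> standard_exps n \<and> c ` T \<subseteq> ZP m n S \<and> (\<Sum>e\<in>T. c e * ?v e) = 0" and e: "e \<in> T"
    have toof: "to_pair (of_pair e) = e" if "e \<in> T" for e using T that by (intro to_of_pair[of e n]) auto
    have inj: "inj_on of_pair T" by (rule inj_on_inverseI) (rule toof)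
    have "(\<Sum>z\<in>of_pair ` T. c (to_pair z) * ?w z) = (\<Sum>e\<in>T. c e * ?v e)"
      unfolding sum.reindex[OF inj] using T by (intro sum.cong) (auto simp: toof v_of)
    then have sum0: "(\<Sum>z\<in>of_pair ` T. c (to_pair z) * ?w z) = 0" using T by simp
    have "c (to_pair (of_pair e)) = 0"
      by (rule lin_indepD[OF std_mon_independent[OF g assms(5)] _ _ _ sum0])
        (use T e of_pair_int_exps toof in auto)
    then show "c e = 0" by (simp add: toof[OF e])
  qed
  moreover have "lin_span (ZP m n S) (standard_exps n) ?v = ?A"
  proof
    have A: "is_subring ?A" unfolding generalized_cluster_algebra_def by (rule is_subring_hull)
    have ZA: "ZP m n S \<subseteq> ?A" unfolding generalized_cluster_algebra_def by (auto intro: hull_inc)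
    have cA: "clus S' i \<in> ?A" if "mutation_equivalent m n d S S'" "i \<in> {1..n}" for S' i
      unfolding generalized_cluster_algebra_def using that by (intro hull_inc) blast
    have x: "clus S i \<in> ?A" if "i \<in> {1..n}" for i
      by (rule cA[OF _ that]) (simp add: mutation_equivalent_def)
    have x': "new_var m d S i \<in> ?A" if "i \<in> {1..n}" for i
    proof -
      have "mutation_equivalent m n d S (mutate m d i S)"
        unfolding mutation_equivalent_def using that by (intro r_into_rtranclp) blast
      from cA[OF this that] show ?thesis by simp
    qed
    show "lin_span (ZP m n S) (standard_exps n) ?v \<subseteq> ?A"
    proof
      fix f assume "f \<in> lin_span (ZP m n S) (standard_exps n) ?v"
      then obtain T c where T: "f = (\<Sum>e\<in>T. c e * ?v e)" "c ` T \<subseteq> ZP m n S" by (auto simp: lin_span_def)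
      have vA: "?v e \<in> ?A" for e
        unfolding monomial_at_def using x x'
        by (auto simp: case_prod_unfold intro!: subring_prod[OF A] subring_mult[OF A] subring_power[OF A])
      show "f \<in> ?A"
        unfolding T(1) using T(2) ZA by (intro subring_sum[OF A] subring_mult[OF A] vA) auto
    qed
    have "?A \<subseteq> lower_bound m n d S"
      unfolding generalized_cluster_algebra_def
    proof (rule hull_minimal)
      show "is_subring (lower_bound m n d S)" unfolding lower_bound_def by (rule is_subring_hull)
      have "ZP m n S \<subseteq> lower_bound m n d S" unfolding lower_bound_def by (auto intro: hull_inc)
      then show "ZP m n S \<union> {clus S' i |S' i. mutation_equivalent m n d S S' \<and> i \<in> {1..n}} \<subseteq> lower_bound m n d S"
        using cluster_variable_in_lower_bound[OF g assms(5)] by blast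
    qed
    also have "\<dots> \<subseteq> lin_span (ZP m n S) (int_exps {1..n}) ?w"
      unfolding lower_bound_def
    proof (rule hull_subset_std_span[OF is_subring_ZP])
      \<comment> \<open>Straightening needs \<open>x_j x'_j\<close> to be a polynomial in the
        cluster over \<open>ZP\<close>; it is \<open>P_j\<close>, whose coefficients involve frozen
        variables only.\<close>
      fix j assume j: "j \<in> {1..n}"
      let ?H = "is_subring hull (ZP m n S \<union> clus S ` {1..n})"
      have H: "is_subring ?H" by (rule is_subring_hull)
      have ZH: "ZP m n S \<subseteq> ?H" by (auto intro: hull_inc)
      have "clus S j \<noteq> 0" using gd(1,7) j unfolding laurent_indep_def by simp
      then have "clus S j * new_var m d S j = exch_poly m d S j" by (simp add: new_var_def)
      also have "exch_poly m d S j \<in> ?H"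
        unfolding exch_poly_def Let_def
      proof (intro subring_sum[OF H] subring_mult[OF H] subring_prod[OF H] subring_power[OF H])
        fix r assume "r \<in> {0..d j}"
        then have "rho S j r = ev (ext m (clus S)) (R j r)" using gd(5)[OF j] by simp
        also have "\<dots> \<in> ZP m n S"
          by (rule ev_in_subring[OF is_subring_ZP mon_in_ZP])
            (use gd(3) j in \<open>auto simp: coef_data_def\<close>)
        finally show "rho S j r \<in> ?H" using ZH by blast
      next
        fix l assume l: "l \<in> {1..m}"
        show "clus S l \<in> ?H"
        proof (cases "l \<in> {1..n}")
          case True
          then show ?thesis by (auto intro: hull_inc)
        next
          case False
          then have "clus S l \<in> ZP m n S" using l unfolding ZP_def by (auto intro: hull_inc)
          then show ?thesis using ZH by blast
        qed
      qed
      finally show "clus S j * new_var m d S j \<in> ?H" .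
    qed simp
    also have "\<dots> \<subseteq> lin_span (ZP m n S) (standard_exps n) ?v"
    proof
      fix f assume "f \<in> lin_span (ZP m n S) (int_exps {1..n}) ?w"
      then obtain T c where T: "f = (\<Sum>z\<in>T. c z * ?w z)" "finite T" "T \<subseteq> int_exps {1..n}" "c ` T \<subseteq> ZP m n S"
        by (auto simp: lin_span_def)
      have inj: "inj_on to_pair T" by (rule inj_on_inverseI) (rule of_to_pair)
      have "(\<Sum>e\<in>to_pair ` T. c (of_pair e) * ?v e) = f"
        unfolding sum.reindex[OF inj] T(1) by (simp add: of_to_pair monomial_at_to_pair)
      moreover have "to_pair ` T \<subseteq> standard_exps n" using T(3) to_pair_standard by blast
      moreover have "(\<lambda>e. c (of_pair e)) ` to_pair ` T \<subseteq> ZP m n S" using T(4) by (auto simp: of_to_pair)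
      ultimately show "f \<in> lin_span (ZP m n S) (standard_exps n) ?v"
        using lin_spanI[of "to_pair ` T" "standard_exps n" "\<lambda>e. c (of_pair e)" "ZP m n S" ?v] T(2) by simp
    qed
    finally show "?A \<subseteq> lin_span (ZP m n S) (standard_exps n) ?v" .
  qed
  ultimately show ?thesis by (simp add: is_basis_def)
qed

end
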